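(* Let $H$ be a complex Hilbert space, let $p\in[-1,1]$ be a nonzero real number and let $\phi:B(H)^+\to B(H)^+$ be a bijective map such that \[ \phi(A\,\mathsf{m}_p\, B)=\phi(A)\,\mathsf{m}_p\, \phi(B)\quad\text{for all } A,B\in B(H)^+. \tag{1} \] Then there is an invertible bounded either linear or conjugate linear operator $T:H\to H$ such that \[ \phi(A)=\left(TA^{|p|}T^*\right)^{\frac{1}{|p|}}\quad\text{for all } A\in B(H)^+. \tag{2} \] Conversely, for every invertible bounded either linear or conjugate linear operator $T:H\to H$, the map $\phi:B(H)^+\to B(H)^+$ defined by (2) satisfies (1).
   Context: $B(H)^+$ is the set of all bounded positive semidefinite linear operators on $H$; positive powers of its elements are defined by continuous functional calculus. No continuity of $\phi$ is assumed. For a bounded conjugate linear operator $T$ on $H$, the adjoint $T^*$ is the bounded conjugate linear operator with $\langle Tx,y\rangle=\langle T^*y,x\rangle$ for all $x,y\in H$. The conventional $p$th power mean $\mathsf{m}_p$ on $B(H)^+$ is defined as follows. For $0<p\le 1$, \[ A\,\mathsf{m}_p\, B=\left(\frac{A^p+B^p}{2}\right)^{\frac1p},\quad A,B\in B(H)^+. \] For $-1\le p<0$, with $q=-p$, \[ A\,\mathsf{m}_p\, B=\left(A^q\,\mathfrak{m}_{-1}\, B^q\right)^{\frac1q},\quad A,B\in B(H)^+, \] where $\mathfrak{m}_{-1}$ is the harmonic mean: $A\,\mathfrak{m}_{-1}\,B=2(A^{-1}+B^{-1})^{-1}$ for invertible $A,B\in B(H)^+$, and for general $A,B\in B(H)^+$,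 $A\,\mathfrak{m}_{-1}\,B$ is the limit in the strong operator topology of the (monotone decreasing) net $(A+\varepsilon I)\,\mathfrak{m}_{-1}\,(B+\varepsilon I)$ as $\varepsilon\downarrow 0$. *)

theory Defs
  imports "HOL-Analysis.Analysis" "HOL-Computational_Algebra.Polynomial"
begin

section \<open>Complex Hilbert spaces\<close>

text \<open>
  The type class is built on top of \<^class>\<open>real_inner\<close>, whose inner product is required to be the
  real part of the complex one. This loses no generality, and fixes the norm as
  the square root of \<open>cinner x x\<close>; positive definiteness is inherited.
  The form is linear in the first argument.
\<close>

class complex_hilbert = real_inner + banach +
  fixes scaleC :: "complex \<Rightarrow> 'a \<Rightarrow> 'a" (infixr "*\<^sub>C" 75)
    and cinner :: "'a \<Rightarrow> 'a \<Rightarrow> complex"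
  assumes scaleC_add_right: "c *\<^sub>C (x + y) = c *\<^sub>C x + c *\<^sub>C y"
    and scaleC_add_left: "(c + d) *\<^sub>C x = c *\<^sub>C x + d *\<^sub>C x"
    and scaleC_scaleC: "c *\<^sub>C d *\<^sub>C x = (c * d) *\<^sub>C x"
    and scaleC_of_real: "complex_of_real r *\<^sub>C x = r *\<^sub>R x"
    and cinner_add_left: "cinner (x + y) z = cinner x z + cinner y z"
    and cinner_scaleC_left: "cinner (c *\<^sub>C x) y = c * cinner x y"
    and cinner_commute: "cinner x y = cnj (cinner y x)"
    and inner_eq_Re_cinner: "inner x y = Re (cinner x y)"

instantiation complex :: complex_hilbert
begin

definition scaleC_complex :: "complex \<Rightarrow> complex \<Rightarrow> complex"
  where "scaleC_complex c x = c * x"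

definition cinner_complex :: "complex \<Rightarrow> complex \<Rightarrow> complex"
  where "cinner_complex x y = x * cnj y"

instance
  by standard
    (simp_all add: scaleC_complex_def cinner_complex_def algebra_simps scaleR_conv_of_real inner_complex_def)

end

lemma norm_scaleC:
  fixes x :: "'a::complex_hilbert"
  shows "norm (c *\<^sub>C x) = cmod c * norm x"
proof -
  have sq: "complex_of_real ((norm z)\<^sup>2) = cinner z z" for z :: 'a
  proof (rule complex_eqI)
    show "Re (complex_of_real ((norm z)\<^sup>2)) = Re (cinner z z)"
      by (simp add: power2_norm_eq_inner inner_eq_Re_cinner)
    have "Im (cinner z z) = - Im (cinner z z)"
      using arg_cong[OF cinner_commute[of z z], of Im] by simp
    then show "Im (complex_of_real ((norm z)\<^sup>2)) = Im (cinner z z)"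
      by simp
  qed
  have "cinner (c *\<^sub>C x) (c *\<^sub>C x) = c * cnj (c * cinner x x)"
    by (metis cinner_commute cinner_scaleC_left)
  also have "\<dots> = (c * cnj c) * cnj (cinner x x)"
    by simp
  also have "\<dots> = complex_of_real ((cmod c * norm x)\<^sup>2)"
    by (simp add: complex_norm_square[symmetric] sq[symmetric] power_mult_distrib)
  finally have "complex_of_real ((norm (c *\<^sub>C x))\<^sup>2) = complex_of_real ((cmod c * norm x)\<^sup>2)"
    by (simp only: sq)
  then have "(norm (c *\<^sub>C x))\<^sup>2 = (cmod c * norm x)\<^sup>2"
    by (simp only: of_real_eq_iff)
  then show ?thesis
    by (simp add: power2_eq_iff_nonneg)
qed

lemma bounded_linear_scaleC: "bounded_linear (\<lambda>x::'a::complex_hilbert. c *\<^sub>C x)"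
proof (rule bounded_linear_intro[where K = "cmod c"])
  fix r :: real and x y :: 'a
  show "c *\<^sub>C (x + y) = c *\<^sub>C x + c *\<^sub>C y"
    by (rule scaleC_add_right)
  show "c *\<^sub>C r *\<^sub>R x = r *\<^sub>R c *\<^sub>C x"
    by (simp add: scaleC_of_real[symmetric] scaleC_scaleC mult.commute)
  show "norm (c *\<^sub>C x) \<le> norm x * cmod c"
    by (simp add: norm_scaleC mult.commute)
qed


section \<open>Bounded operators\<close>

text \<open>
  Bounded linear and bounded conjugate linear operators are both real-linear and bounded, so both
  live in the type \<^typ>\<open>'a \<Rightarrow>\<^sub>L 'a\<close>.
\<close>

definition complex_linear :: "('a::complex_hilbert \<Rightarrow>\<^sub>L 'a) \<Rightarrow> bool"
  where "complex_linear A \<longleftrightarrow> (\<forall>c x. A (c *\<^sub>C x) = c *\<^sub>C A x)"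

definition conjugate_linear :: "('a::complex_hilbert \<Rightarrow>\<^sub>L 'a) \<Rightarrow> bool"
  where "conjugate_linear A \<longleftrightarrow> (\<forall>c x. A (c *\<^sub>C x) = cnj c *\<^sub>C A x)"

lift_definition scalar_op :: "complex \<Rightarrow> ('a::complex_hilbert \<Rightarrow>\<^sub>L 'a)"
  is "\<lambda>c x. c *\<^sub>C x"
  by (rule bounded_linear_scaleC)

definition invertible_op :: "('a::complex_hilbert \<Rightarrow>\<^sub>L 'a) \<Rightarrow> bool"
  where "invertible_op A \<longleftrightarrow> (\<exists>S. S o\<^sub>L A = id_blinfun \<and> A o\<^sub>L S = id_blinfun)"

definition inverse_op :: "('a::complex_hilbert \<Rightarrow>\<^sub>L 'a) \<Rightarrow> ('a \<Rightarrow>\<^sub>L 'a)"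
  where "inverse_op A = (THE S. S o\<^sub>L A = id_blinfun \<and> A o\<^sub>L S = id_blinfun)"

text \<open>
  The only operator that is both linear and conjugate linear is \<open>0\<close>, for which both
  branches give \<open>0\<close>.
\<close>

definition adjoint_op :: "('a::complex_hilbert \<Rightarrow>\<^sub>L 'a) \<Rightarrow> ('a \<Rightarrow>\<^sub>L 'a)"
  where "adjoint_op T =
    (if complex_linear T
     then (THE S. complex_linear S \<and> (\<forall>x y. cinner (T x) y = cinner x (S y)))
     else (THE S. conjugate_linear S \<and> (\<forall>x y. cinner (T x) y = cinner (S y) x)))"

definition positive_ops :: "('a::complex_hilbert \<Rightarrow>\<^sub>L 'a) set"
  where "positive_ops = {A. complex_linear A \<and> (\<forall>x. cinner (A x) x \<in> \<real>\<^sub>\<ge>\<^sub>0)}"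


section \<open>Continuous functional calculus\<close>

definition op_spectrum :: "('a::complex_hilbert \<Rightarrow>\<^sub>L 'a) \<Rightarrow> complex set"
  where "op_spectrum A = {c. \<not> invertible_op (A - scalar_op c)}"

primrec op_power :: "('a::complex_hilbert \<Rightarrow>\<^sub>L 'a) \<Rightarrow> nat \<Rightarrow> ('a \<Rightarrow>\<^sub>L 'a)"
  where
    "op_power A 0 = id_blinfun"
  | "op_power A (Suc n) = A o\<^sub>L op_power A n"

definition poly_op :: "real poly \<Rightarrow> ('a::complex_hilbert \<Rightarrow>\<^sub>L 'a) \<Rightarrow> ('a \<Rightarrow>\<^sub>L 'a)"
  where "poly_op P A = (\<Sum>i\<le>degree P. coeff P i *\<^sub>R op_power A i)"

text \<open>
  Only meant for self-adjoint \<open>A\<close> (whose spectrum is real) and \<open>f\<close> continuous on the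
  spectrum: \<open>cfc f A\<close> is the operator-norm limit of \<open>P n (A)\<close> for all real polynomials \<open>P n\<close>
  that converge to \<open>f\<close> uniformly on the spectrum.
\<close>

definition cfc :: "(real \<Rightarrow> real) \<Rightarrow> ('a::complex_hilbert \<Rightarrow>\<^sub>L 'a) \<Rightarrow> ('a \<Rightarrow>\<^sub>L 'a)"
  where "cfc f A = (THE F. \<forall>P :: nat \<Rightarrow> real poly.
    uniform_limit {t. complex_of_real t \<in> op_spectrum A} (\<lambda>n. poly (P n)) f sequentially
    \<longrightarrow> (\<lambda>n. poly_op (P n) A) \<longlonglongrightarrow> F)"

text \<open>Used for \<open>q > 0\<close> only; there \<open>0 powr q = 0\<close> is the continuous value at \<open>0\<close>.\<close>

definition positive_power :: "('a::complex_hilbert \<Rightarrow>\<^sub>L 'a) \<Rightarrow> real \<Rightarrow> ('a \<Rightarrow>\<^sub>L 'a)"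
  where "positive_power A q = cfc (\<lambda>t. t powr q) A"


section \<open>Power means\<close>

definition harmonic_mean_inv ::
    "('a::complex_hilbert \<Rightarrow>\<^sub>L 'a) \<Rightarrow> ('a \<Rightarrow>\<^sub>L 'a) \<Rightarrow> ('a \<Rightarrow>\<^sub>L 'a)"
  where "harmonic_mean_inv A B = 2 *\<^sub>R inverse_op (inverse_op A + inverse_op B)"

definition harmonic_mean ::
    "('a::complex_hilbert \<Rightarrow>\<^sub>L 'a) \<Rightarrow> ('a \<Rightarrow>\<^sub>L 'a) \<Rightarrow> ('a \<Rightarrow>\<^sub>L 'a)"
  where "harmonic_mean A B =
    (if invertible_op A \<and> invertible_op B then harmonic_mean_inv A B
     else (THE C :: 'a \<Rightarrow>\<^sub>L 'a. \<forall>x. ((\<lambda>\<epsilon>. harmonic_mean_inv (A + \<epsilon> *\<^sub>R id_blinfun) (B + \<epsilon> *\<^sub>R id_blinfun) x)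
       \<longlongrightarrow> blinfun_apply C x) (at_right 0)))"

definition power_mean ::
    "real \<Rightarrow> ('a::complex_hilbert \<Rightarrow>\<^sub>L 'a) \<Rightarrow> ('a \<Rightarrow>\<^sub>L 'a) \<Rightarrow> ('a \<Rightarrow>\<^sub>L 'a)"
  where "power_mean p A B =
    (if p > 0
     then positive_power ((1 / 2) *\<^sub>R (positive_power A p + positive_power B p)) (1 / p)
     else positive_power (harmonic_mean (positive_power A (- p)) (positive_power B (- p))) (1 / (- p)))"

end

theory Submission
  imports Defs "HOL-Computational_Algebra.Fundamental_Theorem_Algebra"
begin

text \<open>
  Replacing \<open>\<phi>\<close> by \<open>A \<mapsto> \<phi>(A\<^bsup>1/|p|\<^esup>)\<^bsup>|p|\<^esup>\<close> reduces the problem to bijections \<open>\<psi>\<close> of the positive cone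
  that preserve the arithmetic mean (\<open>p > 0\<close>) or the harmonic mean (\<open>p < 0\<close>).

  Arithmetic mean. Since \<open>\<psi>\<close> and its inverse are additive, \<open>\<psi>\<close> is an order isomorphism and
  positively homogeneous. The positive operators of rank at most one are those that dominate only
  their own multiples, so \<open>\<psi>\<close> permutes them. After normalising \<open>\<psi>(I) = I\<close>, \<open>\<psi>\<close> preserves norm and
  orthogonality of the vectors \<open>x\<close> that represent the rank-one operators \<open>x\<otimes>x\<close>. Fix a unit vector
  \<open>e\<close> and let \<open>\<psi>(e\<otimes>e) = f\<otimes>f\<close>; the linear extension of \<open>\<psi>\<close> maps \<open>z\<otimes>e + e\<otimes>z\<close> with \<open>z \<bottom> e\<close> to
  \<open>Uz\<otimes>f + f\<otimes>Uz\<close>. The map \<open>U\<close> is real-linear with \<open>U(iz) = \<plusminus>iUz\<close>, the sign being the same for all \<open>z\<close>,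
  and \<open>T(ae + z) = af + Uz\<close> (respectively with the conjugate of \<open>a\<close>) satisfies \<open>\<psi>(x\<otimes>x) = Tx\<otimes>Tx\<close>. A positive
  operator is determined by the rank-one operators below it, hence \<open>\<psi>(A) = TAT*\<close>.

  Harmonic mean. The rank-one operators are characterised by harmonic means being nonzero, and
  \<open>\<psi>(t x\<otimes>x) = t \<psi>(x\<otimes>x)\<close> because midpoint-affine bijections of the positive half-line are linear. Since the
  harmonic mean of \<open>x\<otimes>x\<close> and \<open>A\<close> is \<open>2s/(1+s) x\<otimes>x\<close> with \<open>s\<close> the strength of \<open>A\<close> along \<open>x\<close>, \<open>\<psi>\<close> preserves
  strengths. For invertible \<open>A\<close> the strength is \<open>\<langle>A\<^bsup>-1\<^esup>x,x\<rangle>\<^bsup>-1\<^esup>\<close>, so \<open>X \<mapsto> \<psi>(X\<^bsup>-1\<^esup>)\<^bsup>-1\<^esup>\<close> is additive and the first case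
  applies; the general \<open>A\<close> is the infimum of the operators \<open>A + \<epsilon>I\<close>.
\<close>

section \<open>Complex inner product and scalar multiplication\<close>

text \<open>No continuity is available, so homogeneity has to come from positivity: a nonnegative
  additive function on the half-line is linear, and surjectivity lets inequalities be pulled back as
  well as pushed forward. The reduction to \<psi> needs only that positive powers stay in the cone
  and that exponents \<open>q\<close> and \<open>1 / q\<close> undo each other. A rank-one operator
  fixes its vector only up to phase; the cross terms with a single \<open>e\<close> supply
  consistent phases for all vectors at once, because the extension of \<psi> is real-linear and all
  phases are measured against the one vector \<open>f\<close>. For the harmonic mean the obstacle is
  that singular operators have no inverse and that \<psi> is not known in advance to respect order,
  scaling or invertibility. The variational description of the mean treats singular and invertible
  operators alike, and strengths recover order, scaling and invertibility in turn before any inverse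
  is taken on the image side.\<close>

lemma scaleC_eq_Re_Im: "c *\<^sub>C x = Re c *\<^sub>R x + Im c *\<^sub>R (\<i> *\<^sub>C x)"
proof -
  have "c = complex_of_real (Re c) + complex_of_real (Im c) * \<i>"
    by (simp add: complex_eq_iff)
  then have "c *\<^sub>C x = complex_of_real (Re c) *\<^sub>C x + complex_of_real (Im c) *\<^sub>C \<i> *\<^sub>C x"
    by (metis scaleC_add_left scaleC_scaleC)
  then show ?thesis by (simp add: scaleC_of_real)
qed

lemma scaleC_zero_left [simp]: "0 *\<^sub>C x = 0"
  using scaleC_of_real[of 0 x] by simp

lemma scaleC_zero_right [simp]: "c *\<^sub>C 0 = 0"
  using norm_scaleC[of c 0] by simp

lemma scaleC_one [simp]: "1 *\<^sub>C x = x"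
  using scaleC_of_real[of 1 x] by simp

lemma scaleC_ii_ii [simp]: "\<i> *\<^sub>C \<i> *\<^sub>C x = - x"
  using scaleC_of_real[of "-1" x] by (simp add: scaleC_scaleC)

lemma scaleC_minus_left: "(- c) *\<^sub>C x = - (c *\<^sub>C x)"
  by (metis add.inverse_unique add.left_inverse scaleC_add_left scaleC_zero_left add.inverse_inverse)

lemma scaleC_minus_right: "c *\<^sub>C (- x) = - (c *\<^sub>C x)"
  by (metis add.inverse_unique add.right_inverse scaleC_add_right scaleC_zero_right)

lemma scaleC_diff_right: "c *\<^sub>C (x - y) = c *\<^sub>C x - c *\<^sub>C y"
  by (metis scaleC_add_right scaleC_minus_right diff_conv_add_uminus)

lemma scaleC_scaleR: "c *\<^sub>C (r *\<^sub>R x) = r *\<^sub>R (c *\<^sub>C x)"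
  by (simp add: scaleC_of_real[symmetric] scaleC_scaleC mult.commute)

lemma cinner_scaleC_right: "cinner x (c *\<^sub>C y) = cnj c * cinner x y"
  by (metis cinner_commute cinner_scaleC_left complex_cnj_mult)

lemma cinner_add_right: "cinner x (y + z) = cinner x y + cinner x z"
  by (metis cinner_commute cinner_add_left complex_cnj_add)

lemma cinner_scaleR_left: "cinner (r *\<^sub>R x) y = r * cinner x y"
  by (metis cinner_scaleC_left scaleC_of_real)

lemma cinner_scaleR_right: "cinner x (r *\<^sub>R y) = r * cinner x y"
  by (metis cinner_scaleC_right scaleC_of_real complex_cnj_complex_of_real)

lemma cinner_minus_left: "cinner (- x) y = - cinner x y"
  using cinner_scaleR_left[of "-1" x y] by simp

lemma cinner_minus_right: "cinner x (- y) = - cinner x y"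
  using cinner_scaleR_right[of x "-1" y] by simp

lemma cinner_diff_left: "cinner (x - y) z = cinner x z - cinner y z"
  by (metis cinner_add_left cinner_minus_left diff_conv_add_uminus)

lemma cinner_diff_right: "cinner x (y - z) = cinner x y - cinner x z"
  by (metis cinner_add_right cinner_minus_right diff_conv_add_uminus)

lemma cinner_zero_left [simp]: "cinner 0 x = 0"
  using cinner_scaleR_left[of 0 x x] by simp

lemma cinner_zero_right [simp]: "cinner x 0 = 0"
  using cinner_scaleR_right[of x 0 x] by simp

lemma Re_cinner: "Re (cinner x y) = inner x y"
  by (simp add: inner_eq_Re_cinner)

lemma Im_cinner: "Im (cinner x y) = inner x (\<i> *\<^sub>C y)"
  by (simp add: inner_eq_Re_cinner cinner_scaleC_right)

lemma cinner_eq_Complex: "cinner x y = Complex (inner x y) (inner x (\<i> *\<^sub>C y))"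
  by (simp add: complex_eq_iff Re_cinner Im_cinner)

lemma inner_ii_left: "inner (\<i> *\<^sub>C x) y = - inner x (\<i> *\<^sub>C y)"
  by (simp add: inner_eq_Re_cinner cinner_scaleC_right cinner_scaleC_left)

lemma inner_ii_self [simp]: "inner x (\<i> *\<^sub>C x) = 0" "inner (\<i> *\<^sub>C x) x = 0"
  using inner_ii_left[of x x] by (simp_all add: inner_commute)

lemma inner_scaleC_scaleC: "inner (c *\<^sub>C x) (c *\<^sub>C y) = (cmod c)\<^sup>2 * inner x y"
proof -
  have "cinner (c *\<^sub>C x) (c *\<^sub>C y) = (c * cnj c) * cinner x y"
    by (simp add: cinner_scaleC_right cinner_scaleC_left)
  also have "\<dots> = complex_of_real ((cmod c)\<^sup>2) * cinner x y"
    using complex_norm_square[of c] by simp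
  finally show ?thesis by (simp add: inner_eq_Re_cinner Re_complex_of_real)
qed

lemma cinner_self: "cinner x x = complex_of_real ((norm x)\<^sup>2)"
  by (simp add: cinner_eq_Complex complex_eq_iff power2_norm_eq_inner)

lemma cmod_cinner_commute: "cmod (cinner x y) = cmod (cinner y x)"
  by (metis cinner_commute complex_mod_cnj)

text \<open>A unimodular \<open>c\<close> rotates the complex inner product onto the nonnegative
  half-line; this lifts Cauchy-Schwarz inequalities from the real inner product to the complex
  one.\<close>

lemma cmod_cinner_eq_inner: "\<exists>c. cmod c = 1 \<and> cmod (cinner x y) = inner (c *\<^sub>C x) y"
proof (cases "cinner x y = 0")
  case True then show ?thesis by (intro exI[of _ 1]) (simp add: inner_eq_Re_cinner)
next
  case False
  define c where "c = cnj (cinner x y) / cmod (cinner x y)"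
  have "c * cinner x y = complex_of_real ((cmod (cinner x y))\<^sup>2) / cmod (cinner x y)"
    unfolding c_def using complex_norm_square[of "cinner x y"] by (simp add: mult.commute)
  then have "c * cinner x y = cmod (cinner x y)"
    using False by (simp add: power2_eq_square)
  then have "inner (c *\<^sub>C x) y = cmod (cinner x y)"
    by (simp add: inner_eq_Re_cinner cinner_scaleC_left)
  moreover have "cmod c = 1" using False by (simp add: c_def norm_divide)
  ultimately show ?thesis by auto
qed

lemma cmod_cinner_le: "cmod (cinner x y) \<le> norm x * norm y"
proof -
  obtain c where "cmod c = 1" "cmod (cinner x y) = inner (c *\<^sub>C x) y"
    using cmod_cinner_eq_inner by blast
  then show ?thesis using norm_cauchy_schwarz[of "c *\<^sub>C x" y] by (simp add: norm_scaleC)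
qed

section \<open>Self-adjoint and positive operators\<close>

lemma complex_linear_iff: "complex_linear A \<longleftrightarrow> (\<forall>x. A (\<i> *\<^sub>C x) = \<i> *\<^sub>C A x)"
proof
  assume A: "\<forall>x. A (\<i> *\<^sub>C x) = \<i> *\<^sub>C A x"
  have "A (c *\<^sub>C x) = c *\<^sub>C A x" for c x
    unfolding scaleC_eq_Re_Im[of c x] scaleC_eq_Re_Im[of c "A x"]
    by (simp add: blinfun.add_right blinfun.scaleR_right A)
  then show "complex_linear A" by (simp add: complex_linear_def)
qed (simp add: complex_linear_def)

lemma conjugate_linear_iff: "conjugate_linear A \<longleftrightarrow> (\<forall>x. A (\<i> *\<^sub>C x) = - (\<i> *\<^sub>C A x))"
proof
  assume "conjugate_linear A"
  then show "\<forall>x. A (\<i> *\<^sub>C x) = - (\<i> *\<^sub>C A x)"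
    by (simp add: conjugate_linear_def scaleC_minus_left)
next
  assume A: "\<forall>x. A (\<i> *\<^sub>C x) = - (\<i> *\<^sub>C A x)"
  have "A (c *\<^sub>C x) = cnj c *\<^sub>C A x" for c x
    unfolding scaleC_eq_Re_Im[of c x] scaleC_eq_Re_Im[of "cnj c" "A x"]
    by (simp add: blinfun.add_right blinfun.scaleR_right A)
  then show "conjugate_linear A" by (simp add: conjugate_linear_def)
qed

text \<open>Symmetry is asked only of the real inner product. Together with complex linearity it
  gives the complex identity, see \<open>selfadj_cinner\<close>, and the estimates can stay
  real.\<close>

definition selfadj :: "('a::complex_hilbert \<Rightarrow>\<^sub>L 'a) \<Rightarrow> bool"
  where "selfadj A \<longleftrightarrow> complex_linear A \<and> (\<forall>x y. inner (A x) y = inner x (A y))"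

definition qf :: "('a::complex_hilbert \<Rightarrow>\<^sub>L 'a) \<Rightarrow> 'a \<Rightarrow> real"
  where "qf A x = inner (A x) x"

text \<open>The Loewner order, read off from quadratic forms without requiring self-adjointness;
  antisymmetry therefore carries that hypothesis separately.\<close>

definition le_op :: "('a::complex_hilbert \<Rightarrow>\<^sub>L 'a) \<Rightarrow> ('a \<Rightarrow>\<^sub>L 'a) \<Rightarrow> bool"  (infix "\<sqsubseteq>" 50)
  where "A \<sqsubseteq> B \<longleftrightarrow> (\<forall>x. qf A x \<le> qf B x)"

lemma complex_linear_ii: "complex_linear A \<Longrightarrow> A (\<i> *\<^sub>C x) = \<i> *\<^sub>C A x"
  by (simp add: complex_linear_def)

lemma selfadj_complex_linear: "selfadj A \<Longrightarrow> complex_linear A"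
  by (simp add: selfadj_def)

lemma selfadj_inner: "selfadj A \<Longrightarrow> inner (A x) y = inner x (A y)"
  by (simp add: selfadj_def)

lemma selfadj_cinner: "selfadj A \<Longrightarrow> cinner (A x) y = cinner x (A y)"
  by (simp add: cinner_eq_Complex selfadj_inner complex_linear_ii[symmetric] selfadj_complex_linear)

lemma qf_simps [simp]:
  "qf 0 x = 0" "qf A 0 = 0" "qf (A + B) x = qf A x + qf B x" "qf (A - B) x = qf A x - qf B x"
  "qf (r *\<^sub>R A) x = r * qf A x" "qf id_blinfun x = (norm x)\<^sup>2" "qf (- A) x = - qf A x"
  "qf A (r *\<^sub>R x) = r\<^sup>2 * qf A x" "qf A (- x) = qf A x"
  by (simp_all add: qf_def blinfun.bilinear_simps inner_simps power2_norm_eq_inner[symmetric] power2_eq_square[of r])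

lemma qf_add: "selfadj A \<Longrightarrow> qf A (x + y) = qf A x + qf A y + 2 * inner (A x) y"
  using selfadj_inner[of A y x] by (simp add: qf_def blinfun.add_right inner_simps inner_commute)

lemma qf_diff: "selfadj A \<Longrightarrow> qf A (x - y) = qf A x + qf A y - 2 * inner (A x) y"
  using selfadj_inner[of A y x] by (simp add: qf_def blinfun.diff_right inner_simps inner_commute)

lemma qf_scaleC: "complex_linear A \<Longrightarrow> qf A (c *\<^sub>C x) = (cmod c)\<^sup>2 * qf A x"
  by (simp add: qf_def complex_linear_def inner_scaleC_scaleC)

text \<open>Polarization: by \<open>qf_add\<close> the values of the form determine
  \<open>inner (A x) y\<close>.\<close>

lemma selfadj_eqI:
  assumes A: "selfadj A" and B: "selfadj B" and eq: "\<And>x. qf A x = qf B x"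
  shows "A = B"
proof (rule blinfun_eqI)
  fix x
  have "inner (A x) y = inner (B x) y" for y
    using qf_add[OF A, of x y] qf_add[OF B, of x y] by (simp add: eq)
  then have "inner (A x - B x) (A x - B x) = 0" by (simp add: inner_diff_left)
  then show "A x = B x" by simp
qed

lemma complex_linear_intros [intro, simp]:
  "complex_linear 0" "complex_linear id_blinfun"
  "complex_linear A \<Longrightarrow> complex_linear B \<Longrightarrow> complex_linear (A + B)"
  "complex_linear A \<Longrightarrow> complex_linear B \<Longrightarrow> complex_linear (A - B)"
  "complex_linear A \<Longrightarrow> complex_linear B \<Longrightarrow> complex_linear (A o\<^sub>L B)"
  "complex_linear A \<Longrightarrow> complex_linear (r *\<^sub>R A)"
  "complex_linear (scalar_op c)"
  by (auto simp: complex_linear_def blinfun.bilinear_simps scaleC_add_right scaleC_diff_right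
      scaleC_scaleR scalar_op.rep_eq scaleC_scaleC mult.commute)

lemma conjugate_linear_compose:
  "conjugate_linear A \<Longrightarrow> conjugate_linear B \<Longrightarrow> complex_linear (A o\<^sub>L B)"
  "conjugate_linear A \<Longrightarrow> complex_linear B \<Longrightarrow> conjugate_linear (A o\<^sub>L B)"
  "complex_linear A \<Longrightarrow> conjugate_linear B \<Longrightarrow> conjugate_linear (A o\<^sub>L B)"
  by (auto simp: complex_linear_def conjugate_linear_def)

lemma selfadj_intros [intro, simp]:
  "selfadj 0" "selfadj id_blinfun"
  "selfadj A \<Longrightarrow> selfadj B \<Longrightarrow> selfadj (A + B)"
  "selfadj A \<Longrightarrow> selfadj B \<Longrightarrow> selfadj (A - B)"
  "selfadj A \<Longrightarrow> selfadj (r *\<^sub>R A)"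
  by (auto simp: selfadj_def blinfun.bilinear_simps inner_simps)

lemma selfadj_uminus [simp]: "selfadj A \<Longrightarrow> selfadj (- A)"
  using selfadj_intros(5)[of A "-1"] by simp

text \<open>On a complex space a real-valued form forces self-adjointness: the vanishing imaginary
  part is polarized, and multiplying one argument by \<open>\<i>\<close> turns the resulting skew
  identity into symmetry.\<close>

lemma positive_iff: "A \<in> positive_ops \<longleftrightarrow> selfadj A \<and> (\<forall>x. 0 \<le> qf A x)"
proof
  assume "A \<in> positive_ops"
  then have l: "complex_linear A" and p: "cinner (A x) x \<in> \<real>\<^sub>\<ge>\<^sub>0" for x
    by (auto simp: positive_ops_def)
  have pos: "0 \<le> qf A x" for x
    using p[of x] by (simp add: complex_nonneg_Reals_iff Re_cinner qf_def)
  have ii: "inner (A x) (\<i> *\<^sub>C x) = 0" for x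
    using p[of x] by (simp add: complex_nonneg_Reals_iff Im_cinner)
  have sk: "inner (A x) (\<i> *\<^sub>C y) = - inner (A y) (\<i> *\<^sub>C x)" for x y
    using ii[of "x + y"] ii[of x] ii[of y]
    by (simp add: blinfun.add_right scaleC_add_right inner_simps)
  have "inner (A x) y = inner x (A y)" for x y
    using sk[of x "\<i> *\<^sub>C y"] inner_ii_left[of "A y" "\<i> *\<^sub>C x"]
    by (simp add: complex_linear_ii[OF l] inner_commute)
  then show "selfadj A \<and> (\<forall>x. 0 \<le> qf A x)"
    using l pos by (simp add: selfadj_def)
next
  assume a: "selfadj A \<and> (\<forall>x. 0 \<le> qf A x)"
  then have l: "complex_linear A" by (simp add: selfadj_def)
  have "inner (A x) (\<i> *\<^sub>C x) = 0" for x
    using a selfadj_inner[of A x "\<i> *\<^sub>C x"] inner_ii_left[of x "A x"] l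
    by (simp add: complex_linear_ii inner_commute)
  then show "A \<in> positive_ops"
    using a l by (auto simp: positive_ops_def complex_nonneg_Reals_iff Re_cinner Im_cinner qf_def)
qed

lemma positive_selfadj: "A \<in> positive_ops \<Longrightarrow> selfadj A"
  by (simp add: positive_iff)

lemma positive_qf: "A \<in> positive_ops \<Longrightarrow> 0 \<le> qf A x"
  by (simp add: positive_iff)

lemma positive_intros [intro, simp]:
  "0 \<in> positive_ops" "id_blinfun \<in> positive_ops"
  "A \<in> positive_ops \<Longrightarrow> B \<in> positive_ops \<Longrightarrow> A + B \<in> positive_ops"
  "A \<in> positive_ops \<Longrightarrow> 0 \<le> r \<Longrightarrow> r *\<^sub>R A \<in> positive_ops"
  by (auto simp: positive_iff)

lemma diff_positive_iff:
  "selfadj A \<Longrightarrow> selfadj B \<Longrightarrow> B - A \<in> positive_ops \<longleftrightarrow> A \<sqsubseteq> B"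
  by (auto simp: positive_iff le_op_def)

lemma le_op_trans: "A \<sqsubseteq> B \<Longrightarrow> B \<sqsubseteq> C \<Longrightarrow> A \<sqsubseteq> C"
  by (meson le_op_def order_trans)

lemma le_op_refl [simp]: "A \<sqsubseteq> A"
  by (simp add: le_op_def)

lemma le_op_antisym: "selfadj A \<Longrightarrow> selfadj B \<Longrightarrow> A \<sqsubseteq> B \<Longrightarrow> B \<sqsubseteq> A \<Longrightarrow> A = B"
  by (rule selfadj_eqI) (auto simp: le_op_def intro: order_antisym)

section \<open>Norm estimates and Cauchy-Schwarz for positive forms\<close>

lemma abs_qf_le: "\<bar>qf A x\<bar> \<le> norm A * (norm x)\<^sup>2"
proof -
  have "\<bar>qf A x\<bar> \<le> norm (A x) * norm x"
    unfolding qf_def by (rule Cauchy_Schwarz_ineq2)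
  also have "\<dots> \<le> norm A * norm x * norm x"
    by (intro mult_right_mono norm_blinfun) auto
  finally show ?thesis by (simp add: power2_eq_square mult.assoc)
qed

lemma positive_norm_add: "selfadj A \<Longrightarrow> norm A \<le> c \<Longrightarrow> A + c *\<^sub>R id_blinfun \<in> positive_ops"
proof -
  assume "selfadj A" "norm A \<le> c"
  moreover have "0 \<le> qf A x + c * (norm x)\<^sup>2" for x
    using abs_qf_le[of A x] mult_right_mono[OF \<open>norm A \<le> c\<close>, of "(norm x)\<^sup>2"] by simp
  ultimately show ?thesis by (simp add: positive_iff)
qed

lemma le_op_norm: "norm A \<le> c \<Longrightarrow> A \<sqsubseteq> c *\<^sub>R id_blinfun"
  unfolding le_op_def
proof (intro allI)
  fix x assume "norm A \<le> c"
  then show "qf A x \<le> qf (c *\<^sub>R id_blinfun) x"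
    using abs_qf_le[of A x] mult_right_mono[OF \<open>norm A \<le> c\<close>, of "(norm x)\<^sup>2"] by simp
qed

lemma positive_Cauchy_Schwarz:
  assumes A: "A \<in> positive_ops"
  shows "(inner (A x) y)\<^sup>2 \<le> qf A x * qf A y"
proof -
  have s: "selfadj A" using A by (rule positive_selfadj)
  have q: "0 \<le> qf A x + t\<^sup>2 * qf A y + 2 * t * inner (A x) y" for t
    using positive_qf[OF A, of "x + t *\<^sub>R y"] by (simp add: qf_add[OF s])
  have x0: "0 \<le> qf A x" "0 \<le> qf A y" by (simp_all add: positive_qf A)
  show ?thesis
  proof (cases "qf A y = 0")
    case True
    have "inner (A x) y = 0"
    proof (rule ccontr)
      assume n: "inner (A x) y \<noteq> 0"
      \<comment> \<open>With \<open>qf A y = 0\<close> the nonnegative expression in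
        \<open>q\<close> is affine in \<open>t\<close>; the chosen \<open>t\<close> gives it the
        value -1.\<close>
      show False
        using q[of "- (qf A x + 1) / (2 * inner (A x) y)"] n True x0 by (simp add: field_simps)
    qed
    then show ?thesis by (simp add: True)
  next
    case False
    then have p: "0 < qf A y" using x0 by simp
    \<comment> \<open>The quadratic in \<open>t\<close> is evaluated at its minimiser.\<close>
    have "0 \<le> qf A x + ((inner (A x) y) / qf A y)\<^sup>2 * qf A y - 2 * (inner (A x) y / qf A y) * inner (A x) y"
      using q[of "- inner (A x) y / qf A y"] by (simp add: algebra_simps)
    also have "\<dots> = qf A x - (inner (A x) y)\<^sup>2 / qf A y"
      using p by (simp add: field_simps power2_eq_square)
    finally show ?thesis using p by (simp add: field_simps)
  qed
qed

lemma positive_cinner_Cauchy_Schwarz: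
  assumes A: "A \<in> positive_ops"
  shows "(cmod (cinner (A x) y))\<^sup>2 \<le> qf A x * qf A y"
proof -
  obtain c where c: "cmod c = 1" "cmod (cinner (A x) y) = inner (c *\<^sub>C A x) y"
    using cmod_cinner_eq_inner by blast
  have l: "complex_linear A" using A by (simp add: positive_iff selfadj_def)
  have "(cmod (cinner (A x) y))\<^sup>2 = (inner (A (c *\<^sub>C x)) y)\<^sup>2"
    using l c(2) by (simp add: complex_linear_def)
  also have "\<dots> \<le> qf A (c *\<^sub>C x) * qf A y" by (rule positive_Cauchy_Schwarz[OF A])
  finally show ?thesis by (simp add: qf_scaleC[OF l] c(1))
qed

lemma square_le_mult_cancel:
  fixes a b :: real
  assumes "a * a \<le> b * a" "0 \<le> a"
  shows "a = 0 \<or> a \<le> b"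
  using assms by (metis mult_le_cancel_right order_le_less not_less)

text \<open>Cauchy-Schwarz for the form of \<open>A\<close>, applied to \<open>x\<close> and
  \<open>A x\<close>, bounds the fourth power of \<open>norm (A x)\<close>; cancelling a square
  leaves the operator bound.\<close>

lemma positive_norm_le:
  assumes A: "A \<in> positive_ops" and c: "A \<sqsubseteq> c *\<^sub>R id_blinfun" "0 \<le> c"
  shows "norm A \<le> c"
proof (rule norm_blinfun_bound[OF c(2)])
  fix x
  have u: "qf A y \<le> c * (norm y)\<^sup>2" for y using c by (simp add: le_op_def)
  have "((norm (A x))\<^sup>2)\<^sup>2 = (inner (A x) (A x))\<^sup>2" by (simp add: power2_norm_eq_inner)
  also have "\<dots> \<le> qf A x * qf A (A x)" by (rule positive_Cauchy_Schwarz[OF A])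
  also have "\<dots> \<le> (c * (norm x)\<^sup>2) * (c * (norm (A x))\<^sup>2)"
    by (intro mult_mono u positive_qf[OF A]) (simp add: c)
  finally have "(norm (A x))\<^sup>2 * (norm (A x))\<^sup>2 \<le> (c * norm x)\<^sup>2 * (norm (A x))\<^sup>2"
    by (simp add: power_mult_distrib power2_eq_square algebra_simps)
  then have "norm (A x) = 0 \<or> (norm (A x))\<^sup>2 \<le> (c * norm x)\<^sup>2"
    using square_le_mult_cancel by fastforce
  then show "norm (A x) \<le> c * norm x"
    using c(2) by (auto intro: power2_le_imp_le)
qed

text \<open>The same inequality with one factor kept as \<open>qf A x\<close>. It lets convergence
  of forms control convergence of vectors, and it shows that the form vanishes only on the
  kernel.\<close>

lemma positive_norm_square_le:
  assumes A: "A \<in> positive_ops"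
  shows "(norm (A x))\<^sup>2 \<le> norm A * qf A x"
proof -
  have "((norm (A x))\<^sup>2)\<^sup>2 = (inner (A x) (A x))\<^sup>2" by (simp add: power2_norm_eq_inner)
  also have "\<dots> \<le> qf A x * qf A (A x)" by (rule positive_Cauchy_Schwarz[OF A])
  also have "\<dots> \<le> qf A x * (norm A * (norm (A x))\<^sup>2)"
    using abs_qf_le[of A "A x"] by (intro mult_left_mono positive_qf[OF A]) simp
  finally have "(norm (A x))\<^sup>2 * (norm (A x))\<^sup>2 \<le> (norm A * qf A x) * (norm (A x))\<^sup>2"
    by (simp add: power2_eq_square algebra_simps)
  then have "norm (A x) = 0 \<or> (norm (A x))\<^sup>2 \<le> norm A * qf A x"
    using square_le_mult_cancel by fastforce
  then show ?thesis using positive_qf[OF A, of x] by auto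
qed

lemma positive_qf_eq_0: "A \<in> positive_ops \<Longrightarrow> qf A x = 0 \<Longrightarrow> A x = 0"
  using positive_norm_square_le[of A x] by simp

lemma positive_nonzero_qf: "A \<in> positive_ops \<Longrightarrow> A \<noteq> 0 \<Longrightarrow> \<exists>x. 0 < qf A x"
proof (rule ccontr)
  assume A: "A \<in> positive_ops" "A \<noteq> 0" and "\<nexists>x. 0 < qf A x"
  then have "qf A x = 0" for x using positive_qf[OF A(1), of x] by (metis order_le_less)
  then have "A = 0" by (intro blinfun_eqI) (simp add: positive_qf_eq_0[OF A(1)])
  then show False using A by simp
qed

section \<open>Invertibility and adjoints\<close>

lemma invertible_opI_bounded_below:
  fixes T :: "'a::complex_hilbert \<Rightarrow>\<^sub>L 'a"
  assumes surj: "surj (blinfun_apply T)" and bb: "\<And>x. norm x \<le> K * norm (T x)"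
  shows "invertible_op T"
proof -
  have inj: "inj (blinfun_apply T)"
  proof (rule injI)
    fix x y assume "T x = T y"
    then show "x = y" using bb[of "x - y"] by (simp add: blinfun.diff_right)
  qed
  define g where "g = inv (blinfun_apply T)"
  have Tg: "T (g y) = y" for y using surj by (simp add: g_def surj_f_inv_f)
  have gT: "g (T x) = x" for x using inj by (simp add: g_def inv_f_f)
  have "bounded_linear g"
  proof (rule bounded_linear_intro[where K = K])
    show "g (x + y) = g x + g y" for x y
      by (metis Tg gT blinfun.add_right)
    show "g (r *\<^sub>R x) = r *\<^sub>R g x" for r x
      by (metis Tg gT blinfun.scaleR_right)
    show "norm (g x) \<le> norm x * K" for x
      using bb[of "g x"] by (simp add: Tg mult.commute)
  qed
  then have "blinfun_apply (Blinfun g) = g" by (rule bounded_linear_Blinfun_apply)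
  then show ?thesis
    unfolding invertible_op_def
    by (intro exI[of _ "Blinfun g"] conjI blinfun_eqI) (simp_all add: Tg gT)
qed

lemma invertible_op_inverse:
  assumes "invertible_op A"
  shows "inverse_op A o\<^sub>L A = id_blinfun" "A o\<^sub>L inverse_op A = id_blinfun"
proof -
  have "\<exists>!S. S o\<^sub>L A = id_blinfun \<and> A o\<^sub>L S = id_blinfun"
  proof -
    obtain S where S: "S o\<^sub>L A = id_blinfun" "A o\<^sub>L S = id_blinfun"
      using assms by (auto simp: invertible_op_def)
    moreover have "S' = S" if S': "S' o\<^sub>L A = id_blinfun" for S'
    proof (rule blinfun_eqI)
      fix x
      have "S' x = S' (A (S x))"
        using arg_cong[OF S(2), of "\<lambda>F. blinfun_apply F x"] by simp
      also have "\<dots> = S x"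
        using arg_cong[OF S', of "\<lambda>F. blinfun_apply F (S x)"] by simp
      finally show "S' x = S x" .
    qed
    ultimately show ?thesis by blast
  qed
  from theI'[OF this] show "inverse_op A o\<^sub>L A = id_blinfun" "A o\<^sub>L inverse_op A = id_blinfun"
    by (auto simp: inverse_op_def)
qed

lemma inverse_op_apply [simp]:
  assumes "invertible_op A"
  shows "inverse_op A (A x) = x" "A (inverse_op A x) = x"
  using arg_cong[OF invertible_op_inverse(1)[OF assms], of "\<lambda>F. blinfun_apply F x"]
    arg_cong[OF invertible_op_inverse(2)[OF assms], of "\<lambda>F. blinfun_apply F x"] by simp_all

lemma invertible_opI:
  fixes A S :: "'a::complex_hilbert \<Rightarrow>\<^sub>L 'a"
  shows "(\<And>x. S (A x) = x) \<Longrightarrow> (\<And>x. A (S x) = x) \<Longrightarrow> invertible_op A"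
  unfolding invertible_op_def by (intro exI[of _ S] conjI blinfun_eqI) simp_all

lemma inverse_op_eqI:
  fixes A S :: "'a::complex_hilbert \<Rightarrow>\<^sub>L 'a"
  assumes "\<And>x. S (A x) = x" "\<And>x. A (S x) = x"
  shows "inverse_op A = S"
proof -
  have i: "invertible_op A" by (rule invertible_opI[OF assms])
  show ?thesis
    by (rule blinfun_eqI) (metis assms(2) inverse_op_apply(1)[OF i])
qed

lemma invertible_inverse_op: "invertible_op A \<Longrightarrow> invertible_op (inverse_op A)"
  by (rule invertible_opI[where S = A]) simp_all

lemma inverse_inverse_op: "invertible_op A \<Longrightarrow> inverse_op (inverse_op A) = A"
  by (rule inverse_op_eqI) simp_all

lemma invertible_op_compose: "invertible_op A \<Longrightarrow> invertible_op B \<Longrightarrow> invertible_op (A o\<^sub>L B)"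
  by (rule invertible_opI[where S = "inverse_op B o\<^sub>L inverse_op A"]) simp_all

text \<open>The inverse of the product, composed with \<open>A\<close>, is a left inverse of
  \<open>B\<close>; commutation makes it a right inverse too. This yields invertibility of a square
  root.\<close>

lemma invertible_op_factor:
  assumes AB: "invertible_op (A o\<^sub>L B)" and comm: "A o\<^sub>L B = B o\<^sub>L A"
  shows "invertible_op B"
proof (rule invertible_opI[where S = "inverse_op (A o\<^sub>L B) o\<^sub>L A"])
  let ?S = "inverse_op (A o\<^sub>L B)"
  have c: "A (B x) = B (A x)" for x
    using arg_cong[OF comm, of "\<lambda>F. blinfun_apply F x"] by simp
  have l: "?S (A (B x)) = x" for x using inverse_op_apply(1)[OF AB, of x] by simp
  have r: "A (B (?S x)) = x" for x using inverse_op_apply(2)[OF AB, of x] by simp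
  show "(?S o\<^sub>L A) (B x) = x" for x using l by simp
  show "B ((?S o\<^sub>L A) x) = x" for x
  proof -
    have "?S (A x) = A (?S x)"
    proof -
      have "?S (A x) = ?S (A (A (B (?S x))))" by (simp add: r)
      also have "\<dots> = ?S (A (B (A (?S x))))" by (simp add: c)
      also have "\<dots> = A (?S x)" by (rule l)
      finally show ?thesis .
    qed
    then show ?thesis using c r by simp
  qed
qed

lemma invertible_op_bounded_below:
  assumes "invertible_op A" shows "norm x \<le> norm (inverse_op A) * norm (A x)"
  using norm_blinfun[of "inverse_op A" "A x"] assms by simp

text \<open>Lax--Milgram; for small positive \<open>\<rho>\<close> the map \<open>x \<mapsto> x - \<rho> (T x - y)\<close> is a contraction.\<close>

lemma coercive_invertible:
  fixes T :: "'a::complex_hilbert \<Rightarrow>\<^sub>L 'a"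
  assumes c: "0 < c" and co: "\<And>x. c * (norm x)\<^sup>2 \<le> inner (T x) x"
  shows "invertible_op T"
proof (rule invertible_opI_bounded_below[where K = "1 / c"])
  \<comment> \<open>The summand \<open>c\<close> makes \<open>M\<close> positive and at least
    \<open>c\<close>. The value of \<open>\<rho>\<close> below minimises
    \<open>1 - 2 * \<rho> * c + \<rho>\<^sup>2 * M\<^sup>2\<close>, the square of the contraction
    constant \<open>k\<close>.\<close>
  define M where "M = norm T + c"
  define \<rho> where "\<rho> = c / M\<^sup>2"
  have M: "0 < M" "norm T \<le> M" "c \<le> M" using c by (simp_all add: M_def add_nonneg_pos)
  have \<rho>: "0 < \<rho>" using c M by (simp add: \<rho>_def)
  define k where "k = sqrt (1 - c\<^sup>2 / M\<^sup>2)"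
  have k2: "0 \<le> 1 - c\<^sup>2 / M\<^sup>2" using M c by (simp add: power_mono)
  have k: "0 \<le> k" "k < 1" using k2 c M by (simp_all add: k_def)
  have contr: "norm (x - \<rho> *\<^sub>R T x) \<le> k * norm x" for x
  proof (rule power2_le_imp_le)
    have "(norm (T x))\<^sup>2 \<le> (M * norm x)\<^sup>2"
      using order_trans[OF norm_blinfun[of T x] mult_right_mono[OF M(2)]] by (intro power_mono) auto
    then have T2: "\<rho>\<^sup>2 * (norm (T x))\<^sup>2 \<le> \<rho>\<^sup>2 * (M * norm x)\<^sup>2"
      by (simp add: mult_left_mono)
    have "(norm (x - \<rho> *\<^sub>R T x))\<^sup>2 = (norm x)\<^sup>2 - 2 * \<rho> * inner (T x) x + \<rho>\<^sup>2 * (norm (T x))\<^sup>2"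
      unfolding power2_norm_eq_inner
      by (simp add: inner_simps inner_commute power2_eq_square[of \<rho>] algebra_simps)
    also have "\<dots> \<le> (norm x)\<^sup>2 - 2 * \<rho> * (c * (norm x)\<^sup>2) + \<rho>\<^sup>2 * (M * norm x)\<^sup>2"
      using mult_left_mono[OF co[of x] less_imp_le[OF \<rho>]] T2 by (simp add: algebra_simps)
    also have "\<dots> = (1 - 2 * \<rho> * c + \<rho>\<^sup>2 * M\<^sup>2) * (norm x)\<^sup>2"
      by (simp add: algebra_simps power_mult_distrib)
    also have "1 - 2 * \<rho> * c + \<rho>\<^sup>2 * M\<^sup>2 = k\<^sup>2"
      using M k2 by (simp add: k_def \<rho>_def field_simps power2_eq_square)
    finally show "(norm (x - \<rho> *\<^sub>R T x))\<^sup>2 \<le> (k * norm x)\<^sup>2"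
      by (simp add: power_mult_distrib)
  qed (use k in simp)
  show "surj (blinfun_apply T)"
  proof (rule surjI)
    fix y
    have "\<exists>!x. x - \<rho> *\<^sub>R (T x - y) = x"
    proof (rule banach_fix_type[OF k])
      show "\<forall>x z. dist (x - \<rho> *\<^sub>R (T x - y)) (z - \<rho> *\<^sub>R (T z - y)) \<le> k * dist x z"
      proof (intro allI)
        fix x z
        have "x - \<rho> *\<^sub>R (T x - y) - (z - \<rho> *\<^sub>R (T z - y)) = (x - z) - \<rho> *\<^sub>R T (x - z)"
          by (simp add: blinfun.diff_right algebra_simps)
        then show "dist (x - \<rho> *\<^sub>R (T x - y)) (z - \<rho> *\<^sub>R (T z - y)) \<le> k * dist x z"
          using contr[of "x - z"] by (simp only: dist_norm)
      qed
    qed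
    then have "\<exists>x. T x = y" using \<rho> by auto
    then show "T (SOME x. T x = y) = y" by (rule someI_ex)
  qed
  show "norm x \<le> 1 / c * norm (T x)" for x
  proof -
    have "c * norm x * norm x \<le> norm (T x) * norm x"
      using order_trans[OF co[of x] norm_cauchy_schwarz] by (simp add: power2_eq_square mult.assoc)
    then have "c * norm x \<le> norm (T x)" by (cases "x = 0") auto
    then show ?thesis using c by (simp add: field_simps)
  qed
qed

section \<open>Riesz representation and adjoints\<close>

lemma riesz_representation:
  fixes f :: "'a::{real_inner,banach} \<Rightarrow> real"
  assumes f: "bounded_linear f"
  shows "\<exists>a. \<forall>x. f x = inner a x"
proof -
  interpret f: bounded_linear f by fact
  \<comment> \<open>If \<open>a\<close> represents \<open>f\<close>, then \<open>J x\<close> is the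
    squared distance from \<open>x\<close> to \<open>a\<close> minus the squared norm of
    \<open>a\<close>. Hence \<open>a\<close> is sought as the minimiser of \<open>J\<close>; the
    parallelogram identity in \<open>par\<close> makes minimising sequences Cauchy.\<close>
  define J where "J = (\<lambda>x. (norm x)\<^sup>2 - 2 * f x)"
  obtain K where K: "\<And>x. norm (f x) \<le> norm x * K" using f.bounded by blast
  have J_lower: "- K\<^sup>2 \<le> J x" for x
  proof -
    have "f x \<le> norm x * K" using K[of x] by simp
    then have "(norm x)\<^sup>2 - 2 * (norm x * K) \<le> J x" by (simp add: J_def)
    moreover have "- K\<^sup>2 \<le> (norm x)\<^sup>2 - 2 * (norm x * K)"
      using zero_le_power2[of "norm x - K"] by (simp add: power2_eq_square algebra_simps)
    ultimately show ?thesis by linarith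
  qed
  define m where "m = Inf (range J)"
  have bdd: "bdd_below (range J)" using J_lower by (auto intro!: bdd_belowI)
  have m_le: "m \<le> J x" for x unfolding m_def using bdd by (simp add: cInf_lower)
  have par: "(norm (x - y))\<^sup>2 \<le> 2 * (J x - m) + 2 * (J y - m)" for x y
  proof -
    define w where "w = (1/2) *\<^sub>R (x + y)"
    have "(norm (x - y))\<^sup>2 + 4 * J w = 2 * J x + 2 * J y"
      by (simp add: w_def J_def f.scaleR f.add power2_norm_eq_inner inner_simps inner_commute field_simps)
    then show ?thesis using m_le[of w] by (simp add: algebra_simps)
  qed
  have "\<exists>x. J x < m + 1 / real (Suc n)" for n
    using cInf_lessD[of "range J" "m + 1 / real (Suc n)"] by (auto simp: m_def)
  then obtain X where X: "\<And>n. J (X n) < m + 1 / real (Suc n)" by metis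
  have "Cauchy X"
  proof (rule metric_CauchyI)
    fix e :: real assume e: "0 < e"
    obtain N where N: "inverse (real (Suc N)) < e\<^sup>2 / 4"
      using e reals_Archimedean[of "e\<^sup>2 / 4"] by auto
    have "dist (X i) (X j) < e" if "N \<le> i" "N \<le> j" for i j
    proof -
      have b: "J (X k) - m < e\<^sup>2 / 4" if "N \<le> k" for k
      proof -
        have "1 / real (Suc k) \<le> inverse (real (Suc N))" using that by (simp add: field_simps)
        then show ?thesis using X[of k] N by linarith
      qed
      have "(norm (X i - X j))\<^sup>2 < e\<^sup>2" using par[of "X i" "X j"] b[OF that(1)] b[OF that(2)] by (simp add: algebra_simps)
      then show ?thesis using e by (simp add: dist_norm power2_less_imp_less)
    qed
    then show "\<exists>M. \<forall>i\<ge>M. \<forall>j\<ge>M. dist (X i) (X j) < e" by blast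
  qed
  then obtain a where a: "X \<longlonglongrightarrow> a" by (metis Cauchy_convergent_iff convergent_def)
  have "(\<lambda>n. J (X n)) \<longlonglongrightarrow> J a"
    unfolding J_def by (intro tendsto_intros a f.tendsto)
  moreover have "(\<lambda>n. m + 1 / real (Suc n)) \<longlonglongrightarrow> m + 0"
    by (intro tendsto_intros LIMSEQ_Suc[OF lim_1_over_n])
  ultimately have "J a \<le> m + 0"
    by (rule LIMSEQ_le) (use X less_imp_le in blast)
  then have "J a \<le> m" by simp
  have "f h = inner a h" for h
  proof (cases "h = 0")
    case False
    define d where "d = inner a h - f h"
    \<comment> \<open>The minimiser of \<open>J\<close> on the line through \<open>a\<close> in
      direction \<open>h\<close>; a nonzero \<open>d\<close> would push \<open>J\<close> below its
      infimum by \<open>d\<^sup>2 / (norm h)\<^sup>2\<close>.\<close>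
    define t where "t = - d / (norm h)\<^sup>2"
    have h: "(norm h)\<^sup>2 > 0" using False by simp
    have e1: "J a \<le> J (a + t *\<^sub>R h)" using \<open>J a \<le> m\<close> m_le order_trans by blast
    have e2: "J (a + t *\<^sub>R h) = J a + 2 * t * d + t\<^sup>2 * (norm h)\<^sup>2"
      unfolding J_def d_def power2_norm_eq_inner
      by (simp add: f.scaleR f.add inner_simps inner_commute power2_eq_square[of t] algebra_simps)
    have e3: "2 * t * d + t\<^sup>2 * (norm h)\<^sup>2 = - (d\<^sup>2 / (norm h)\<^sup>2)"
      using h by (simp add: t_def field_simps power2_eq_square)
    have "d\<^sup>2 / (norm h)\<^sup>2 \<le> 0" using e1 e2 e3 by linarith
    then have "d\<^sup>2 \<le> 0" using h by (simp add: field_simps)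
    then show ?thesis by (simp add: d_def)
  qed (simp add: f.zero)
  then show ?thesis by blast
qed

text \<open>Linear and conjugate linear operators are both real-linear, so one adjoint for the real
  inner product serves both kinds.\<close>

lemma real_adjoint_exists:
  fixes T :: "'a::{real_inner,banach} \<Rightarrow>\<^sub>L 'a"
  shows "\<exists>S :: 'a \<Rightarrow>\<^sub>L 'a. \<forall>x y. inner (T x) y = inner x (S y)"
proof -
  have "\<exists>a. \<forall>x. inner (T x) y = inner a x" for y
    by (rule riesz_representation) (intro bounded_linear_intros)
  then obtain g where g: "\<And>x y. inner (T x) y = inner (g y) x" by metis
  have eqI: "u = v" if "\<And>x. inner u x = inner v x" for u v :: 'a
    by (metis that inner_diff_left inner_eq_zero_iff right_minus_eq)
  have "bounded_linear g"
  proof (rule bounded_linear_intro[where K = "norm T"])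
    show "g (x + y) = g x + g y" for x y
      by (rule eqI) (simp add: inner_simps g[symmetric])
    show "g (r *\<^sub>R x) = r *\<^sub>R g x" for r x
      by (rule eqI) (simp add: inner_simps g[symmetric])
    show "norm (g x) \<le> norm x * norm T" for x
    proof -
      have "norm (g x) * norm (g x) = inner (T (g x)) x"
        by (simp add: g power2_norm_eq_inner[symmetric] power2_eq_square)
      also have "\<dots> \<le> norm (T (g x)) * norm x" by (rule norm_cauchy_schwarz)
      also have "\<dots> \<le> norm T * norm (g x) * norm x" by (intro mult_right_mono norm_blinfun) simp
      finally have "norm (g x) * norm (g x) \<le> (norm x * norm T) * norm (g x)"
        by (simp add: algebra_simps)
      then show ?thesis using square_le_mult_cancel[of "norm (g x)" "norm x * norm T"] by auto
    qed
  qed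
  then have "blinfun_apply (Blinfun g) = g" by (rule bounded_linear_Blinfun_apply)
  then show ?thesis by (intro exI[of _ "Blinfun g"]) (simp add: g inner_commute[of _ "g _"])
qed

text \<open>Moving \<open>\<i>\<close> across the real inner product shows that the real adjoint
  inherits linearity or conjugate linearity. It then fits the description in the matching branch of
  \<open>adjoint_op\<close>.\<close>

lemma adjoint_op_works:
  fixes T :: "'a::complex_hilbert \<Rightarrow>\<^sub>L 'a"
  assumes T: "complex_linear T \<or> conjugate_linear T"
  shows inner_adjoint_op: "inner (T x) y = inner x (adjoint_op T y)"
    and complex_linear_adjoint_op: "complex_linear T \<Longrightarrow> complex_linear (adjoint_op T)"
    and conjugate_linear_adjoint_op: "conjugate_linear T \<Longrightarrow> conjugate_linear (adjoint_op T)"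
proof -
  obtain S :: "'a \<Rightarrow>\<^sub>L 'a" where S: "\<And>x y. inner (T x) y = inner x (S y)"
    using real_adjoint_exists[of T] by blast
  have eqI: "u = v" if "\<And>x. inner x u = inner x v" for u v :: 'a
    by (metis that inner_diff_right inner_eq_zero_iff right_minus_eq)
  have lin: "complex_linear S" if "complex_linear T"
    unfolding complex_linear_iff
  proof (intro allI eqI)
    fix y z
    show "inner z (S (\<i> *\<^sub>C y)) = inner z (\<i> *\<^sub>C S y)"
      using that inner_ii_left[of z "S y"] inner_ii_left[of "T z" y]
        S[of z "\<i> *\<^sub>C y"] S[of "\<i> *\<^sub>C z" y]
      by (simp add: complex_linear_iff)
  qed
  have con: "conjugate_linear S" if "conjugate_linear T"
    unfolding conjugate_linear_iff
  proof (intro allI eqI)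
    fix y z
    show "inner z (S (\<i> *\<^sub>C y)) = inner z (- (\<i> *\<^sub>C S y))"
      using that inner_ii_left[of z "S y"] inner_ii_left[of "T z" y]
        S[of z "\<i> *\<^sub>C y"] S[of "\<i> *\<^sub>C z" y]
      by (simp add: conjugate_linear_iff)
  qed
  have "adjoint_op T = S"
  proof (cases "complex_linear T")
    case True
    have "(THE S. complex_linear S \<and> (\<forall>x y. cinner (T x) y = cinner x (S y))) = S"
    proof (rule the_equality)
      have "cinner (T x) y = cinner x (S y)" for x y
        using lin[OF True] by (simp add: cinner_eq_Complex S complex_linear_iff)
      then show "complex_linear S \<and> (\<forall>x y. cinner (T x) y = cinner x (S y))"
        using lin[OF True] by blast
    next
      fix S' assume "complex_linear S' \<and> (\<forall>x y. cinner (T x) y = cinner x (S' y))"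
      then have "inner x (S' y) = inner x (S y)" for x y
        using S by (metis Re_cinner)
      then show "S' = S" by (intro blinfun_eqI eqI)
    qed
    then show ?thesis using True by (simp add: adjoint_op_def)
  next
    case False
    then have cT: "conjugate_linear T" using T by blast
    have "(THE S. conjugate_linear S \<and> (\<forall>x y. cinner (T x) y = cinner (S y) x)) = S"
    proof (rule the_equality)
      have "cinner (T x) y = cinner (S y) x" for x y
      proof (rule complex_eqI)
        show "Re (cinner (T x) y) = Re (cinner (S y) x)"
          by (simp add: Re_cinner S inner_commute[of _ "S y"])
        show "Im (cinner (T x) y) = Im (cinner (S y) x)"
          using con[OF cT] inner_ii_left[of "S y" x]
          by (simp add: Im_cinner S conjugate_linear_iff inner_commute)
      qed
      then show "conjugate_linear S \<and> (\<forall>x y. cinner (T x) y = cinner (S y) x)"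
        using con[OF cT] by blast
    next
      fix S' assume "conjugate_linear S' \<and> (\<forall>x y. cinner (T x) y = cinner (S' y) x)"
      then have "inner x (S' y) = inner x (S y)" for x y
        using S by (metis Re_cinner inner_commute)
      then show "S' = S" by (intro blinfun_eqI eqI)
    qed
    then show ?thesis using False by (simp add: adjoint_op_def)
  qed
  then show "inner (T x) y = inner x (adjoint_op T y)"
    "complex_linear T \<Longrightarrow> complex_linear (adjoint_op T)"
    "conjugate_linear T \<Longrightarrow> conjugate_linear (adjoint_op T)"
    using S lin con by simp_all
qed

lemma adjoint_op_eqI:
  fixes S T :: "'a::complex_hilbert \<Rightarrow>\<^sub>L 'a"
  assumes T: "complex_linear T \<or> conjugate_linear T" and S: "\<And>x y. inner (T x) y = inner x (S y)"
  shows "adjoint_op T = S"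
proof (rule blinfun_eqI)
  fix y
  have "inner x (adjoint_op T y - S y) = 0" for x
    using inner_adjoint_op[OF T, of x y] S[of x y] by (simp add: inner_diff_right)
  then show "adjoint_op T y = S y" by (metis inner_eq_zero_iff right_minus_eq)
qed

section \<open>Congruences by linear and conjugate linear operators\<close>

definition congr_op :: "('a::complex_hilbert \<Rightarrow>\<^sub>L 'a) \<Rightarrow> ('a \<Rightarrow>\<^sub>L 'a) \<Rightarrow> ('a \<Rightarrow>\<^sub>L 'a)"
  where "congr_op T A = T o\<^sub>L A o\<^sub>L adjoint_op T"

definition semilinear :: "('a::complex_hilbert \<Rightarrow>\<^sub>L 'a) \<Rightarrow> bool"
  where "semilinear T \<longleftrightarrow> complex_linear T \<or> conjugate_linear T"

lemma congr_op_apply: "congr_op T A x = T (A (adjoint_op T x))"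
  by (simp add: congr_op_def)

lemma semilinear_adjoint: "semilinear T \<Longrightarrow> semilinear (adjoint_op T)"
  unfolding semilinear_def using complex_linear_adjoint_op conjugate_linear_adjoint_op by blast

lemma semilinear_inner: "semilinear T \<Longrightarrow> inner (T x) y = inner x (adjoint_op T y)"
  unfolding semilinear_def by (rule inner_adjoint_op)

lemma semilinear_compose: "semilinear S \<Longrightarrow> semilinear T \<Longrightarrow> semilinear (S o\<^sub>L T)"
  unfolding semilinear_def using conjugate_linear_compose by blast

lemma semilinear_complex_linear [simp]: "complex_linear T \<Longrightarrow> semilinear T"
  by (simp add: semilinear_def)

lemma adjoint_op_eqI':
  fixes S T :: "'a::complex_hilbert \<Rightarrow>\<^sub>L 'a"
  shows "semilinear T \<Longrightarrow> (\<And>x y. inner (T x) y = inner x (S y)) \<Longrightarrow> adjoint_op T = S"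
  unfolding semilinear_def by (rule adjoint_op_eqI)

lemma adjoint_selfadj: "selfadj A \<Longrightarrow> adjoint_op A = A"
  by (rule adjoint_op_eqI') (auto simp: selfadj_def)

lemma adjoint_compose:
  "semilinear S \<Longrightarrow> semilinear T \<Longrightarrow> adjoint_op (S o\<^sub>L T) = adjoint_op T o\<^sub>L adjoint_op S"
  by (rule adjoint_op_eqI'[OF semilinear_compose]) (simp_all add: semilinear_inner)

lemma qf_congr_op: "semilinear T \<Longrightarrow> qf (congr_op T A) x = qf A (adjoint_op T x)"
  by (simp add: qf_def congr_op_apply semilinear_inner)

text \<open>For conjugate linear \<open>T\<close> both outer factors are conjugate linear, and the
  composite is complex linear again.\<close>

lemma selfadj_congr_op:
  assumes T: "semilinear T" and A: "selfadj A" shows "selfadj (congr_op T A)"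
  unfolding selfadj_def
proof (intro conjI allI)
  show "inner (congr_op T A x) y = inner x (congr_op T A y)" for x y
    using semilinear_inner[OF T] A by (simp add: congr_op_apply selfadj_inner) (metis inner_commute)
  show "complex_linear (congr_op T A)"
    using T A conjugate_linear_adjoint_op[of T] complex_linear_adjoint_op[of T]
    by (auto simp: semilinear_def congr_op_def selfadj_def conjugate_linear_compose)
qed

lemma positive_congr_op: "semilinear T \<Longrightarrow> A \<in> positive_ops \<Longrightarrow> congr_op T A \<in> positive_ops"
  by (simp add: positive_iff selfadj_congr_op qf_congr_op)

lemma congr_op_linear:
  "congr_op T (A + B) = congr_op T A + congr_op T B"
  "congr_op T (r *\<^sub>R A) = r *\<^sub>R congr_op T A"
  by (simp_all add: blinfun_eqI congr_op_apply blinfun.bilinear_simps)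

lemma congr_op_mono: "semilinear T \<Longrightarrow> A \<sqsubseteq> B \<Longrightarrow> congr_op T A \<sqsubseteq> congr_op T B"
  by (simp add: le_op_def qf_congr_op)

lemma congr_op_compose:
  "semilinear S \<Longrightarrow> semilinear T \<Longrightarrow> congr_op S (congr_op T A) = congr_op (S o\<^sub>L T) A"
  by (simp add: blinfun_eqI congr_op_apply adjoint_compose)

lemma semilinear_inverse:
  assumes i: "invertible_op T" and T: "semilinear T" shows "semilinear (inverse_op T)"
proof -
  have *: "inverse_op T y = x" if "T x = y" for x y using that i by auto
  have "inverse_op T (\<i> *\<^sub>C y) = \<i> *\<^sub>C inverse_op T y" if "complex_linear T" for y
    by (rule *) (simp add: complex_linear_ii[OF that] i)
  moreover have "inverse_op T (\<i> *\<^sub>C y) = - (\<i> *\<^sub>C inverse_op T y)" if "conjugate_linear T" for y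
    by (rule *) (use that i in \<open>simp add: conjugate_linear_iff blinfun.minus_right\<close>)
  ultimately show ?thesis
    using T unfolding semilinear_def complex_linear_iff[of "inverse_op T"] conjugate_linear_iff[of "inverse_op T"]
    by blast
qed

lemma congr_op_id [simp]: "congr_op id_blinfun A = A"
  by (simp add: blinfun_eqI congr_op_apply adjoint_selfadj)

lemma congr_op_inverse:
  assumes "invertible_op T" "semilinear T"
  shows "congr_op T (congr_op (inverse_op T) A) = A" "congr_op (inverse_op T) (congr_op T A) = A"
  using assms by (simp_all add: congr_op_compose semilinear_inverse invertible_op_inverse)

lemma invertible_adjoint:
  assumes i: "invertible_op T" and T: "semilinear T"
  shows "invertible_op (adjoint_op T)"
proof (rule invertible_opI[where S = "adjoint_op (inverse_op T)"])
  note c = adjoint_compose[OF T semilinear_inverse[OF i T]] adjoint_compose[OF semilinear_inverse[OF i T] T]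
  show "adjoint_op (inverse_op T) (adjoint_op T x) = x" for x
    using arg_cong[OF c(1), of "\<lambda>F. blinfun_apply F x"] i by (simp add: invertible_op_inverse adjoint_selfadj)
  show "adjoint_op T (adjoint_op (inverse_op T) x) = x" for x
    using arg_cong[OF c(2), of "\<lambda>F. blinfun_apply F x"] i by (simp add: invertible_op_inverse adjoint_selfadj)
qed

lemma congr_op_le_iff:
  assumes i: "invertible_op T" and T: "semilinear T"
  shows "congr_op T A \<sqsubseteq> congr_op T B \<longleftrightarrow> A \<sqsubseteq> B"
  using congr_op_mono[OF T] congr_op_mono[OF semilinear_inverse[OF i T]] congr_op_inverse(2)[OF i T]
  by metis

lemma selfadj_inverse:
  assumes i: "invertible_op A" and A: "selfadj A" shows "selfadj (inverse_op A)"
proof -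
  have "inverse_op A (\<i> *\<^sub>C y) = \<i> *\<^sub>C inverse_op A y" for y
    using inverse_op_apply(1)[OF i, of "\<i> *\<^sub>C inverse_op A y"]
    by (simp add: complex_linear_ii[OF selfadj_complex_linear[OF A]] i)
  then have l: "complex_linear (inverse_op A)" by (simp add: complex_linear_iff)
  moreover have "inner (inverse_op A x) y = inner x (inverse_op A y)" for x y
    using selfadj_inner[OF A, of "inverse_op A x" "inverse_op A y"] i by simp
  ultimately show ?thesis by (simp add: selfadj_def)
qed

lemma positive_inverse:
  assumes i: "invertible_op A" and A: "A \<in> positive_ops" shows "inverse_op A \<in> positive_ops"
proof -
  have "0 \<le> qf (inverse_op A) x" for x
    using positive_qf[OF A, of "inverse_op A x"] i by (simp add: qf_def inner_commute)
  then show ?thesis using A selfadj_inverse[OF i] by (simp add: positive_iff)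
qed

lemma coercive_invertible_qf:
  "0 < c \<Longrightarrow> c *\<^sub>R id_blinfun \<sqsubseteq> A \<Longrightarrow> invertible_op A"
  by (rule coercive_invertible[of c]) (auto simp: le_op_def qf_def[of A, symmetric])

text \<open>The inverse bounds \<open>norm x\<close> by \<open>norm (A x)\<close>, and
  \<open>positive_norm_square_le\<close> bounds the latter by the form. The denominator is
  \<open>K + 1\<close> because \<open>K\<close> is zero on the zero space.\<close>

lemma invertible_positive_coercive:
  assumes i: "invertible_op A" and A: "A \<in> positive_ops"
  shows "\<exists>c>0. c *\<^sub>R id_blinfun \<sqsubseteq> A"
proof -
  define K where "K = (norm (inverse_op A))\<^sup>2 * norm A"
  have b: "(norm x)\<^sup>2 \<le> K * qf A x" for x
  proof -
    have "(norm x)\<^sup>2 \<le> (norm (inverse_op A) * norm (A x))\<^sup>2"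
      using invertible_op_bounded_below[OF i] by (intro power_mono) auto
    also have "\<dots> \<le> (norm (inverse_op A))\<^sup>2 * (norm A * qf A x)"
      using positive_norm_square_le[OF A] by (simp add: power_mult_distrib mult_left_mono)
    finally show ?thesis by (simp add: K_def mult.assoc)
  qed
  have K: "0 \<le> K" by (simp add: K_def)
  have "1 / (K + 1) * (norm x)\<^sup>2 \<le> qf A x" for x
    using b[of x] K positive_qf[OF A, of x] by (simp add: field_simps)
  then show ?thesis using K by (intro exI[of _ "1 / (K + 1)"]) (auto simp: le_op_def)
qed

section \<open>Functional calculus\<close>

interpretation blinfun_compose: bounded_bilinear "(o\<^sub>L)"
  by (rule bounded_bilinear_blinfun_compose)

section \<open>Polynomials in an operator\<close>

lemma poly_op_0 [simp]: "poly_op 0 A = 0"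
  by (simp add: poly_op_def)

lemma poly_op_pCons [simp]: "poly_op (pCons a P) A = a *\<^sub>R id_blinfun + (A o\<^sub>L poly_op P A)"
proof (cases "P = 0")
  case False
  have "(\<Sum>i\<le>degree P. coeff P i *\<^sub>R (A o\<^sub>L op_power A i)) = A o\<^sub>L (\<Sum>i\<le>degree P. coeff P i *\<^sub>R op_power A i)"
    by (simp add: blinfun_compose.sum_right blinfun_compose.scaleR_right)
  then show ?thesis using False
    by (simp add: poly_op_def sum.atMost_Suc_shift del: sum.atMost_Suc)
qed (simp add: poly_op_def)

lemma poly_op_add: "poly_op (P + Q) A = poly_op P A + poly_op Q A"
  by (induction P Q rule: poly_induct2) (simp_all add: blinfun_compose.add_right algebra_simps)

lemma poly_op_smult: "poly_op (smult c P) A = c *\<^sub>R poly_op P A"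
  by (induction P) (simp_all add: blinfun_compose.scaleR_right algebra_simps)

lemma poly_op_diff: "poly_op (P - Q) A = poly_op P A - poly_op Q A"
  using poly_op_add[of "P - Q" Q A] by simp

lemma blinfun_compose_assoc: "(A o\<^sub>L B) o\<^sub>L C = A o\<^sub>L (B o\<^sub>L C)"
  by (rule blinfun_eqI) simp

lemma blinfun_compose_id [simp]: "id_blinfun o\<^sub>L A = A" "A o\<^sub>L id_blinfun = A"
  by (rule blinfun_eqI; simp)+

lemma poly_op_mult: "poly_op (P * Q) A = poly_op P A o\<^sub>L poly_op Q A"
  by (induction P)
    (simp_all add: poly_op_add poly_op_smult blinfun_compose.add_left blinfun_compose.scaleR_left blinfun_compose_assoc)

lemma poly_op_pcompose: "poly_op (pcompose Q P) A = poly_op Q (poly_op P A)"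
  by (induction Q) (simp_all add: blinfun_compose.zero_right pcompose_pCons poly_op_add poly_op_mult)

lemma poly_op_commute: "A o\<^sub>L poly_op P A = poly_op P A o\<^sub>L A"
proof (induction P)
  case (pCons a P)
  have "A o\<^sub>L (A o\<^sub>L poly_op P A) = (A o\<^sub>L poly_op P A) o\<^sub>L A"
    by (metis pCons(2) blinfun_compose_assoc)
  then show ?case
    by (simp add: blinfun_compose.add_left blinfun_compose.add_right blinfun_compose.scaleR_left
        blinfun_compose.scaleR_right)
qed (simp add: blinfun_compose.zero_right blinfun_compose.zero_left)

lemma selfadj_poly_op:
  assumes A: "selfadj A" shows "selfadj (poly_op P A)"
proof (induction P)
  case (pCons a P)
  have "inner ((A o\<^sub>L poly_op P A) x) y = inner x ((A o\<^sub>L poly_op P A) y)" for x y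
    using selfadj_inner[OF A] selfadj_inner[OF pCons(2)]
      arg_cong[OF poly_op_commute[of A P], of "\<lambda>F. blinfun_apply F y"] by simp
  moreover have "complex_linear (A o\<^sub>L poly_op P A)"
    using A pCons(2) by (simp add: selfadj_def)
  ultimately show ?case by (simp add: selfadj_def[of "A o\<^sub>L _"])
qed simp

text \<open>Complex polynomials in an operator serve only to split a real polynomial into linear factors.\<close>

definition complex_poly_op :: "complex poly \<Rightarrow> ('a::complex_hilbert \<Rightarrow>\<^sub>L 'a) \<Rightarrow> ('a \<Rightarrow>\<^sub>L 'a)"
  where "complex_poly_op P A = fold_coeffs (\<lambda>a F. scalar_op a + (A o\<^sub>L F)) P 0"

lemma scalar_op_simps [simp]: "scalar_op 0 = 0" "scalar_op (a + b) = scalar_op a + scalar_op b"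
  "scalar_op (of_real r) = r *\<^sub>R id_blinfun" "scalar_op (- a) = - scalar_op a"
  by (rule blinfun_eqI; simp add: scalar_op.rep_eq scaleC_add_left blinfun.bilinear_simps
      scaleC_of_real scaleC_minus_left)+

lemma scalar_op_1 [simp]: "scalar_op 1 = id_blinfun"
  by (rule blinfun_eqI) (simp add: scalar_op.rep_eq)

lemma scalar_op_compose: "scalar_op a o\<^sub>L scalar_op b = scalar_op (a * b)"
  by (rule blinfun_eqI) (simp add: scalar_op.rep_eq scaleC_scaleC)

lemma complex_poly_op_0 [simp]: "complex_poly_op 0 A = 0"
  by (simp add: complex_poly_op_def)

lemma complex_poly_op_pCons [simp]:
  "complex_poly_op (pCons a P) A = scalar_op a + (A o\<^sub>L complex_poly_op P A)"
  by (cases "P = 0 \<and> a = 0") (auto simp: complex_poly_op_def)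

lemma complex_poly_op_add:
  "complex_poly_op (P + Q) A = complex_poly_op P A + complex_poly_op Q A"
  by (induction P Q rule: poly_induct2) (simp_all add: blinfun_compose.add_right algebra_simps)

lemma complex_poly_op_smult:
  assumes "complex_linear A"
  shows "complex_poly_op (smult c P) A = scalar_op c o\<^sub>L complex_poly_op P A"
proof (induction P)
  case (pCons a P)
  have "A (c *\<^sub>C x) = c *\<^sub>C A x" for x using assms by (simp add: complex_linear_def)
  with pCons show ?case
    by (intro blinfun_eqI)
      (simp add: scalar_op.rep_eq blinfun.bilinear_simps scaleC_add_right scaleC_scaleC)
qed simp

lemma complex_poly_op_mult:
  assumes "complex_linear A"
  shows "complex_poly_op (P * Q) A = complex_poly_op P A o\<^sub>L complex_poly_op Q A"
  by (induction P) (simp_all add: scalar_op_compose complex_poly_op_add complex_poly_op_smult[OF assms]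
      blinfun_compose.add_left blinfun_compose_assoc)

lemma complex_poly_op_of_real: "complex_poly_op (map_poly of_real P) A = poly_op P A"
  by (induction P) (simp_all add: map_poly_pCons)

lemma invertible_scalar_op: "c \<noteq> 0 \<Longrightarrow> invertible_op (scalar_op c)"
  by (rule invertible_opI[where S = "scalar_op (inverse c)"])
    (simp_all add: scalar_op.rep_eq scaleC_scaleC)

text \<open>The needed half of the spectral mapping theorem. Roots are split off one at a time; a
  non-invertible product has a non-invertible factor, and nonzero constants are invertible.\<close>

lemma spectrum_complex_poly_op:
  assumes A: "complex_linear A"
  shows "P \<noteq> 0 \<Longrightarrow> \<not> invertible_op (complex_poly_op P A) \<Longrightarrow> \<exists>z\<in>op_spectrum A. poly P z = 0"
proof (induction "degree P" arbitrary: P rule: less_induct)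
  case less
  show ?case
  proof (cases "degree P = 0")
    case True
    then obtain a where P: "P = [:a:]" by (rule degree_eq_zeroE)
    then show ?thesis using less(2,3) invertible_scalar_op[of a] by (auto simp: blinfun_compose.zero_right)
  next
    case False
    then obtain z where z: "poly P z = 0"
      using fundamental_theorem_of_algebra[of P] constant_degree[of P] by auto
    then obtain Q where Q: "P = [:- z, 1:] * Q" by (auto simp: poly_eq_0_iff_dvd elim: dvdE)
    have Q0: "Q \<noteq> 0" using less(2) Q by auto
    have dQ: "degree Q < degree P" using Q0 unfolding Q by (subst degree_mult_eq) auto
    have "complex_poly_op P A = (A - scalar_op z) o\<^sub>L complex_poly_op Q A"
      unfolding Q complex_poly_op_mult[OF A] by (simp add: blinfun_compose.zero_right)
    then have "\<not> invertible_op (A - scalar_op z) \<or> \<not> invertible_op (complex_poly_op Q A)"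
      using less(3) invertible_op_compose by metis
    then show ?thesis
    proof
      assume "\<not> invertible_op (A - scalar_op z)"
      then show ?thesis using z by (auto simp: op_spectrum_def)
    next
      assume "\<not> invertible_op (complex_poly_op Q A)"
      then show ?thesis using less(1)[OF dQ Q0] unfolding Q by auto
    qed
  qed
qed

section \<open>The spectrum of self-adjoint operators\<close>

lemma invertible_uminus: "invertible_op A \<Longrightarrow> invertible_op (- A)"
  by (rule invertible_opI[where S = "- inverse_op A"]) (simp_all add: blinfun.bilinear_simps)

text \<open>Multiplying \<open>A - scalar_op z\<close> by the unit \<open>c\<close> makes it
  coercive with constant \<open>\<bar>Im z\<bar>\<close>: the self-adjoint part \<open>B\<close>
  contributes nothing to the real form after rotation by \<open>\<i>\<close>.\<close>

lemma spectrum_selfadj_real: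
  assumes A: "selfadj A" and z: "z \<in> op_spectrum A"
  shows "z = of_real (Re z)"
proof (rule ccontr)
  assume "z \<noteq> of_real (Re z)"
  then have b: "Im z \<noteq> 0" by (auto simp: complex_eq_iff)
  define B where "B = A - Re z *\<^sub>R id_blinfun"
  have B: "selfadj B" using A by (simp add: B_def)
  define c where "c = (if Im z > 0 then \<i> else - \<i>)"
  have "invertible_op (scalar_op c o\<^sub>L (A - scalar_op z))"
  proof (rule coercive_invertible[where c = "\<bar>Im z\<bar>"])
    fix x
    have "inner (B x) (\<i> *\<^sub>C x) = 0"
      using selfadj_inner[OF B, of x "\<i> *\<^sub>C x"] inner_ii_left[of x "B x"]
        complex_linear_ii[OF selfadj_complex_linear[OF B]] by (simp add: inner_commute)
    then have i: "inner (\<i> *\<^sub>C B x) x = 0" by (simp add: inner_ii_left)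
    have "(A - scalar_op z) x = B x - Im z *\<^sub>R (\<i> *\<^sub>C x)"
      by (simp add: B_def blinfun.bilinear_simps scalar_op.rep_eq scaleC_eq_Re_Im[of z])
    then have "inner (\<i> *\<^sub>C ((A - scalar_op z) x)) x = Im z * (norm x)\<^sup>2"
      using i by (simp add: scaleC_diff_right scaleC_scaleR inner_simps power2_norm_eq_inner)
    then show "\<bar>Im z\<bar> * (norm x)\<^sup>2 \<le> inner ((scalar_op c o\<^sub>L (A - scalar_op z)) x) x"
      by (auto simp: c_def scalar_op.rep_eq scaleC_minus_left)
  qed (use b in simp)
  moreover have "c \<noteq> 0" by (simp add: c_def)
  ultimately have "invertible_op (scalar_op (inverse c) o\<^sub>L (scalar_op c o\<^sub>L (A - scalar_op z)))"
    by (simp add: invertible_op_compose invertible_scalar_op)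
  moreover have "scalar_op (inverse c) o\<^sub>L (scalar_op c o\<^sub>L (A - scalar_op z)) = A - scalar_op z"
    using \<open>c \<noteq> 0\<close> by (intro blinfun_eqI) (simp add: scalar_op.rep_eq scaleC_scaleC)
  ultimately show False using z by (simp add: op_spectrum_def)
qed

text \<open>This is the set on which the definition of \<open>cfc\<close> asks for uniform
  convergence.\<close>

definition real_spectrum :: "('a::complex_hilbert \<Rightarrow>\<^sub>L 'a) \<Rightarrow> real set"
  where "real_spectrum A = {t. complex_of_real t \<in> op_spectrum A}"

lemma real_spectrum_iff: "t \<in> real_spectrum A \<longleftrightarrow> \<not> invertible_op (A - t *\<^sub>R id_blinfun)"
  by (simp add: real_spectrum_def op_spectrum_def)

lemma real_spectrum_positive:
  assumes A: "A \<in> positive_ops" shows "real_spectrum A \<subseteq> {0..norm A}"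
proof
  fix t assume t: "t \<in> real_spectrum A"
  have "0 \<le> t"
  proof (rule ccontr)
    assume n: "\<not> 0 \<le> t"
    then have "invertible_op (A - t *\<^sub>R id_blinfun)"
      by (intro coercive_invertible_qf[of "- t"]) (auto simp: le_op_def positive_qf[OF A])
    then show False using t by (simp add: real_spectrum_iff)
  qed
  moreover have "t \<le> norm A"
  proof (rule ccontr)
    assume n: "\<not> t \<le> norm A"
    have "invertible_op (t *\<^sub>R id_blinfun - A)"
    proof (rule coercive_invertible_qf[of "t - norm A"])
      show "(t - norm A) *\<^sub>R id_blinfun \<sqsubseteq> t *\<^sub>R id_blinfun - A"
        unfolding le_op_def
      proof
        show "qf ((t - norm A) *\<^sub>R id_blinfun) x \<le> qf (t *\<^sub>R id_blinfun - A) x" for x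
          using abs_qf_le[of A x] by (simp add: algebra_simps)
      qed
    qed (use n in simp)
    then have "invertible_op (A - t *\<^sub>R id_blinfun)" using invertible_uminus by fastforce
    then show False using t by (simp add: real_spectrum_iff)
  qed
  ultimately show "t \<in> {0..norm A}" by simp
qed

text \<open>If neither \<open>norm B\<close> nor its negative were spectral, the product
  \<open>?G\<close>, which is the square of \<open>B\<close> minus \<open>m\<^sup>2\<close>, would
  be bounded below. That keeps \<open>norm (B x)\<close> under a multiple of \<open>norm x\<close>
  smaller than \<open>m\<close>, against \<open>m = norm B\<close>. A nonzero vector is required
  since on the zero space every spectrum is empty.\<close>

lemma norm_in_real_spectrum:
  fixes B :: "'a::complex_hilbert \<Rightarrow>\<^sub>L 'a"
  assumes B: "selfadj B" and nt: "x0 \<noteq> (0::'a)"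
  shows "\<exists>t\<in>real_spectrum B. \<bar>t\<bar> = norm B"
proof (rule ccontr)
  define m where "m = norm B"
  assume "\<not> ?thesis"
  then have "invertible_op (B - m *\<^sub>R id_blinfun)" "invertible_op (B - (- m) *\<^sub>R id_blinfun)"
    using real_spectrum_iff[of m B] real_spectrum_iff[of "- m" B] by (auto simp: m_def)
  then have inv: "invertible_op ((B - m *\<^sub>R id_blinfun) o\<^sub>L (B - (- m) *\<^sub>R id_blinfun))" (is "invertible_op ?G")
    by (rule invertible_op_compose)
  define K where "K = norm (inverse_op ?G)"
  have G: "?G x = B (B x) - m\<^sup>2 *\<^sub>R x" for x
    by (simp add: blinfun.bilinear_simps algebra_simps power2_eq_square)
  \<comment> \<open>Expand the squared norm of \<open>?G x\<close> and use
    \<open>norm (B (B x)) \<le> m * norm (B x)\<close>. What remains is a multiple of the amount by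
    which \<open>(norm (B x))\<^sup>2\<close> falls short of
    \<open>m\<^sup>2 * (norm x)\<^sup>2\<close>.\<close>
  have key: "(norm x)\<^sup>2 \<le> K\<^sup>2 * (m\<^sup>2 * (m\<^sup>2 * (norm x)\<^sup>2 - (norm (B x))\<^sup>2))" for x
  proof -
    have "(norm (B (B x)))\<^sup>2 \<le> (m * norm (B x))\<^sup>2"
      unfolding m_def by (intro power_mono norm_blinfun) simp
    moreover have "inner (B (B x)) x = (norm (B x))\<^sup>2"
      by (simp add: selfadj_inner[OF B] power2_norm_eq_inner)
    moreover have "(norm (?G x))\<^sup>2 = (norm (B (B x)))\<^sup>2 - 2 * m\<^sup>2 * inner (B (B x)) x + m\<^sup>2 * m\<^sup>2 * (norm x)\<^sup>2"
      unfolding G power2_norm_eq_inner by (simp add: inner_simps inner_commute algebra_simps)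
    ultimately have "(norm (?G x))\<^sup>2 \<le> m\<^sup>2 * (m\<^sup>2 * (norm x)\<^sup>2 - (norm (B x))\<^sup>2)"
      by (simp add: power_mult_distrib algebra_simps)
    then have "K\<^sup>2 * (norm (?G x))\<^sup>2 \<le> K\<^sup>2 * (m\<^sup>2 * (m\<^sup>2 * (norm x)\<^sup>2 - (norm (B x))\<^sup>2))"
      by (rule mult_left_mono) simp
    moreover have "(norm x)\<^sup>2 \<le> (K * norm (?G x))\<^sup>2"
      unfolding K_def using invertible_op_bounded_below[OF inv, of x] by (intro power_mono) auto
    ultimately show ?thesis by (simp add: power_mult_distrib)
  qed
  define L where "L = K\<^sup>2 * m\<^sup>2"
  have L: "(norm x)\<^sup>2 + L * (norm (B x))\<^sup>2 \<le> L * m\<^sup>2 * (norm x)\<^sup>2" for x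
    using key[of x] by (simp add: L_def algebra_simps)
  have "0 \<le> L" by (simp add: L_def)
  moreover have "L \<noteq> 0" using L[of x0] nt by auto
  ultimately have Lp: "0 < L" by simp
  have b: "(norm (B x))\<^sup>2 \<le> (m\<^sup>2 - 1 / L) * (norm x)\<^sup>2" for x
    using L[of x] Lp by (simp add: field_simps)
  have nn: "0 \<le> m\<^sup>2 - 1 / L"
  proof -
    have "0 \<le> (m\<^sup>2 - 1 / L) * (norm x0)\<^sup>2" using b[of x0] by (rule order_trans[rotated]) simp
    then show ?thesis using nt by (simp add: zero_le_mult_iff)
  qed
  have "norm B \<le> sqrt (m\<^sup>2 - 1 / L)"
  proof (rule norm_blinfun_bound)
    show "norm (B x) \<le> sqrt (m\<^sup>2 - 1 / L) * norm x" for x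
    proof (rule power2_le_imp_le)
      show "(norm (B x))\<^sup>2 \<le> (sqrt (m\<^sup>2 - 1 / L) * norm x)\<^sup>2"
        using b[of x] by (simp only: power_mult_distrib real_sqrt_pow2[OF nn])
    qed (intro mult_nonneg_nonneg real_sqrt_ge_zero nn norm_ge_zero)
  qed (rule real_sqrt_ge_zero[OF nn])
  then have "m\<^sup>2 \<le> (sqrt (m\<^sup>2 - 1 / L))\<^sup>2" unfolding m_def by (intro power_mono) auto
  then have "m\<^sup>2 \<le> m\<^sup>2 - 1 / L" by (simp only: real_sqrt_pow2[OF nn])
  then show False using Lp by simp
qed

lemma poly_map_of_real: "poly (map_poly complex_of_real P) (of_real t) = of_real (poly P t)"
  by (induction P) (simp_all add: map_poly_pCons)

text \<open>The norm of the self-adjoint operator \<open>poly_op P A\<close> is the modulus of some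
  \<open>s\<close> in its spectrum. Then \<open>P - [:s:]\<close> has a root in the spectrum of
  \<open>A\<close>, where \<open>P\<close> takes the value \<open>s\<close>.\<close>

lemma norm_poly_op_le:
  fixes A :: "'a::complex_hilbert \<Rightarrow>\<^sub>L 'a"
  assumes A: "selfadj A" and M: "0 \<le> M" and bound: "\<And>t. t \<in> real_spectrum A \<Longrightarrow> \<bar>poly P t\<bar> \<le> M"
  shows "norm (poly_op P A) \<le> M"
proof (cases "\<exists>x::'a. x \<noteq> 0")
  case False
  then have z: "y = 0" for y :: 'a by blast
  have "poly_op P A = 0"
  proof (rule blinfun_eqI)
    show "poly_op P A x = (0 :: 'a \<Rightarrow>\<^sub>L 'a) x" for x
      using z[of "poly_op P A x"] by (simp only: zero_blinfun.rep_eq)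
  qed
  then show ?thesis using M by simp
next
  case True
  then obtain x0 :: 'a where x0: "x0 \<noteq> 0" by blast
  obtain s where s: "s \<in> real_spectrum (poly_op P A)" "\<bar>s\<bar> = norm (poly_op P A)"
    using norm_in_real_spectrum[OF selfadj_poly_op[OF A] x0] by blast
  have "\<exists>t\<in>real_spectrum A. poly P t = s"
  \<comment> \<open>If \<open>P\<close> is the constant \<open>s\<close>, the difference is the zero
    polynomial and its roots carry no information; any point of the spectrum serves.\<close>
  proof (cases "P = [:s:]")
    case True
    obtain t where "t \<in> real_spectrum A" using norm_in_real_spectrum[OF A x0] by blast
    then show ?thesis using True by auto
  next
    case False
    define R where "R = map_poly complex_of_real (P - [:s:])"
    have "R \<noteq> 0" using False by (simp add: R_def map_poly_eq_0_iff)
    moreover have "\<not> invertible_op (complex_poly_op R A)"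
      using s(1) unfolding R_def complex_poly_op_of_real by (simp add: poly_op_diff real_spectrum_iff)
    ultimately obtain z where z: "z \<in> op_spectrum A" "poly R z = 0"
      using spectrum_complex_poly_op selfadj_complex_linear[OF A] by blast
    have zr: "z = of_real (Re z)" using spectrum_selfadj_real[OF A z(1)] .
    have "poly R (of_real (Re z)) = of_real (poly (P - [:s:]) (Re z))"
      unfolding R_def by (rule poly_map_of_real)
    then have "poly P (Re z) = s" using z(2) zr by simp
    moreover have "Re z \<in> real_spectrum A" using z(1) zr by (simp add: real_spectrum_def)
    ultimately show ?thesis by blast
  qed
  then show ?thesis using bound s(2) by metis
qed

text \<open>Existence of the limit comes from \<open>norm_poly_op_le\<close>, applied to differences
  of approximants. The given sequence also secures uniqueness: if no polynomials converged uniformly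
  to \<open>f\<close>, every operator would satisfy the description in \<open>cfc\<close>.\<close>

lemma cfc_tendsto:
  fixes A :: "'a::complex_hilbert \<Rightarrow>\<^sub>L 'a"
  assumes A: "selfadj A" and P: "uniform_limit (real_spectrum A) (\<lambda>n. poly (P n)) f sequentially"
  shows "(\<lambda>n. poly_op (P n) A) \<longlonglongrightarrow> cfc f A"
proof -
  have close: "\<exists>N. \<forall>n\<ge>N. \<forall>m\<ge>N. dist (poly_op (Q n) A) (poly_op (R m) A) < e"
    if Q: "uniform_limit (real_spectrum A) (\<lambda>n. poly (Q n)) f sequentially"
      and R: "uniform_limit (real_spectrum A) (\<lambda>n. poly (R n)) f sequentially" and e: "0 < e"
    for Q R :: "nat \<Rightarrow> real poly" and e
  proof -
    have "\<forall>\<^sub>F n in sequentially. (\<forall>t\<in>real_spectrum A. dist (poly (Q n) t) (f t) < e / 4) \<and>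
        (\<forall>t\<in>real_spectrum A. dist (poly (R n) t) (f t) < e / 4)"
      using e by (intro eventually_conj uniform_limitD Q R) auto
    then obtain N where N: "\<And>n t. N \<le> n \<Longrightarrow> t \<in> real_spectrum A \<Longrightarrow>
        dist (poly (Q n) t) (f t) < e / 4 \<and> dist (poly (R n) t) (f t) < e / 4"
      unfolding eventually_sequentially by blast
    have "dist (poly_op (Q n) A) (poly_op (R m) A) < e" if "N \<le> n" "N \<le> m" for n m
    proof -
      have "norm (poly_op (Q n - R m) A) \<le> e / 2"
      proof (rule norm_poly_op_le[OF A])
        fix t assume "t \<in> real_spectrum A"
        then show "\<bar>poly (Q n - R m) t\<bar> \<le> e / 2"
          using N[OF that(1), of t] N[OF that(2), of t] by (simp add: dist_real_def abs_if split: if_splits)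
      qed (use e in simp)
      then show ?thesis using e by (simp add: dist_norm poly_op_diff)
    qed
    then show ?thesis by blast
  qed
  have "Cauchy (\<lambda>n. poly_op (P n) A)" unfolding Cauchy_def using close[OF P P] by blast
  then obtain F where F: "(\<lambda>n. poly_op (P n) A) \<longlonglongrightarrow> F"
    by (metis Cauchy_convergent_iff convergent_def)
  have all: "(\<lambda>n. poly_op (Q n) A) \<longlonglongrightarrow> F"
    if Q: "uniform_limit (real_spectrum A) (\<lambda>n. poly (Q n)) f sequentially" for Q :: "nat \<Rightarrow> real poly"
  proof -
    have "(\<lambda>n. dist (poly_op (Q n) A) (poly_op (P n) A)) \<longlonglongrightarrow> 0"
      unfolding LIMSEQ_def using close[OF Q P] by simp blast
    then have "(\<lambda>n. poly_op (Q n) A - poly_op (P n) A) \<longlonglongrightarrow> 0"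
      by (subst tendsto_norm_zero_iff[symmetric]) (simp add: dist_norm)
    from tendsto_add[OF this F] show ?thesis by simp
  qed
  have "cfc f A = F"
    unfolding cfc_def real_spectrum_def[symmetric]
  proof (rule the_equality)
    show "\<forall>P. uniform_limit (real_spectrum A) (\<lambda>n. poly (P n)) f sequentially \<longrightarrow> (\<lambda>n. poly_op (P n) A) \<longlonglongrightarrow> F"
      using all by blast
  next
    fix F' assume "\<forall>P. uniform_limit (real_spectrum A) (\<lambda>n. poly (P n)) f sequentially \<longrightarrow> (\<lambda>n. poly_op (P n) A) \<longlonglongrightarrow> F'"
    then show "F' = F" using P F LIMSEQ_unique by blast
  qed
  then show ?thesis using F by simp
qed

section \<open>Powers of positive operators\<close>

lemma Weierstrass_poly_seq:
  fixes f :: "real \<Rightarrow> real"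
  assumes "continuous_on {a..b} f"
  shows "\<exists>P :: nat \<Rightarrow> real poly. uniform_limit {a..b} (\<lambda>n. poly (P n)) f sequentially"
proof -
  obtain g where g: "uniform_limit {a..b} g f sequentially" "\<And>n. polynomial_function (g n)"
    using Stone_Weierstrass_uniform_limit[of "{a..b}" f] assms by auto
  have "\<exists>p. g n = poly p" for n
  proof -
    obtain c k where "g n = (\<lambda>x. \<Sum>i\<le>k. c i * x ^ i)"
      using g(2)[of n] by (auto simp: real_polynomial_function_eq[symmetric] real_polynomial_function_iff_sum)
    then show ?thesis
      by (intro exI[of _ "\<Sum>i\<le>k. monom (c i) i"]) (simp add: fun_eq_iff poly_sum poly_monom)
  qed
  then obtain P where "\<And>n. g n = poly (P n)" by metis
  then have "g = (\<lambda>n. poly (P n))" by (simp add: fun_eq_iff)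
  then show ?thesis using g(1) by auto
qed

text \<open>Pointwise convergence along an arbitrary filter covers both the polynomial approximants
  and the strong limit of a decreasing net.\<close>

lemma selfadj_limit:
  fixes L :: "'a::complex_hilbert \<Rightarrow>\<^sub>L 'a"
  assumes F: "F \<noteq> bot" and X: "\<forall>\<^sub>F n in F. selfadj (X n)" and l: "\<And>x. ((\<lambda>n. X n x) \<longlongrightarrow> L x) F"
  shows "selfadj L"
proof -
  have "inner (L x) y = inner x (L y)" for x y
  proof (rule tendsto_unique[OF F])
    show "((\<lambda>n. inner (X n x) y) \<longlongrightarrow> inner (L x) y) F" by (intro tendsto_intros l)
    have "((\<lambda>n. inner x (X n y)) \<longlongrightarrow> inner x (L y)) F" by (intro tendsto_intros l)
    then show "((\<lambda>n. inner (X n x) y) \<longlongrightarrow> inner x (L y)) F"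
      by (rule Lim_transform_eventually) (use X in \<open>auto simp: selfadj_inner elim: eventually_mono\<close>)
  qed
  moreover have "L (\<i> *\<^sub>C x) = \<i> *\<^sub>C L x" for x
  proof (rule tendsto_unique[OF F l])
    have "((\<lambda>n. \<i> *\<^sub>C X n x) \<longlongrightarrow> \<i> *\<^sub>C L x) F"
      by (intro bounded_linear.tendsto[OF bounded_linear_scaleC] l)
    then show "((\<lambda>n. X n (\<i> *\<^sub>C x)) \<longlongrightarrow> \<i> *\<^sub>C L x) F"
      by (rule Lim_transform_eventually)
        (use X in \<open>auto simp: complex_linear_ii selfadj_complex_linear elim: eventually_mono\<close>)
  qed
  ultimately show ?thesis by (simp add: selfadj_def complex_linear_iff)
qed

lemma positive_power_approx:
  fixes A :: "'a::complex_hilbert \<Rightarrow>\<^sub>L 'a"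
  assumes A: "A \<in> positive_ops" and q: "0 < q" and M: "norm A \<le> M"
  obtains P :: "nat \<Rightarrow> real poly"
  where "uniform_limit {0..M} (\<lambda>n. poly (P n)) (\<lambda>t. t powr q) sequentially"
    and "(\<lambda>n. poly_op (P n) A) \<longlonglongrightarrow> positive_power A q"
proof -
  have "continuous_on {0..M} (\<lambda>t. t powr q)"
    using q by (intro continuous_on_powr' continuous_intros) auto
  then obtain P :: "nat \<Rightarrow> real poly"
    where P: "uniform_limit {0..M} (\<lambda>n. poly (P n)) (\<lambda>t. t powr q) sequentially"
    using Weierstrass_poly_seq by blast
  moreover have "(\<lambda>n. poly_op (P n) A) \<longlonglongrightarrow> positive_power A q"
    unfolding positive_power_def
  proof (rule cfc_tendsto)
    show "uniform_limit (real_spectrum A) (\<lambda>n. poly (P n)) (\<lambda>t. t powr q) sequentially"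
      by (rule uniform_limit_on_subset[OF P]) (use real_spectrum_positive[OF A] M in auto)
  qed (rule positive_selfadj[OF A])
  ultimately show ?thesis by (rule that)
qed

text \<open>The approximating polynomials may be negative on the spectrum, so positivity is not
  inherited termwise. Instead \<open>norm (?K *\<^sub>R id_blinfun - ?F) \<le> ?K\<close> confines
  the form of \<open>?F\<close> between 0 and \<open>2 * ?K\<close> times the squared norm; the
  factor 2 is harmless, as only some interval containing the spectrum is wanted later.\<close>

lemma positive_power_bounds:
  assumes A: "A \<in> positive_ops" and q: "0 < q" and M: "norm A \<le> M"
  shows "positive_power A q \<in> positive_ops" "norm (positive_power A q) \<le> 2 * M powr q"
proof -
  let ?F = "positive_power A q" and ?K = "M powr q"
  obtain P :: "nat \<Rightarrow> real poly"
    where P: "uniform_limit {0..M} (\<lambda>n. poly (P n)) (\<lambda>t. t powr q) sequentially"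
      and lim: "(\<lambda>n. poly_op (P n) A) \<longlonglongrightarrow> ?F"
    using positive_power_approx[OF A q M] .
  have s: "selfadj A" by (rule positive_selfadj[OF A])
  have sF: "selfadj ?F"
  proof (rule selfadj_limit[of sequentially "\<lambda>n. poly_op (P n) A"])
    show "(\<lambda>n. poly_op (P n) A x) \<longlonglongrightarrow> ?F x" for x by (intro tendsto_intros lim)
  qed (simp_all add: selfadj_poly_op[OF s])
  have n: "norm (?K *\<^sub>R id_blinfun - ?F) \<le> ?K + e" if e: "0 < e" for e
  proof (rule Lim_norm_ubound)
    show "(\<lambda>n. ?K *\<^sub>R id_blinfun - poly_op (P n) A) \<longlonglongrightarrow> ?K *\<^sub>R id_blinfun - ?F"
      by (intro tendsto_intros lim)
    show "\<forall>\<^sub>F n in sequentially. norm (?K *\<^sub>R id_blinfun - poly_op (P n) A) \<le> ?K + e"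
      using uniform_limitD[OF P e]
    proof (rule eventually_mono)
      fix n assume n: "\<forall>x\<in>{0..M}. dist (poly (P n) x) (x powr q) < e"
      have "norm (poly_op ([:?K:] - P n) A) \<le> ?K + e"
      proof (rule norm_poly_op_le[OF s])
        fix t assume "t \<in> real_spectrum A"
        then have t: "0 \<le> t" "t \<le> M" using real_spectrum_positive[OF A] M by auto
        then have "t powr q \<le> ?K" using q by (intro powr_mono2) auto
        moreover have "\<bar>poly (P n) t - t powr q\<bar> < e" using n t by (simp add: dist_real_def)
        moreover have "0 \<le> t powr q" by simp
        ultimately have "\<bar>?K - poly (P n) t\<bar> \<le> ?K + e" by linarith
        then show "\<bar>poly ([:?K:] - P n) t\<bar> \<le> ?K + e" by simp
      qed (use e in simp)
      then show "norm (?K *\<^sub>R id_blinfun - poly_op (P n) A) \<le> ?K + e"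
        by (simp add: poly_op_diff)
    qed
  qed simp
  have n: "norm (?K *\<^sub>R id_blinfun - ?F) \<le> ?K" using n by (rule field_le_epsilon)
  have b: "\<bar>?K * (norm x)\<^sup>2 - qf ?F x\<bar> \<le> ?K * (norm x)\<^sup>2" for x
    using abs_qf_le[of "?K *\<^sub>R id_blinfun - ?F" x] mult_right_mono[OF n, of "(norm x)\<^sup>2"] by simp
  have "0 \<le> qf ?F x" for x using b[of x] by linarith
  then show F: "?F \<in> positive_ops" using sF by (simp add: positive_iff)
  have "qf ?F x \<le> qf ((2 * ?K) *\<^sub>R id_blinfun) x" for x using b[of x] by simp
  then show "norm ?F \<le> 2 * ?K" by (intro positive_norm_le[OF F]) (auto simp: le_op_def)
qed

lemma positive_power_positive [simp]:
  "A \<in> positive_ops \<Longrightarrow> 0 < q \<Longrightarrow> positive_power A q \<in> positive_ops"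
  using positive_power_bounds(1) by blast

lemma tendsto_poly_op:
  assumes "(X \<longlonglongrightarrow> F)" shows "(\<lambda>n. poly_op Q (X n)) \<longlonglongrightarrow> poly_op Q F"
  by (induction Q) (auto intro!: tendsto_intros assms blinfun_compose.tendsto)

text \<open>\<open>poly_op (Q m) ?F\<close> is the limit over \<open>n\<close> of the composites of
  \<open>Q m\<close> with \<open>P n\<close>, taken at \<open>A\<close>, and on the spectrum of
  \<open>A\<close> these are close to the identity function. The index \<open>m\<close> is fixed
  first because the modulus of continuity of \<open>Q m\<close> depends on it.\<close>

lemma positive_power_positive_power:
  fixes A :: "'a::complex_hilbert \<Rightarrow>\<^sub>L 'a"
  assumes A: "A \<in> positive_ops" and q: "0 < q" and qr: "q * r = 1"
  shows "positive_power (positive_power A q) r = A"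
proof -
  let ?F = "positive_power A q"
  define M where "M = norm A"
  define K where "K = 2 * M powr q"
  have r: "0 < r" using q qr by (metis zero_less_mult_pos zero_less_one)
  have s: "selfadj A" by (rule positive_selfadj[OF A])
  obtain P :: "nat \<Rightarrow> real poly"
    where P: "uniform_limit {0..M} (\<lambda>n. poly (P n)) (\<lambda>t. t powr q) sequentially"
      and limP: "(\<lambda>n. poly_op (P n) A) \<longlonglongrightarrow> ?F"
    using positive_power_approx[OF A q, of M] by (auto simp: M_def)
  have nF: "norm ?F \<le> K" unfolding K_def by (rule positive_power_bounds(2)[OF A q]) (simp add: M_def)
  obtain Q :: "nat \<Rightarrow> real poly"
    where Q: "uniform_limit {0..K} (\<lambda>n. poly (Q n)) (\<lambda>t. t powr r) sequentially"
      and limQ: "(\<lambda>n. poly_op (Q n) ?F) \<longlonglongrightarrow> positive_power ?F r"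
    using positive_power_approx[OF positive_power_positive[OF A q] r nF] .
  have "(\<lambda>n. poly_op (Q n) ?F) \<longlonglongrightarrow> A"
  proof (rule metric_LIMSEQ_I)
    fix e :: real assume e: "0 < e"
    have "\<forall>\<^sub>F m in sequentially. \<forall>t\<in>{0..K}. \<bar>poly (Q m) t - t powr r\<bar> < e / 4"
      using uniform_limitD[OF Q, of "e / 4"] e by (simp add: dist_real_def)
    then obtain N where N: "\<And>m t. N \<le> m \<Longrightarrow> t \<in> {0..K} \<Longrightarrow> \<bar>poly (Q m) t - t powr r\<bar> < e / 4"
      unfolding eventually_sequentially by blast
    have "dist (poly_op (Q m) ?F) A < e" if m: "N \<le> m" for m
    proof -
      \<comment> \<open>\<open>P n\<close> may leave the range \<open>{0..K}\<close> of the power by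
        less than 1, hence the enlarged interval.\<close>
      have uc: "uniformly_continuous_on {-1..K+1} (poly (Q m))"
        by (intro compact_uniformly_continuous continuous_intros) auto
      obtain d where d: "0 < d" "\<And>s t. s \<in> {-1..K+1} \<Longrightarrow> t \<in> {-1..K+1} \<Longrightarrow> dist s t < d \<Longrightarrow>
          dist (poly (Q m) s) (poly (Q m) t) < e / 4"
        using uc e unfolding uniformly_continuous_on_def by (metis zero_less_divide_iff zero_less_numeral)
      have "norm (poly_op (Q m) ?F - A) \<le> e / 2"
      proof (rule Lim_norm_ubound)
        show "(\<lambda>n. poly_op (Q m) (poly_op (P n) A) - A) \<longlonglongrightarrow> poly_op (Q m) ?F - A"
          by (intro tendsto_intros tendsto_poly_op limP)
        have "0 < min d 1" using d by simp
        from uniform_limitD[OF P this]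
        show "\<forall>\<^sub>F n in sequentially. norm (poly_op (Q m) (poly_op (P n) A) - A) \<le> e / 2"
        proof (rule eventually_mono)
          fix n assume n: "\<forall>x\<in>{0..M}. dist (poly (P n) x) (x powr q) < min d 1"
          have "norm (poly_op (pcompose (Q m) (P n) - [:0, 1:]) A) \<le> e / 2"
          proof (rule norm_poly_op_le[OF s])
            fix t assume "t \<in> real_spectrum A"
            then have t: "0 \<le> t" "t \<le> M" using real_spectrum_positive[OF A] by (auto simp: M_def)
            have "t powr q \<le> M powr q" using q t by (intro powr_mono2) auto
            moreover have "0 \<le> t powr q" "0 \<le> M powr q" by simp_all
            ultimately have tq: "t powr q \<in> {0..K}"
              unfolding K_def atLeastAtMost_iff by linarith
            have c: "\<bar>poly (P n) t - t powr q\<bar> < min d 1" using n t by (simp add: dist_real_def)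
            then have p: "poly (P n) t \<in> {-1..K+1}" "t powr q \<in> {-1..K+1}"
              using tq unfolding atLeastAtMost_iff min_less_iff_conj by linarith+
            have "\<bar>poly (Q m) (poly (P n) t) - poly (Q m) (t powr q)\<bar> < e / 4"
              using d(2)[OF p] c by (simp add: dist_real_def)
            moreover have "\<bar>poly (Q m) (t powr q) - (t powr q) powr r\<bar> < e / 4" using N[OF m tq] .
            moreover have "(t powr q) powr r = t" using t qr by (simp add: powr_powr)
            ultimately have "\<bar>poly (Q m) (poly (P n) t) - t\<bar> \<le> e / 2"
              using abs_triangle_ineq[of "poly (Q m) (poly (P n) t) - poly (Q m) (t powr q)" "poly (Q m) (t powr q) - t"]
              by simp
            then show "\<bar>poly (pcompose (Q m) (P n) - [:0, 1:]) t\<bar> \<le> e / 2"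
              by (simp add: poly_pcompose)
          qed (use e in simp)
          then show "norm (poly_op (Q m) (poly_op (P n) A) - A) \<le> e / 2"
            by (simp add: poly_op_diff poly_op_pcompose)
        qed
      qed simp
      then show ?thesis using e by (simp add: dist_norm)
    qed
    then show "\<exists>no. \<forall>n\<ge>no. dist (poly_op (Q n) ?F) A < e" by blast
  qed
  then show ?thesis using limQ LIMSEQ_unique by blast
qed

section \<open>The harmonic mean\<close>

text \<open>
  The last two clauses say that
  \<open>\<langle>Hz,z\<rangle> = 2 inf\<^sub>v (\<langle>A(z-v),z-v\<rangle> + \<langle>Bv,v\<rangle>)\<close>.
\<close>

definition is_harmonic_mean ::
    "('a::complex_hilbert \<Rightarrow>\<^sub>L 'a) \<Rightarrow> ('a \<Rightarrow>\<^sub>L 'a) \<Rightarrow> ('a \<Rightarrow>\<^sub>L 'a) \<Rightarrow> bool"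
  where "is_harmonic_mean A B H \<longleftrightarrow> H \<in> positive_ops \<and>
    (\<forall>z v. qf H z \<le> 2 * (qf A (z - v) + qf B v)) \<and>
    (\<forall>z. \<forall>e>0. \<exists>v. 2 * (qf A (z - v) + qf B v) \<le> qf H z + e)"

text \<open>A nearly optimal \<open>v\<close> for the larger pair is a competitor for the smaller
  one.\<close>

lemma is_harmonic_mean_le:
  assumes H: "is_harmonic_mean A B H" and H': "is_harmonic_mean A' B' H'"
    and le: "A \<sqsubseteq> A'" "B \<sqsubseteq> B'"
  shows "H \<sqsubseteq> H'"
  unfolding le_op_def
proof (rule allI, rule field_le_epsilon)
  fix z and e :: real assume "0 < e"
  then obtain v where v: "2 * (qf A' (z - v) + qf B' v) \<le> qf H' z + e"
    using H' unfolding is_harmonic_mean_def by blast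
  have "qf H z \<le> 2 * (qf A (z - v) + qf B v)" using H by (auto simp: is_harmonic_mean_def)
  also have "\<dots> \<le> 2 * (qf A' (z - v) + qf B' v)"
    using le by (intro mult_left_mono add_mono) (auto simp: le_op_def)
  finally show "qf H z \<le> qf H' z + e" using v by linarith
qed

lemma is_harmonic_mean_unique:
  assumes H: "is_harmonic_mean A B H" and H': "is_harmonic_mean A B H'"
  shows "H = H'"
proof (rule le_op_antisym)
  show "selfadj H" "selfadj H'" using H H' by (auto simp: is_harmonic_mean_def positive_selfadj)
qed (use is_harmonic_mean_le[OF H H'] is_harmonic_mean_le[OF H' H] in auto)

lemma invertible_add_positive:
  assumes A: "A \<in> positive_ops" "invertible_op A" and B: "B \<in> positive_ops"
  shows "invertible_op (A + B)"
proof -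
  obtain c where c: "0 < c" "c *\<^sub>R id_blinfun \<sqsubseteq> A"
    using invertible_positive_coercive[OF A(2,1)] by blast
  then have "c *\<^sub>R id_blinfun \<sqsubseteq> A + B"
    using positive_qf[OF B] by (auto simp: le_op_def intro: add_increasing2)
  then show ?thesis by (rule coercive_invertible_qf[OF c(1)])
qed

text \<open>Completing the square: with \<open>C\<close> half of the mean, the optimal vector is
  \<open>inverse_op B (C z)\<close>, and \<open>eq\<close> displays the excess at any other
  \<open>w\<close> as a sum of two nonnegative forms.\<close>

lemma is_harmonic_mean_inv:
  assumes A: "A \<in> positive_ops" "invertible_op A" and B: "B \<in> positive_ops" "invertible_op B"
  shows "is_harmonic_mean A B (harmonic_mean_inv A B)"
proof -
  define S where "S = inverse_op A + inverse_op B"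
  have S: "S \<in> positive_ops" "invertible_op S"
    unfolding S_def using A B
    by (auto intro!: invertible_add_positive invertible_inverse_op simp: positive_inverse)
  define C where "C = inverse_op S"
  have C: "C \<in> positive_ops" unfolding C_def by (rule positive_inverse[OF S(2,1)])
  have eq: "2 * (qf A (z - w) + qf B w) =
      2 * qf C z + 2 * (qf A (w - inverse_op B (C z)) + qf B (w - inverse_op B (C z)))" for z w
  proof -
    define u v h where "u = inverse_op A (C z)" and "v = inverse_op B (C z)" and "h = w - v"
    have "u + v = S (C z)" by (simp add: u_def v_def S_def blinfun.add_left)
    then have z: "u + v = z" using S by (simp add: C_def)
    have Au: "A u = C z" and Bv: "B v = C z" using A B by (simp_all add: u_def v_def)
    have e: "z - w = u - h" "w = v + h" using z by (auto simp: h_def algebra_simps)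
    have "qf A (z - w) + qf B w = inner (C z) (u + v) + qf A h + qf B h"
      unfolding e(1) unfolding e(2) using qf_diff[OF positive_selfadj[OF A(1)], of u h] qf_add[OF positive_selfadj[OF B(1)], of v h]
      by (simp add: Au Bv inner_add_right qf_def[of A u] qf_def[of B v])
    then have "qf A (z - w) + qf B w = qf C z + qf A h + qf B h"
      unfolding z by (simp add: qf_def[of C])
    then show ?thesis unfolding h_def v_def by simp
  qed
  have "2 * qf C z \<le> 2 * (qf A (z - v) + qf B v)" for z v
    unfolding eq using positive_qf[OF A(1)] positive_qf[OF B(1)] by simp
  moreover have "\<exists>v. 2 * (qf A (z - v) + qf B v) \<le> 2 * qf C z + e" if "0 < e" for z e
    using that by (intro exI[of _ "inverse_op B (C z)"]) (subst eq, simp)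
  ultimately show ?thesis
    using C by (simp add: is_harmonic_mean_def harmonic_mean_inv_def S_def[symmetric] C_def[symmetric])
qed

lemma eventually_at_right_0: "\<forall>\<^sub>F \<epsilon> in at_right 0. (0::real) < \<epsilon>"
  unfolding eventually_at_right_field by (intro exI[of _ 1]) auto

text \<open>Vigier's theorem for a decreasing net.\<close>

lemma decreasing_strong_limit:
  fixes C :: "real \<Rightarrow> ('a::complex_hilbert \<Rightarrow>\<^sub>L 'a)"
  assumes pos: "\<And>\<epsilon>. 0 < \<epsilon> \<Longrightarrow> C \<epsilon> \<in> positive_ops"
    and mono: "\<And>\<epsilon> \<delta>. 0 < \<epsilon> \<Longrightarrow> \<epsilon> \<le> \<delta> \<Longrightarrow> C \<epsilon> \<sqsubseteq> C \<delta>"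
  shows "\<exists>F\<in>positive_ops. \<forall>x. ((\<lambda>\<epsilon>. C \<epsilon> x) \<longlongrightarrow> F x) (at_right 0)"
proof -
  define K where "K = norm (C 1)"
  have sC: "selfadj (C \<epsilon>)" if "0 < \<epsilon>" for \<epsilon> using pos[OF that] by (rule positive_selfadj)
  \<comment> \<open>The difference \<open>D\<close> lies between 0 and \<open>C 1\<close>, so its
    norm is at most \<open>K\<close>, and the monotone numbers \<open>qf (C \<epsilon>) x\<close>
    control the vectors \<open>C \<epsilon> x\<close>.\<close>
  have est: "(norm (C \<delta> x - C \<epsilon> x))\<^sup>2 \<le> K * (qf (C \<delta>) x - qf (C \<epsilon>) x)"
    if "0 < \<epsilon>" "\<epsilon> \<le> \<delta>" "\<delta> \<le> 1" for \<epsilon> \<delta> x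
  proof -
    define D where "D = C \<delta> - C \<epsilon>"
    have D: "D \<in> positive_ops"
      unfolding D_def using mono that sC by (simp add: diff_positive_iff)
    have "D \<sqsubseteq> C \<delta>" using positive_qf[OF pos[OF that(1)]] by (simp add: le_op_def D_def)
    also have "C \<delta> \<sqsubseteq> C 1" using mono that by simp
    also (le_op_trans) have "C 1 \<sqsubseteq> K *\<^sub>R id_blinfun" by (rule le_op_norm) (simp add: K_def)
    finally (le_op_trans) have "norm D \<le> K"
      by (intro positive_norm_le[OF D]) (simp_all add: K_def)
    then have "norm D * qf D x \<le> K * qf D x" by (intro mult_right_mono positive_qf[OF D])
    then show ?thesis
      using positive_norm_square_le[OF D, of x] by (simp add: D_def blinfun.diff_left)
  qed
  have K0: "0 \<le> K" by (simp add: K_def)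
  have lim: "\<exists>y. ((\<lambda>\<epsilon>. C \<epsilon> x) \<longlongrightarrow> y) (at_right 0)" for x
  proof -
    define L where "L = (INF \<epsilon>\<in>{0<..}. qf (C \<epsilon>) x)"
    have bdd: "bdd_below ((\<lambda>\<epsilon>. qf (C \<epsilon>) x) ` {0<..})"
      using positive_qf[OF pos] by (auto intro!: bdd_belowI[of _ 0])
    have L: "L \<le> qf (C \<epsilon>) x" if "0 < \<epsilon>" for \<epsilon>
      unfolding L_def using bdd that by (auto intro: cINF_lower)
    have small: "\<exists>\<delta>>0. \<delta> \<le> 1 \<and> (\<forall>\<epsilon>. 0 < \<epsilon> \<and> \<epsilon> \<le> \<delta> \<longrightarrow> norm (C \<delta> x - C \<epsilon> x) < e)" if e: "0 < e" for e
    proof -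
      have "0 < e\<^sup>2 / (K + 1)" using e K0 by simp
      then have "L < L + e\<^sup>2 / (K + 1)" by simp
      then obtain \<delta>0 where d0: "0 < \<delta>0" "qf (C \<delta>0) x < L + e\<^sup>2 / (K + 1)"
        using cInf_lessD[of "(\<lambda>\<epsilon>. qf (C \<epsilon>) x) ` {0<..}" "L + e\<^sup>2 / (K + 1)"] by (auto simp: L_def)
      define \<delta> where "\<delta> = min \<delta>0 1"
      have d: "0 < \<delta>" "\<delta> \<le> 1" "\<delta> \<le> \<delta>0" using d0 by (auto simp: \<delta>_def)
      have qd: "qf (C \<delta>) x < L + e\<^sup>2 / (K + 1)" using mono[OF d(1,3)] d0(2) by (auto simp: le_op_def intro: le_less_trans)
      have "norm (C \<delta> x - C \<epsilon> x) < e" if eps: "0 < \<epsilon>" "\<epsilon> \<le> \<delta>" for \<epsilon>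
      proof (rule power2_less_imp_less)
        have "(norm (C \<delta> x - C \<epsilon> x))\<^sup>2 \<le> K * (qf (C \<delta>) x - qf (C \<epsilon>) x)"
          using est eps d by blast
        also have "\<dots> \<le> K * (e\<^sup>2 / (K + 1))"
          using qd L[OF eps(1)] K0 by (intro mult_left_mono) auto
        also have "\<dots> < e\<^sup>2" using K0 e by (simp add: field_simps)
        finally show "(norm (C \<delta> x - C \<epsilon> x))\<^sup>2 < e\<^sup>2" .
      qed (use e in simp)
      then show ?thesis using d by blast
    qed
    have "cauchy_filter (filtermap (\<lambda>\<epsilon>. C \<epsilon> x) (at_right 0))"
      unfolding cauchy_filter_metric_filtermap
    proof (intro allI impI)
      fix e :: real assume e: "0 < e"
      obtain \<delta> where d: "0 < \<delta>" "\<And>\<epsilon>. 0 < \<epsilon> \<Longrightarrow> \<epsilon> \<le> \<delta> \<Longrightarrow> norm (C \<delta> x - C \<epsilon> x) < e / 2"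
        using small[of "e / 2"] e by auto
      have "eventually (\<lambda>\<epsilon>. 0 < \<epsilon> \<and> \<epsilon> \<le> \<delta>) (at_right 0)"
        unfolding eventually_at_right_field using d(1) by (intro exI[of _ \<delta>]) auto
      moreover have "dist (C \<epsilon> x) (C \<epsilon>' x) < e" if "0 < \<epsilon> \<and> \<epsilon> \<le> \<delta>" "0 < \<epsilon>' \<and> \<epsilon>' \<le> \<delta>" for \<epsilon> \<epsilon>'
        using d(2)[of \<epsilon>] d(2)[of \<epsilon>'] that dist_triangle_half_r[of "C \<delta> x" "C \<epsilon> x" e "C \<epsilon>' x"]
        by (simp add: dist_norm)
      ultimately show "\<exists>P. eventually P (at_right 0) \<and> (\<forall>\<epsilon> \<epsilon>'. P \<epsilon> \<and> P \<epsilon>' \<longrightarrow> dist (C \<epsilon> x) (C \<epsilon>' x) < e)"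
        by blast
    qed
    then have "\<exists>y. filtermap (\<lambda>\<epsilon>. C \<epsilon> x) (at_right 0) \<le> nhds y"
      by (rule cauchy_filter_complete_converges[OF _ complete_UNIV]) (simp_all add: filtermap_bot_iff)
    then show ?thesis by (simp add: filterlim_def)
  qed
  then obtain g where g: "\<And>x. ((\<lambda>\<epsilon>. C \<epsilon> x) \<longlongrightarrow> g x) (at_right 0)" by metis
  have uniq: "a = b" if "(f \<longlongrightarrow> a) (at_right (0::real))" "(f \<longlongrightarrow> b) (at_right 0)" for f and a b :: 'a
    using tendsto_unique[OF trivial_limit_at_right_real that] .
  have "bounded_linear g"
  proof (rule bounded_linear_intro[where K = K])
    show "g (x + y) = g x + g y" for x y
    proof (rule uniq[OF g])
      show "((\<lambda>\<epsilon>. C \<epsilon> (x + y)) \<longlongrightarrow> g x + g y) (at_right 0)"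
        unfolding blinfun.add_right by (intro tendsto_intros g)
    qed
    show "g (r *\<^sub>R x) = r *\<^sub>R g x" for r x
    proof (rule uniq[OF g])
      show "((\<lambda>\<epsilon>. C \<epsilon> (r *\<^sub>R x)) \<longlongrightarrow> r *\<^sub>R g x) (at_right 0)"
        unfolding blinfun.scaleR_right by (intro tendsto_intros g)
    qed
    show "norm (g x) \<le> norm x * K" for x
    proof (rule Lim_norm_ubound[OF trivial_limit_at_right_real g])
      have "norm (C \<epsilon> x) \<le> norm x * K" if "0 < \<epsilon>" "\<epsilon> \<le> 1" for \<epsilon>
      proof -
        have "norm (C \<epsilon>) \<le> K"
          using mono[OF that] le_op_trans le_op_norm[of "C 1" K]
          by (intro positive_norm_le pos that) (auto simp: K_def)
        then have "norm (C \<epsilon>) * norm x \<le> K * norm x" by (rule mult_right_mono) simp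
        then show ?thesis using norm_blinfun[of "C \<epsilon>" x] by (simp add: mult.commute)
      qed
      then show "\<forall>\<^sub>F \<epsilon> in at_right 0. norm (C \<epsilon> x) \<le> norm x * K"
        unfolding eventually_at_right_field by (intro exI[of _ 1]) auto
    qed
  qed
  define F where "F = Blinfun g"
  have F: "blinfun_apply F = g"
    unfolding F_def by (rule bounded_linear_Blinfun_apply) fact
  have g': "((\<lambda>\<epsilon>. C \<epsilon> x) \<longlongrightarrow> F x) (at_right 0)" for x using g F by simp
  have sF: "selfadj F"
    by (rule selfadj_limit[OF trivial_limit_at_right_real eventually_mono[OF eventually_at_right_0 sC] g'])
  have "0 \<le> qf F x" for x
  proof (rule tendsto_lowerbound[OF _ _ trivial_limit_at_right_real])
    show "((\<lambda>\<epsilon>. qf (C \<epsilon>) x) \<longlongrightarrow> qf F x) (at_right 0)"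
      unfolding qf_def by (intro tendsto_intros g')
    show "\<forall>\<^sub>F \<epsilon> in at_right 0. 0 \<le> qf (C \<epsilon>) x"
      using eventually_at_right_0 by (rule eventually_mono) (simp add: positive_qf pos)
  qed
  then have "F \<in> positive_ops" using sF by (simp add: positive_iff)
  then show ?thesis using g' by (intro bexI[of _ F]) auto
qed

text \<open>The upper bounds pass to the limit. For near-optimality, a vector that is good for the
  shifted pair is at least as good for \<open>A\<close> and \<open>B\<close>, since the shifts only
  add nonnegative terms.\<close>

lemma is_harmonic_mean_limit:
  assumes C: "\<And>\<epsilon>. 0 < \<epsilon> \<Longrightarrow>
      is_harmonic_mean (A + \<epsilon> *\<^sub>R id_blinfun) (B + \<epsilon> *\<^sub>R id_blinfun) (C \<epsilon>)"
    and F: "F \<in> positive_ops" and lim: "\<And>x. ((\<lambda>\<epsilon>. C \<epsilon> x) \<longlongrightarrow> F x) (at_right 0)"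
  shows "is_harmonic_mean A B F"
proof -
  have q: "((\<lambda>\<epsilon>. qf (C \<epsilon>) x) \<longlongrightarrow> qf F x) (at_right 0)" for x
    unfolding qf_def by (intro tendsto_intros lim)
  have "qf F z \<le> 2 * (qf A (z - v) + qf B v)" for z v
  proof (rule tendsto_le[OF trivial_limit_at_right_real _ q])
    have "((\<lambda>\<epsilon>. 2 * (qf A (z - v) + \<epsilon> * (norm (z - v))\<^sup>2 + (qf B v + \<epsilon> * (norm v)\<^sup>2)))
        \<longlongrightarrow> 2 * (qf A (z - v) + 0 * (norm (z - v))\<^sup>2 + (qf B v + 0 * (norm v)\<^sup>2))) (at_right 0)"
      by (intro tendsto_intros)
    then show "((\<lambda>\<epsilon>. 2 * (qf A (z - v) + \<epsilon> * (norm (z - v))\<^sup>2 + (qf B v + \<epsilon> * (norm v)\<^sup>2)))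
        \<longlongrightarrow> 2 * (qf A (z - v) + qf B v)) (at_right 0)" by simp
    show "\<forall>\<^sub>F \<epsilon> in at_right 0. qf (C \<epsilon>) z \<le>
        2 * (qf A (z - v) + \<epsilon> * (norm (z - v))\<^sup>2 + (qf B v + \<epsilon> * (norm v)\<^sup>2))"
      using eventually_at_right_0
    proof (rule eventually_mono)
      fix \<epsilon> :: real assume "0 < \<epsilon>"
      from C[OF this] show "qf (C \<epsilon>) z \<le>
        2 * (qf A (z - v) + \<epsilon> * (norm (z - v))\<^sup>2 + (qf B v + \<epsilon> * (norm v)\<^sup>2))"
        by (auto simp: is_harmonic_mean_def)
    qed
  qed
  moreover have "\<exists>v. 2 * (qf A (z - v) + qf B v) \<le> qf F z + e" if e: "0 < e" for z e
  proof -
    have "\<forall>\<^sub>F \<epsilon> in at_right 0. qf (C \<epsilon>) z < qf F z + e / 2"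
      using e by (intro order_tendstoD(2)[OF q]) simp
    from eventually_conj[OF this eventually_at_right_0] obtain \<epsilon>
      where eps: "0 < \<epsilon>" "qf (C \<epsilon>) z < qf F z + e / 2"
      using eventually_happens'[OF trivial_limit_at_right_real] by blast
    obtain v where v: "2 * (qf (A + \<epsilon> *\<^sub>R id_blinfun) (z - v) + qf (B + \<epsilon> *\<^sub>R id_blinfun) v)
        \<le> qf (C \<epsilon>) z + e / 2"
      using C[OF eps(1)] e unfolding is_harmonic_mean_def by (meson half_gt_zero)
    have "0 \<le> \<epsilon> * (norm (z - v))\<^sup>2" "0 \<le> \<epsilon> * (norm v)\<^sup>2" using eps by auto
    then show ?thesis using v eps(2) by (intro exI[of _ v]) simp
  qed
  ultimately show ?thesis using F by (auto simp: is_harmonic_mean_def)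
qed

text \<open>Reconciles the case distinction and the strong limit in the definition with the
  variational description, through which alone the mean is used from here on.\<close>

lemma harmonic_mean_works:
  fixes A B :: "'a::complex_hilbert \<Rightarrow>\<^sub>L 'a"
  assumes A: "A \<in> positive_ops" and B: "B \<in> positive_ops"
  shows "is_harmonic_mean A B (harmonic_mean A B)"
proof (cases "invertible_op A \<and> invertible_op B")
  case True
  then show ?thesis by (simp add: harmonic_mean_def is_harmonic_mean_inv A B)
next
  case False
  define C where "C \<epsilon> = harmonic_mean_inv (A + \<epsilon> *\<^sub>R id_blinfun) (B + \<epsilon> *\<^sub>R id_blinfun)" for \<epsilon>
  have C: "is_harmonic_mean (A + \<epsilon> *\<^sub>R id_blinfun) (B + \<epsilon> *\<^sub>R id_blinfun) (C \<epsilon>)" if "0 < \<epsilon>" for \<epsilon>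
  proof -
    have "invertible_op (X + \<epsilon> *\<^sub>R id_blinfun)" if "X \<in> positive_ops" for X :: "'a \<Rightarrow>\<^sub>L 'a"
      using \<open>0 < \<epsilon>\<close> positive_qf[OF that]
      by (intro coercive_invertible_qf[of \<epsilon>]) (auto simp: le_op_def)
    then show ?thesis
      unfolding C_def using that A B by (intro is_harmonic_mean_inv) auto
  qed
  have pos: "C \<epsilon> \<in> positive_ops" if "0 < \<epsilon>" for \<epsilon> using C[OF that] by (simp add: is_harmonic_mean_def)
  have "C \<epsilon> \<sqsubseteq> C \<delta>" if "0 < \<epsilon>" "\<epsilon> \<le> \<delta>" for \<epsilon> \<delta>
    using that by (intro is_harmonic_mean_le[OF C C]) (auto simp: le_op_def mult_right_mono)
  then obtain F where F: "F \<in> positive_ops" "\<And>x. ((\<lambda>\<epsilon>. C \<epsilon> x) \<longlongrightarrow> F x) (at_right 0)"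
    using decreasing_strong_limit[of C] pos by blast
  have "harmonic_mean A B = F"
    unfolding harmonic_mean_def C_def[symmetric] if_not_P[OF False]
  proof (rule the_equality)
    show "\<forall>x. ((\<lambda>\<epsilon>. C \<epsilon> x) \<longlongrightarrow> F x) (at_right 0)" using F by blast
  next
    fix G :: "'a \<Rightarrow>\<^sub>L 'a" assume "\<forall>x. ((\<lambda>\<epsilon>. C \<epsilon> x) \<longlongrightarrow> G x) (at_right 0)"
    then show "G = F"
      using F(2) tendsto_unique[OF trivial_limit_at_right_real] by (intro blinfun_eqI) blast
  qed
  then show ?thesis using is_harmonic_mean_limit[OF C F] by simp
qed

lemma harmonic_mean_positive [simp]:
  "A \<in> positive_ops \<Longrightarrow> B \<in> positive_ops \<Longrightarrow> harmonic_mean A B \<in> positive_ops"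
  using harmonic_mean_works by (auto simp: is_harmonic_mean_def)

lemma harmonic_mean_eqI:
  "A \<in> positive_ops \<Longrightarrow> B \<in> positive_ops \<Longrightarrow> is_harmonic_mean A B H \<Longrightarrow> harmonic_mean A B = H"
  using harmonic_mean_works is_harmonic_mean_unique by blast

text \<open>Substitution in the infimum: the adjoint of \<open>T\<close> is invertible, so it
  carries all competitors \<open>v\<close> onto all competitors.\<close>

lemma harmonic_mean_congr:
  assumes A: "A \<in> positive_ops" and B: "B \<in> positive_ops"
    and i: "invertible_op T" and T: "semilinear T"
  shows "harmonic_mean (congr_op T A) (congr_op T B) = congr_op T (harmonic_mean A B)"
proof (rule harmonic_mean_eqI)
  show "is_harmonic_mean (congr_op T A) (congr_op T B) (congr_op T (harmonic_mean A B))"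
    unfolding is_harmonic_mean_def
  proof (intro conjI allI impI)
    fix z v show "qf (congr_op T (harmonic_mean A B)) z \<le> 2 * (qf (congr_op T A) (z - v) + qf (congr_op T B) v)"
      using harmonic_mean_works[OF A B] by (simp add: is_harmonic_mean_def qf_congr_op[OF T] blinfun.diff_right)
  next
    fix z and e :: real assume "0 < e"
    then obtain v where v: "2 * (qf A (adjoint_op T z - v) + qf B v) \<le> qf (harmonic_mean A B) (adjoint_op T z) + e"
      using harmonic_mean_works[OF A B] unfolding is_harmonic_mean_def by blast
    then show "\<exists>v. 2 * (qf (congr_op T A) (z - v) + qf (congr_op T B) v) \<le> qf (congr_op T (harmonic_mean A B)) z + e"
      using invertible_adjoint[OF i T]
      by (intro exI[of _ "inverse_op (adjoint_op T) v"]) (simp add: qf_congr_op[OF T] blinfun.diff_right)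
  qed (simp add: positive_congr_op T A B)
qed (simp_all add: positive_congr_op T A B)

lemma harmonic_mean_zero: "B \<in> positive_ops \<Longrightarrow> harmonic_mean 0 B = 0"
proof (rule harmonic_mean_eqI)
  assume B: "B \<in> positive_ops"
  show "is_harmonic_mean 0 B 0"
    unfolding is_harmonic_mean_def using positive_qf[OF B] by (auto intro!: exI[of _ 0])
qed auto

text \<open>The substitution of \<open>z - v\<close> for \<open>v\<close> exchanges the two
  forms.\<close>

lemma harmonic_mean_commute:
  "A \<in> positive_ops \<Longrightarrow> B \<in> positive_ops \<Longrightarrow> harmonic_mean A B = harmonic_mean B A"
proof (rule harmonic_mean_eqI)
  assume A: "A \<in> positive_ops" and B: "B \<in> positive_ops"
  have H: "is_harmonic_mean B A (harmonic_mean B A)" by (rule harmonic_mean_works[OF B A])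
  show "is_harmonic_mean A B (harmonic_mean B A)"
    unfolding is_harmonic_mean_def
  proof (intro conjI allI impI)
    show "qf (harmonic_mean B A) z \<le> 2 * (qf A (z - v) + qf B v)" for z v
    proof -
      have "qf (harmonic_mean B A) z \<le> 2 * (qf B (z - (z - v)) + qf A (z - v))"
        using H unfolding is_harmonic_mean_def by blast
      then show ?thesis by (simp add: add.commute)
    qed
    show "\<exists>v. 2 * (qf A (z - v) + qf B v) \<le> qf (harmonic_mean B A) z + e" if e: "0 < e" for z e
    proof -
      obtain v where "2 * (qf B (z - v) + qf A v) \<le> qf (harmonic_mean B A) z + e"
        using H e unfolding is_harmonic_mean_def by blast
      then show ?thesis by (intro exI[of _ "z - v"]) (simp add: add.commute)
    qed
  qed (use A B in simp)
qed

section \<open>Rank-one operators\<close>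

text \<open>The symmetrized dyad (x\<otimes>y + y\<otimes>x)/2. It is real-bilinear and polarizes
  \<open>rank1\<close>; being always self-adjoint, it lies in the domain on which \<open>ext\<close>
  is linear.\<close>

lift_definition symop :: "'a::complex_hilbert \<Rightarrow> 'a \<Rightarrow> ('a \<Rightarrow>\<^sub>L 'a)"
  is "\<lambda>x y z. (1/2) *\<^sub>R (cinner z y *\<^sub>C x + cinner z x *\<^sub>C y)"
proof -
  fix x y :: 'a
  show "bounded_linear (\<lambda>z. (1/2) *\<^sub>R (cinner z y *\<^sub>C x + cinner z x *\<^sub>C y))"
  proof (rule bounded_linear_intro[where K = "norm x * norm y"])
    fix z z' :: 'a and r :: real
    show "(1/2) *\<^sub>R (cinner (z + z') y *\<^sub>C x + cinner (z + z') x *\<^sub>C y) =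
        (1/2) *\<^sub>R (cinner z y *\<^sub>C x + cinner z x *\<^sub>C y) + (1/2) *\<^sub>R (cinner z' y *\<^sub>C x + cinner z' x *\<^sub>C y)"
      by (simp add: cinner_add_left scaleC_add_left algebra_simps)
    show "(1/2) *\<^sub>R (cinner (r *\<^sub>R z) y *\<^sub>C x + cinner (r *\<^sub>R z) x *\<^sub>C y) =
        r *\<^sub>R ((1/2) *\<^sub>R (cinner z y *\<^sub>C x + cinner z x *\<^sub>C y))"
      by (simp add: cinner_scaleR_left scaleC_scaleC[symmetric] scaleC_of_real algebra_simps)
    have "norm (cinner z y *\<^sub>C x + cinner z x *\<^sub>C y) \<le> norm z * norm y * norm x + norm z * norm x * norm y"
      by (intro order_trans[OF norm_triangle_ineq] add_mono)
        (simp_all add: norm_scaleC mult_right_mono cmod_cinner_le)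
    then show "norm ((1/2) *\<^sub>R (cinner z y *\<^sub>C x + cinner z x *\<^sub>C y)) \<le> norm z * (norm x * norm y)"
      by (simp add: algebra_simps del: scaleR_right_distrib)
  qed
qed

definition rank1 :: "'a::complex_hilbert \<Rightarrow> ('a \<Rightarrow>\<^sub>L 'a)"
  where "rank1 x = symop x x"

lemma rank1_apply: "rank1 x z = cinner z x *\<^sub>C x"
  by (simp add: rank1_def symop.rep_eq scaleR_2[symmetric])

lemma symop_simps:
  "symop (x + x') y = symop x y + symop x' y" "symop x (y + y') = symop x y + symop x y'"
  "symop (r *\<^sub>R x) y = r *\<^sub>R symop x y" "symop x (r *\<^sub>R y) = r *\<^sub>R symop x y"
  by (rule blinfun_eqI; simp add: symop.rep_eq blinfun.bilinear_simps cinner_add_right cinner_scaleR_right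
      scaleC_add_left scaleC_add_right scaleC_scaleC[symmetric] scaleC_of_real scaleC_scaleR algebra_simps)+

lemma symop_commute: "symop x y = symop y x"
  by (rule blinfun_eqI) (simp add: symop.rep_eq add.commute)

lemma symop_scaleC: "symop (c *\<^sub>C x) y = symop x (cnj c *\<^sub>C y)"
  by (rule blinfun_eqI) (simp add: symop.rep_eq cinner_scaleC_right scaleC_scaleC mult.commute)

lemma rank1_add: "rank1 (x + y) = rank1 x + rank1 y + 2 *\<^sub>R symop x y"
  by (simp add: rank1_def symop_simps symop_commute[of y x] scaleR_2)

lemma rank1_scaleR: "rank1 (r *\<^sub>R x) = r\<^sup>2 *\<^sub>R rank1 x"
  by (simp add: rank1_def symop_simps power2_eq_square)

lemma rank1_scaleC: "rank1 (c *\<^sub>C x) = (cmod c)\<^sup>2 *\<^sub>R rank1 x"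
proof (rule blinfun_eqI)
  fix z
  have "(cnj c * cinner z x * c) *\<^sub>C x = complex_of_real ((cmod c)\<^sup>2) *\<^sub>C cinner z x *\<^sub>C x"
    unfolding scaleC_scaleC complex_norm_square by (simp add: mult.commute mult.left_commute)
  then show "rank1 (c *\<^sub>C x) z = ((cmod c)\<^sup>2 *\<^sub>R rank1 x) z"
    unfolding scaleC_of_real by (simp add: rank1_apply cinner_scaleC_right scaleC_scaleC blinfun.scaleR_left)
qed

lemma rank1_zero [simp]: "rank1 0 = 0"
  by (rule blinfun_eqI) (simp add: rank1_apply)

lemma inner_scaleC_left: "inner (c *\<^sub>C x) y = Re (c * cinner x y)"
  by (simp add: inner_eq_Re_cinner cinner_scaleC_left)

lemma selfadj_symop [simp]: "selfadj (symop x y)"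
  unfolding selfadj_def
proof (intro conjI allI)
  show "complex_linear (symop x y)"
    by (simp add: complex_linear_def symop.rep_eq cinner_scaleC_left scaleC_scaleC scaleC_add_right scaleC_scaleR)
  show "inner (symop x y z) w = inner z (symop x y w)" for z w
    by (simp add: symop.rep_eq inner_simps inner_scaleC_left inner_commute[of z] cinner_commute[of w]
        cinner_commute[of _ z] algebra_simps)
qed

lemma qf_rank1: "qf (rank1 x) z = (cmod (cinner z x))\<^sup>2"
proof -
  have "qf (rank1 x) z = Re (cinner z x * cnj (cinner z x))"
    unfolding qf_def rank1_apply inner_scaleC_left cinner_commute[of x z] ..
  then show ?thesis by (simp add: complex_norm_square[symmetric] del: of_real_power)
qed

lemma positive_rank1 [simp]: "rank1 x \<in> positive_ops"
  by (simp add: positive_iff qf_rank1) (simp add: rank1_def)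

lemma qf_rank1_self: "qf (rank1 x) x = ((norm x)\<^sup>2)\<^sup>2"
  unfolding qf_rank1 cinner_self norm_of_real by simp

lemma rank1_eq_0 [simp]: "rank1 x = 0 \<longleftrightarrow> x = 0"
proof
  assume "rank1 x = 0" then show "x = 0" using qf_rank1_self[of x] by simp
qed simp

lemma rank1_eqD:
  assumes eq: "rank1 x = rank1 y"
  shows "\<exists>c. cmod c = 1 \<and> y = c *\<^sub>C x"
proof (cases "x = 0")
  case True
  then have "y = 0" using eq by (metis rank1_eq_0)
  then show ?thesis using True by (intro exI[of _ 1]) simp
next
  case False
  then have y: "y \<noteq> 0" using eq by (metis rank1_eq_0)
  define d where "d = cinner y x / (norm y)\<^sup>2"
  have "cinner y x *\<^sub>C x = cinner y y *\<^sub>C y"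
    using arg_cong[OF eq, of "\<lambda>F. blinfun_apply F y"] by (simp add: rank1_apply)
  then have "inverse ((norm y)\<^sup>2) *\<^sub>R (cinner y x *\<^sub>C x) = inverse ((norm y)\<^sup>2) *\<^sub>R ((norm y)\<^sup>2 *\<^sub>R y)"
    by (simp only: cinner_self scaleC_of_real)
  then have yd: "y = d *\<^sub>C x"
    using y by (simp add: d_def scaleC_of_real[symmetric] scaleC_scaleC divide_inverse mult.commute)
  have "rank1 x = (cmod d)\<^sup>2 *\<^sub>R rank1 x" using eq yd rank1_scaleC by metis
  then have "((cmod d)\<^sup>2 - 1) *\<^sub>R rank1 x = 0" by (simp add: scaleR_left_diff_distrib)
  then have "(cmod d)\<^sup>2 = 1" using False by simp
  then have "cmod d = 1" using norm_ge_zero[of d] by (auto simp: power2_eq_1_iff)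
  then show ?thesis using yd by blast
qed

text \<open>On the orthogonal complement of \<open>x\<close> the form of \<open>B\<close> is
  squeezed to zero, so \<open>B\<close> vanishes there. Self-adjointness then makes
  \<open>B x\<close> a multiple of \<open>x\<close>.\<close>

lemma le_op_rank1_imp_multiple:
  assumes B: "B \<in> positive_ops" and le: "B \<sqsubseteq> rank1 x"
  shows "\<exists>t\<ge>0. B = t *\<^sub>R rank1 x"
proof (cases "x = 0")
  case True
  then have "qf B z = 0" for z using le positive_qf[OF B, of z] by (auto simp: le_op_def intro: order_antisym)
  then have "B = 0" by (intro blinfun_eqI) (simp add: positive_qf_eq_0[OF B])
  then show ?thesis by (intro exI[of _ 0]) simp
next
  case False
  have sB: "selfadj B" by (rule positive_selfadj[OF B])
  have lB: "complex_linear B" by (rule selfadj_complex_linear[OF sB])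
  have B0: "B z = 0" if "cinner z x = 0" for z
  proof (rule positive_qf_eq_0[OF B])
    have "qf B z \<le> qf (rank1 x) z" using le by (simp add: le_op_def)
    then show "qf B z = 0" using that positive_qf[OF B, of z] by (simp add: qf_rank1)
  qed
  \<comment> \<open>Chosen so that \<open>w = B x - t *\<^sub>R x\<close> is orthogonal to
    \<open>x\<close>; then \<open>B w = 0\<close>, and \<open>w\<close> turns out orthogonal to
    itself.\<close>
  define t where "t = qf B x / (norm x)\<^sup>2"
  have tx: "t * (norm x)\<^sup>2 = qf B x" using False by (simp add: t_def)
  have cBx: "cinner (B x) x = of_real (qf B x)"
  proof -
    have "cnj (cinner (B x) x) = cinner (B x) x"
      using cinner_commute[of x "B x"] selfadj_cinner[OF sB, of x x] by simp
    then have "Im (cinner (B x) x) = 0" by (auto simp: complex_eq_iff)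
    then show ?thesis by (simp add: complex_eq_iff Re_cinner qf_def)
  qed
  define w where "w = B x - t *\<^sub>R x"
  have "cinner w x = of_real (qf B x - t * (norm x)\<^sup>2)"
    by (simp add: w_def cinner_diff_left cinner_scaleR_left cBx cinner_self)
  then have wx: "cinner w x = 0" using tx by simp
  have "inner (B x) w = 0" using selfadj_inner[OF sB, of x w] B0[OF wx] by simp
  moreover have "inner x w = 0" using wx inner_eq_Re_cinner[of w x] by (simp add: inner_commute)
  moreover have "inner w w = inner (B x) w - t * inner x w"
    by (simp add: w_def inner_diff_left)
  ultimately have "inner w w = 0" by simp
  then have Bx: "B x = t *\<^sub>R x" by (simp add: w_def)
  have "B z = ((t / (norm x)\<^sup>2) *\<^sub>R rank1 x) z" for z
  proof -
    define a where "a = cinner z x / (norm x)\<^sup>2"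
    have "cinner (z - a *\<^sub>C x) x = 0"
      using False by (simp add: cinner_diff_left cinner_scaleC_left a_def cinner_self)
    then have "B (z - a *\<^sub>C x) = 0" by (rule B0)
    then have "B z = a *\<^sub>C B x" using lB by (simp add: blinfun.diff_right complex_linear_def)
    also have "\<dots> = (t / (norm x)\<^sup>2) *\<^sub>R (cinner z x *\<^sub>C x)"
      by (simp add: Bx scaleC_of_real[symmetric] scaleC_scaleC a_def mult.commute)
    finally show ?thesis by (simp add: rank1_apply blinfun.scaleR_left)
  qed
  then have "B = (t / (norm x)\<^sup>2) *\<^sub>R rank1 x" by (rule blinfun_eqI)
  moreover have "0 \<le> t / (norm x)\<^sup>2" using positive_qf[OF B] by (simp add: t_def)
  ultimately show ?thesis by blast
qed

text \<open>Cauchy-Schwarz for the form of \<open>A\<close> at \<open>x\<close> and an arbitrary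
  vector is precisely the claimed order relation, and its equality case at \<open>x\<close> makes
  the two forms touch there.\<close>

lemma rank1_below_positive:
  assumes A: "A \<in> positive_ops" and x: "0 < qf A x"
  defines "y \<equiv> (1 / sqrt (qf A x)) *\<^sub>R A x"
  shows "rank1 y \<sqsubseteq> A" "qf (rank1 y) x = qf A x"
proof -
  have q: "qf (rank1 y) z = (cmod (cinner (A x) z))\<^sup>2 / qf A x" for z
    using x by (simp add: y_def rank1_scaleR qf_rank1 power_divide cmod_cinner_commute[of z])
  show "rank1 y \<sqsubseteq> A"
    using positive_cinner_Cauchy_Schwarz[OF A, of x] x
    by (simp add: le_op_def q divide_le_eq mult.commute)
  have "qf A x \<le> cmod (cinner (A x) x)"
    unfolding qf_def Re_cinner[symmetric] by (rule complex_Re_le_cmod)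
  then have "(qf A x)\<^sup>2 \<le> (cmod (cinner (A x) x))\<^sup>2" using x by (intro power_mono) auto
  then have "(cmod (cinner (A x) x))\<^sup>2 = (qf A x)\<^sup>2"
    using positive_cinner_Cauchy_Schwarz[OF A, of x x] by (simp add: power2_eq_square)
  then show "qf (rank1 y) x = qf A x" using x by (simp add: q power2_eq_square)
qed

lemma le_op_rank1_determined:
  assumes A: "A \<in> positive_ops" and B: "B \<in> positive_ops"
    and le: "\<And>y. rank1 y \<sqsubseteq> A \<Longrightarrow> rank1 y \<sqsubseteq> B"
  shows "A \<sqsubseteq> B"
  unfolding le_op_def
proof
  fix x
  show "qf A x \<le> qf B x"
  proof (cases "0 < qf A x")
    case True
    show ?thesis
      using le[OF rank1_below_positive(1)[OF A True]] rank1_below_positive(2)[OF A True]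
      by (simp add: le_op_def) metis
  next
    case False
    then show ?thesis using positive_qf[OF B, of x] by simp
  qed
qed

lemma rank1_iff_minimal:
  assumes A: "A \<in> positive_ops"
  shows "(\<exists>x. A = rank1 x) \<longleftrightarrow> (\<forall>B\<in>positive_ops. B \<sqsubseteq> A \<longrightarrow> (\<exists>t\<ge>0. B = t *\<^sub>R A))"
proof
  assume "\<exists>x. A = rank1 x"
  then show "\<forall>B\<in>positive_ops. B \<sqsubseteq> A \<longrightarrow> (\<exists>t\<ge>0. B = t *\<^sub>R A)"
    using le_op_rank1_imp_multiple by blast
next
  assume m: "\<forall>B\<in>positive_ops. B \<sqsubseteq> A \<longrightarrow> (\<exists>t\<ge>0. B = t *\<^sub>R A)"
  show "\<exists>x. A = rank1 x"
  proof (cases "A = 0")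
    case True then show ?thesis by (intro exI[of _ 0]) simp
  next
    case False
    then obtain x where x: "0 < qf A x" using positive_nonzero_qf[OF A] by blast
    define y where "y = (1 / sqrt (qf A x)) *\<^sub>R A x"
    have y: "rank1 y \<sqsubseteq> A" "qf (rank1 y) x = qf A x"
      unfolding y_def by (rule rank1_below_positive[OF A x])+
    obtain t where t: "0 \<le> t" "rank1 y = t *\<^sub>R A" using m y(1) positive_rank1 by blast
    \<comment> \<open>\<open>rank1 y\<close> touches \<open>A\<close> at \<open>x\<close>, so the
      multiple is \<open>A\<close> itself.\<close>
    have "t = 1" using y(2) x by (simp add: t(2))
    then show ?thesis using t(2) by (intro exI[of _ y]) simp
  qed
qed

text \<open>Conjugate linearity only flips the sign of the imaginary part. Moduli therefore agree
  for both kinds of \<open>T\<close>, and rank-one forms involve nothing else.\<close>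

lemma semilinear_cmod_cinner:
  assumes T: "semilinear T"
  shows "cmod (cinner (adjoint_op T z) x) = cmod (cinner z (T x))"
proof -
  have "inner z (\<i> *\<^sub>C T x) = inner (adjoint_op T z) (\<i> *\<^sub>C x) \<or>
      inner z (\<i> *\<^sub>C T x) = - inner (adjoint_op T z) (\<i> *\<^sub>C x)"
    using T semilinear_inner[OF T, of "\<i> *\<^sub>C x" z]
    unfolding semilinear_def complex_linear_iff conjugate_linear_iff
    by (auto simp: inner_commute)
  moreover have "inner z (T x) = inner (adjoint_op T z) x"
    using semilinear_inner[OF T, of x z] by (simp add: inner_commute)
  ultimately show ?thesis
    by (auto simp: cinner_eq_Complex cmod_def)
qed

lemma congr_op_rank1:
  assumes T: "semilinear T" shows "congr_op T (rank1 x) = rank1 (T x)"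
proof (rule selfadj_eqI)
  show "qf (congr_op T (rank1 x)) z = qf (rank1 (T x)) z" for z
    by (simp add: qf_congr_op[OF T] qf_rank1 semilinear_cmod_cinner[OF T])
qed (simp_all add: selfadj_congr_op[OF T] positive_selfadj)

text \<open>Expresses the norm of a vector through order and the identity, both of which a unital
  automorphism preserves.\<close>

lemma rank1_le_scaled_id:
  assumes c: "0 \<le> c"
  shows "rank1 x \<sqsubseteq> c *\<^sub>R id_blinfun \<longleftrightarrow> (norm x)\<^sup>2 \<le> c"
proof
  assume "rank1 x \<sqsubseteq> c *\<^sub>R id_blinfun"
  then have "qf (rank1 x) x \<le> c * (norm x)\<^sup>2" by (simp add: le_op_def)
  then have "(norm x)\<^sup>2 * (norm x)\<^sup>2 \<le> c * (norm x)\<^sup>2"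
    by (simp add: qf_rank1_self power2_eq_square[of "(norm x)\<^sup>2"])
  then have "(norm x)\<^sup>2 = 0 \<or> (norm x)\<^sup>2 \<le> c" by (rule square_le_mult_cancel) simp
  then show "(norm x)\<^sup>2 \<le> c" using c by auto
next
  assume a: "(norm x)\<^sup>2 \<le> c"
  have "(cmod (cinner z x))\<^sup>2 \<le> c * (norm z)\<^sup>2" for z
  proof -
    have "(cmod (cinner z x))\<^sup>2 \<le> (norm z * norm x)\<^sup>2"
      by (intro power_mono cmod_cinner_le) simp
    also have "\<dots> \<le> c * (norm z)\<^sup>2"
      using mult_right_mono[OF a, of "(norm z)\<^sup>2"] by (simp add: power_mult_distrib mult.commute)
    finally show ?thesis .
  qed
  then show "rank1 x \<sqsubseteq> c *\<^sub>R id_blinfun" by (simp add: le_op_def qf_rank1)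
qed

section \<open>Additive bijections of the positive cone\<close>

text \<open>Cauchy's functional equation: nonnegativity makes \<open>h\<close> monotone, and
  squeezing \<open>real n * r\<close> between consecutive integers bounds the defect by
  \<open>h 1\<close> divided by \<open>n\<close>.\<close>

lemma nonneg_additive_linear:
  fixes h :: "real \<Rightarrow> real"
  assumes add: "\<And>a b. 0 \<le> a \<Longrightarrow> 0 \<le> b \<Longrightarrow> h (a + b) = h a + h b"
    and nn: "\<And>a. 0 \<le> a \<Longrightarrow> 0 \<le> h a" and r: "0 \<le> r"
  shows "h r = r * h 1"
proof -
  have mono: "h a \<le> h b" if "0 \<le> a" "a \<le> b" for a b
    using add[of a "b - a"] nn[of "b - a"] that by simp
  have h0: "h 0 = 0" using add[of 0 0] by simp
  have nat: "h (real n * a) = real n * h a" if "0 \<le> a" for n a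
    using that by (induction n) (simp_all add: h0 add algebra_simps)
  have "\<bar>h r - r * h 1\<bar> * real n \<le> h 1" for n
  proof -
    define m where "m = nat \<lfloor>real n * r\<rfloor>"
    have m: "real m \<le> real n * r" "real n * r \<le> real m + 1"
      using r by (simp_all add: m_def of_nat_nat)
    have "real m * h 1 \<le> real n * h r" "real n * h r \<le> (real m + 1) * h 1"
      using mono[OF _ m(1)] mono[OF _ m(2)] nat[of 1 m] nat[of 1 "Suc m"] nat[OF r, of n] r
      by (simp_all add: add.commute)
    moreover have "real m * h 1 \<le> real n * r * h 1" "real n * r * h 1 \<le> (real m + 1) * h 1"
      using m nn[of 1] by (simp_all add: mult_right_mono)
    ultimately have "\<bar>real n * h r - real n * r * h 1\<bar> \<le> h 1"
      by (simp add: abs_le_iff algebra_simps)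
    moreover have "real n * h r - real n * r * h 1 = (h r - r * h 1) * real n"
      by (simp add: algebra_simps)
    ultimately show ?thesis by (simp add: abs_mult)
  qed
  then have "\<And>n. real n * \<bar>h r - r * h 1\<bar> \<le> h 1" by (simp add: mult.commute)
  then have "\<bar>h r - r * h 1\<bar> = 0"
    using real_archimedian_rdiv_eq_0[of "\<bar>h r - r * h 1\<bar>" "h 1"] nn[of 1] by simp
  then show ?thesis by simp
qed

text \<open>Puts invertibility into terms of order and scaling, which automorphisms respect.\<close>

lemma invertible_iff_dominates:
  assumes A: "A \<in> positive_ops"
  shows "invertible_op A \<longleftrightarrow> (\<exists>k>0. id_blinfun \<sqsubseteq> k *\<^sub>R A)"
proof
  assume "invertible_op A"
  then obtain c where c: "0 < c" "c *\<^sub>R id_blinfun \<sqsubseteq> A" using invertible_positive_coercive A by blast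
  then show "\<exists>k>0. id_blinfun \<sqsubseteq> k *\<^sub>R A"
    by (intro exI[of _ "1 / c"]) (simp add: le_op_def field_simps)
next
  assume "\<exists>k>0. id_blinfun \<sqsubseteq> k *\<^sub>R A"
  then obtain k where "0 < k" "id_blinfun \<sqsubseteq> k *\<^sub>R A" by blast
  then show "invertible_op A"
    by (intro coercive_invertible_qf[of "1 / k"]) (simp_all add: le_op_def field_simps)
qed

lemma le_op_scaled_id: "\<exists>k>0. B \<sqsubseteq> k *\<^sub>R id_blinfun"
  using le_op_norm[of B "norm B + 1"] by (intro exI[of _ "norm B + 1"]) (simp add: add_nonneg_pos)

section \<open>Additive bijections as order automorphisms\<close>

locale positive_bijection =
  fixes \<psi> :: "('a::complex_hilbert \<Rightarrow>\<^sub>L 'a) \<Rightarrow> ('a \<Rightarrow>\<^sub>L 'a)"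
  assumes bij: "bij_betw \<psi> positive_ops positive_ops"
begin

lemma positive [simp]: "A \<in> positive_ops \<Longrightarrow> \<psi> A \<in> positive_ops"
  using bij by (auto simp: bij_betw_def)

lemma surjective: "B \<in> positive_ops \<Longrightarrow> \<exists>A\<in>positive_ops. \<psi> A = B"
  using bij unfolding bij_betw_def by (metis imageE)

lemma injective: "A \<in> positive_ops \<Longrightarrow> B \<in> positive_ops \<Longrightarrow> \<psi> A = \<psi> B \<Longrightarrow> A = B"
  using bij by (auto simp: bij_betw_def inj_on_def)

end

locale cone_automorphism = positive_bijection +
  assumes add: "A \<in> positive_ops \<Longrightarrow> B \<in> positive_ops \<Longrightarrow> \<psi> (A + B) = \<psi> A + \<psi> B"
begin

text \<open>\<open>A \<sqsubseteq> B\<close> means that \<open>B\<close> is \<open>A\<close> plus a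
  positive operator, an additive condition. For the converse, surjectivity writes the difference of
  the images as an image.\<close>

lemma mono_iff:
  assumes A: "A \<in> positive_ops" and B: "B \<in> positive_ops"
  shows "\<psi> A \<sqsubseteq> \<psi> B \<longleftrightarrow> A \<sqsubseteq> B"
proof
  assume "A \<sqsubseteq> B"
  then have d: "B - A \<in> positive_ops" using A B by (simp add: diff_positive_iff positive_selfadj)
  have "\<psi> B = \<psi> A + \<psi> (B - A)" using add[OF A d] by simp
  then show "\<psi> A \<sqsubseteq> \<psi> B" using positive_qf[OF positive[OF d]] by (simp add: le_op_def)
next
  assume "\<psi> A \<sqsubseteq> \<psi> B"
  then have "\<psi> B - \<psi> A \<in> positive_ops" using A B by (simp add: diff_positive_iff positive_selfadj)
  then obtain C where C: "C \<in> positive_ops" "\<psi> C = \<psi> B - \<psi> A" using surjective by blast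
  then have "\<psi> (A + C) = \<psi> B" using add[OF A C(1)] by simp
  then have "A + C = B" by (rule injective[rotated 2]) (use A B C in auto)
  then show "A \<sqsubseteq> B" using positive_qf[OF C(1)] by (auto simp: le_op_def)
qed

text \<open>For fixed \<open>x\<close> the number \<open>qf (\<psi> (r *\<^sub>R A)) x\<close> is a
  nonnegative additive function of \<open>r\<close>.\<close>

lemma scale:
  assumes A: "A \<in> positive_ops" and r: "0 \<le> r"
  shows "\<psi> (r *\<^sub>R A) = r *\<^sub>R \<psi> A"
proof (rule selfadj_eqI)
  fix x
  show "qf (\<psi> (r *\<^sub>R A)) x = qf (r *\<^sub>R \<psi> A) x"
  proof -
    have "qf (\<psi> ((a + b) *\<^sub>R A)) x = qf (\<psi> (a *\<^sub>R A)) x + qf (\<psi> (b *\<^sub>R A)) x" if "0 \<le> a" "0 \<le> b" for a b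
      using add[of "a *\<^sub>R A" "b *\<^sub>R A"] that A by (simp only: scaleR_left_distrib positive_intros qf_simps)
    moreover have "0 \<le> qf (\<psi> (a *\<^sub>R A)) x" if "0 \<le> a" for a
      using that A by (intro positive_qf positive positive_intros)
    ultimately have "qf (\<psi> (r *\<^sub>R A)) x = r * qf (\<psi> (1 *\<^sub>R A)) x"
      using r by (rule nonneg_additive_linear[of "\<lambda>r. qf (\<psi> (r *\<^sub>R A)) x"])
    then show ?thesis by simp
  qed
qed (use A r in \<open>auto intro!: selfadj_intros positive_selfadj\<close>)

lemma rank1_image: "\<exists>y. \<psi> (rank1 x) = rank1 y"
proof (subst rank1_iff_minimal, simp, intro ballI impI)
  fix B assume B: "B \<in> positive_ops" "B \<sqsubseteq> \<psi> (rank1 x)"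
  then obtain C where C: "C \<in> positive_ops" "\<psi> C = B" using surjective by blast
  then have "C \<sqsubseteq> rank1 x" using B mono_iff[of C "rank1 x"] by simp
  then obtain t where "0 \<le> t" "C = t *\<^sub>R rank1 x" using le_op_rank1_imp_multiple C(1) by blast
  then show "\<exists>t\<ge>0. B = t *\<^sub>R \<psi> (rank1 x)" using C(2) scale by auto
qed

lemma rank1_preimage: "\<exists>x. \<psi> (rank1 x) = rank1 y"
proof -
  obtain A where A: "A \<in> positive_ops" "\<psi> A = rank1 y" using surjective positive_rank1 by blast
  have "\<exists>x. A = rank1 x"
    unfolding rank1_iff_minimal[OF A(1)]
  proof (intro ballI impI)
    fix B assume B: "B \<in> positive_ops" "B \<sqsubseteq> A"
    then have "\<psi> B \<sqsubseteq> rank1 y" using mono_iff[of B A] A by simp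
    then obtain t where t: "0 \<le> t" "\<psi> B = t *\<^sub>R rank1 y"
      using le_op_rank1_imp_multiple B(1) positive by blast
    then have "\<psi> B = \<psi> (t *\<^sub>R A)" using scale A by simp
    then have "B = t *\<^sub>R A" by (rule injective[rotated 2]) (use A B t in auto)
    then show "\<exists>t\<ge>0. B = t *\<^sub>R A" using t(1) by blast
  qed
  then show ?thesis using A(2) by auto
qed

text \<open>Makes the normalisation possible. The preimage \<open>E\<close> of the identity lies
  below a multiple of the identity; applying \<open>\<psi>\<close> shows that
  \<open>\<psi> id_blinfun\<close> dominates a positive multiple of the identity.\<close>

lemma identity_image_invertible: "invertible_op (\<psi> id_blinfun)"
proof -
  obtain E where E: "E \<in> positive_ops" "\<psi> E = id_blinfun" using surjective[of id_blinfun] by auto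
  obtain k where k: "0 < k" "E \<sqsubseteq> k *\<^sub>R id_blinfun" using le_op_scaled_id by blast
  then have "id_blinfun \<sqsubseteq> k *\<^sub>R \<psi> id_blinfun"
    using mono_iff[of E "k *\<^sub>R id_blinfun"] E scale by simp
  then show ?thesis using k(1) by (subst invertible_iff_dominates) auto
qed

end

section \<open>Unital automorphisms\<close>

locale unital_cone_automorphism = cone_automorphism +
  assumes unital: "\<psi> id_blinfun = id_blinfun"
begin

lemma norm_rank1:
  assumes "\<psi> (rank1 x) = rank1 y" shows "norm y = norm x"
proof -
  have iff: "(norm x)\<^sup>2 \<le> c \<longleftrightarrow> (norm y)\<^sup>2 \<le> c" if c: "0 \<le> c" for c
  proof -
    have "rank1 x \<sqsubseteq> c *\<^sub>R id_blinfun \<longleftrightarrow> rank1 y \<sqsubseteq> c *\<^sub>R id_blinfun"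
      using mono_iff[of "rank1 x" "c *\<^sub>R id_blinfun"] scale[of id_blinfun c] c unital assms by simp
    then show ?thesis using c by (simp add: rank1_le_scaled_id)
  qed
  have "(norm x)\<^sup>2 = (norm y)\<^sup>2" using iff[of "(norm x)\<^sup>2"] iff[of "(norm y)\<^sup>2"] by simp
  then show ?thesis by simp
qed

text \<open>Orthogonality expressed by order: with \<open>c = (norm z)\<^sup>2\<close>, the sum
  \<open>c *\<^sub>R rank1 e + rank1 z\<close> still lies below
  \<open>c *\<^sub>R id_blinfun\<close>. The image of this relation, evaluated at the unit vector
  \<open>f\<close>, leaves no room for \<open>cinner f v\<close>.\<close>

lemma orthogonal_rank1:
  assumes e: "norm e = 1" "\<psi> (rank1 e) = rank1 f" and z: "cinner z e = 0" "\<psi> (rank1 z) = rank1 v"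
  shows "cinner f v = 0"
proof -
  define c where "c = (norm z)\<^sup>2"
  have c: "0 \<le> c" by (simp add: c_def)
  have "c *\<^sub>R rank1 e + rank1 z \<sqsubseteq> c *\<^sub>R id_blinfun"
    unfolding le_op_def
  proof
    fix w
    define u where "u = w - cinner w e *\<^sub>C e"
    have ee: "cinner e e = 1" using e(1) by (simp add: cinner_self)
    have wz: "cinner w z = cinner u z"
      using z(1) cinner_commute[of e z] by (simp add: u_def cinner_diff_left cinner_scaleC_left)
    have ue: "cinner u e = 0" by (simp add: u_def cinner_diff_left cinner_scaleC_left ee)
    have "w = u + cinner w e *\<^sub>C e" by (simp add: u_def)
    then have "cinner w w = cinner u u + cinner w e * cnj (cinner w e)"
      using ue cinner_commute[of e u] ee
      by (metis (no_types, lifting) add.commute add.left_neutral cinner_add_left cinner_add_right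
          cinner_scaleC_left cinner_scaleC_right complex_cnj_zero mult.right_neutral mult_zero_right)
    then have nw: "(norm w)\<^sup>2 = (norm u)\<^sup>2 + (cmod (cinner w e))\<^sup>2"
      unfolding cinner_self complex_norm_square[symmetric] by (simp only: of_real_add[symmetric] of_real_eq_iff)
    have "(cmod (cinner w z))\<^sup>2 \<le> (norm u * norm z)\<^sup>2"
      unfolding wz by (intro power_mono cmod_cinner_le) simp
    then have "(cmod (cinner w z))\<^sup>2 \<le> c * (norm u)\<^sup>2" by (simp add: c_def power_mult_distrib mult.commute)
    then show "qf (c *\<^sub>R rank1 e + rank1 z) w \<le> qf (c *\<^sub>R id_blinfun) w"
      by (simp add: qf_rank1 nw algebra_simps)
  qed
  then have "c *\<^sub>R rank1 f + rank1 v \<sqsubseteq> c *\<^sub>R id_blinfun"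
    using mono_iff[of "c *\<^sub>R rank1 e + rank1 z" "c *\<^sub>R id_blinfun"] c e(2) z(2)
    by (simp add: add scale unital)
  then have "qf (c *\<^sub>R rank1 f + rank1 v) f \<le> qf (c *\<^sub>R id_blinfun) f" by (simp add: le_op_def)
  moreover have "norm f = 1" using norm_rank1[OF e(2)] e(1) by simp
  ultimately have "(cmod (cinner f v))\<^sup>2 \<le> 0"
    by (simp add: qf_rank1_self) (simp add: qf_rank1)
  then show ?thesis by simp
qed

text \<open>The real-linear extension of \<open>\<psi>\<close> to all self-adjoint operators.\<close>

definition ext :: "('a \<Rightarrow>\<^sub>L 'a) \<Rightarrow> ('a \<Rightarrow>\<^sub>L 'a)"
  where "ext A = \<psi> (A + norm A *\<^sub>R id_blinfun) - norm A *\<^sub>R id_blinfun"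

text \<open>Any sufficient shift may replace \<open>norm A\<close>, because multiples of the
  identity are fixed by \<open>\<psi>\<close>; both shifts are added to compare them.\<close>

lemma ext_eq:
  assumes A: "A + c *\<^sub>R id_blinfun \<in> positive_ops" "selfadj A" and c: "0 \<le> c"
  shows "ext A = \<psi> (A + c *\<^sub>R id_blinfun) - c *\<^sub>R id_blinfun"
proof -
  have p: "A + norm A *\<^sub>R id_blinfun \<in> positive_ops" using A(2) by (rule positive_norm_add) simp
  have "\<psi> (A + c *\<^sub>R id_blinfun) + norm A *\<^sub>R id_blinfun = \<psi> ((A + c *\<^sub>R id_blinfun) + norm A *\<^sub>R id_blinfun)"
    using A by (simp add: add scale unital)
  also have "\<dots> = \<psi> ((A + norm A *\<^sub>R id_blinfun) + c *\<^sub>R id_blinfun)" by (simp add: algebra_simps)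
  also have "\<dots> = \<psi> (A + norm A *\<^sub>R id_blinfun) + c *\<^sub>R id_blinfun"
    by (subst add) (simp_all add: p c scale unital)
  finally show ?thesis by (simp add: ext_def algebra_simps)
qed

lemma ext_positive: "A \<in> positive_ops \<Longrightarrow> ext A = \<psi> A"
  using ext_eq[of A 0] by (simp add: positive_selfadj)

lemma ext_add:
  assumes A: "selfadj A" and B: "selfadj B"
  shows "ext (A + B) = ext A + ext B"
proof -
  let ?a = "norm A" and ?b = "norm B"
  have p: "A + ?a *\<^sub>R id_blinfun \<in> positive_ops" "B + ?b *\<^sub>R id_blinfun \<in> positive_ops"
    using A B by (simp_all add: positive_norm_add)
  have eq: "(A + B) + (?a + ?b) *\<^sub>R id_blinfun = (A + ?a *\<^sub>R id_blinfun) + (B + ?b *\<^sub>R id_blinfun)"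
    by (simp add: algebra_simps)
  have "ext (A + B) = \<psi> ((A + B) + (?a + ?b) *\<^sub>R id_blinfun) - (?a + ?b) *\<^sub>R id_blinfun"
  proof (rule ext_eq)
    show "(A + B) + (?a + ?b) *\<^sub>R id_blinfun \<in> positive_ops"
      unfolding eq using p by (rule positive_intros)
  qed (use A B in auto)
  also have "\<dots> = ext A + ext B"
    unfolding eq add[OF p] by (simp add: ext_def algebra_simps)
  finally show ?thesis .
qed

lemma ext_scale:
  assumes A: "selfadj A" shows "ext (r *\<^sub>R A) = r *\<^sub>R ext A"
proof -
  have nonneg: "ext (r *\<^sub>R A) = r *\<^sub>R ext A" if r: "0 \<le> r" for r
  proof -
    have p: "A + norm A *\<^sub>R id_blinfun \<in> positive_ops" using A by (simp add: positive_norm_add)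
    have eq: "r *\<^sub>R A + (r * norm A) *\<^sub>R id_blinfun = r *\<^sub>R (A + norm A *\<^sub>R id_blinfun)"
      by (simp add: algebra_simps)
    have "ext (r *\<^sub>R A) = \<psi> (r *\<^sub>R A + (r * norm A) *\<^sub>R id_blinfun) - (r * norm A) *\<^sub>R id_blinfun"
    proof (rule ext_eq)
      show "r *\<^sub>R A + (r * norm A) *\<^sub>R id_blinfun \<in> positive_ops"
        unfolding eq using p r by (rule positive_intros)
    qed (use A r in auto)
    also have "\<dots> = r *\<^sub>R ext A"
      unfolding eq scale[OF p r] by (simp add: ext_def algebra_simps)
    finally show ?thesis .
  qed
  show ?thesis
  proof (cases "0 \<le> r")
    case False
    then have "ext (r *\<^sub>R A) + (- r) *\<^sub>R ext A = ext (r *\<^sub>R A) + ext ((- r) *\<^sub>R A)"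
      by (subst nonneg) auto
    also have "\<dots> = ext (0 *\<^sub>R A)" using A by (subst ext_add[symmetric]) auto
    also have "\<dots> = 0" using nonneg[of 0] by simp
    finally show ?thesis by simp
  qed (rule nonneg)
qed

text \<open>The cross term is the coefficient of \<open>2 * s\<close> in the images of
  \<open>rank1 (e + s *\<^sub>R z)\<close>. That these are positive, and of rank one for
  \<open>s = 1\<close> and \<open>s = -1\<close>, forces the form \<open>symop u f\<close>; the
  choice of \<open>u\<close> absorbs the phases of \<open>v\<close> and \<open>w\<close>.\<close>

lemma rank1_pair:
  assumes e: "norm e = 1" "\<psi> (rank1 e) = rank1 f" and z: "cinner z e = 0"
  shows "\<exists>u. cinner u f = 0 \<and> \<psi> (rank1 z) = rank1 u \<and> ext (symop z e) = symop u f"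
proof -
  obtain v w w' where v: "\<psi> (rank1 z) = rank1 v"
    and w: "\<psi> (rank1 (e + z)) = rank1 w" and w': "\<psi> (rank1 (e + (- 1) *\<^sub>R z)) = rank1 w'"
    using rank1_image by metis
  let ?S = "ext (symop z e)"
  have ee: "cinner e e = 1" using e(1) by (simp add: cinner_self)
  have nf: "norm f = 1" using norm_rank1[OF e(2)] e(1) by simp
  then have ff: "cinner f f = 1" by (simp add: cinner_self)
  have fv: "cinner f v = 0" by (rule orthogonal_rank1[OF e z v])
  then have vf: "cinner v f = 0" using cinner_commute[of v f] by simp
  have nv: "norm v = norm z" by (rule norm_rank1[OF v])
  have expand: "\<psi> (rank1 (e + s *\<^sub>R z)) = rank1 f + s\<^sup>2 *\<^sub>R rank1 v + (2 * s) *\<^sub>R ?S" for s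
  proof -
    have "rank1 (e + s *\<^sub>R z) = (rank1 e + s\<^sup>2 *\<^sub>R rank1 z) + (2 * s) *\<^sub>R symop z e"
      by (simp add: rank1_add rank1_scaleR symop_simps symop_commute[of e z])
    then have "ext (rank1 (e + s *\<^sub>R z)) = ext (rank1 e + s\<^sup>2 *\<^sub>R rank1 z) + ext ((2 * s) *\<^sub>R symop z e)"
      by (simp add: ext_add positive_selfadj)
    then show ?thesis
      by (simp add: ext_positive add scale e(2) v ext_scale)
  qed
  have Sf: "qf ?S f = 0"
  proof -
    \<comment> \<open>An affine function of \<open>s\<close> that is never negative must be
      constant.\<close>
    have q: "0 \<le> 1 + 2 * s * qf ?S f" for s
    proof -
      have "0 \<le> qf (\<psi> (rank1 (e + s *\<^sub>R z))) f" by (intro positive_qf positive positive_rank1)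
      then show ?thesis unfolding expand by (simp add: qf_rank1 fv ff)
    qed
    show ?thesis
    proof (rule ccontr)
      assume "qf ?S f \<noteq> 0"
      then show False using q[of "- 1 / qf ?S f"] by simp
    qed
  qed
  have S1: "rank1 w = rank1 f + rank1 v + 2 *\<^sub>R ?S" using expand[of 1] w by simp
  have S2: "rank1 w' = rank1 f + rank1 v - 2 *\<^sub>R ?S" using expand[of "-1"] w' by simp
  define \<alpha> where "\<alpha> = cinner w f"
  \<comment> \<open>For \<open>v = 0\<close> the division yields 0, which is the right coefficient
    then.\<close>
  define \<beta> where "\<beta> = cinner w v / (norm v)\<^sup>2"
  have "qf (rank1 w) f = 1" unfolding S1 by (simp add: Sf qf_rank1 fv ff)
  then have a1: "cmod \<alpha> = 1"
    by (simp add: qf_rank1 \<alpha>_def cmod_cinner_commute[of f] power2_eq_1_iff)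
      (use norm_ge_zero[of "cinner w f"] in linarith)
  define r where "r = w - \<alpha> *\<^sub>C f - \<beta> *\<^sub>C v"
  have rf: "cinner r f = 0" by (simp add: r_def cinner_diff_left cinner_scaleC_left ff vf \<alpha>_def)
  have rv: "cinner r v = 0"
    by (cases "v = 0") (simp_all add: r_def cinner_diff_left cinner_scaleC_left fv \<beta>_def cinner_self)
  \<comment> \<open>Adding the expansions for \<open>s = 1\<close> and \<open>s = -1\<close> cancels
    \<open>?S\<close>, and \<open>r\<close> is orthogonal to \<open>f\<close> and \<open>v\<close>.
    Hence \<open>w\<close> has no component outside their span.\<close>
  have "qf (rank1 w) r + qf (rank1 w') r = 0"
    unfolding S1 S2 by (simp add: qf_rank1 rf rv)
  then have "qf (rank1 w) r = 0"
    using positive_qf[OF positive_rank1, of w r] positive_qf[OF positive_rank1, of w' r] by linarith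
  then have "cinner r w = 0" by (simp add: qf_rank1)
  then have "cinner r r = 0"
    using rf rv by (subst (2) r_def) (simp add: cinner_diff_right cinner_scaleC_right)
  then have "r = 0" by (simp add: cinner_self)
  then have w_eq: "w = \<alpha> *\<^sub>C f + \<beta> *\<^sub>C v" by (simp add: r_def algebra_simps)
  \<comment> \<open>\<open>w\<close> is determined only up to phase; dividing by the unit
    \<open>\<alpha>\<close> normalises its component along \<open>f\<close>.\<close>
  define \<gamma> where "\<gamma> = cnj \<alpha> * \<beta>"
  define u where "u = \<gamma> *\<^sub>C v"
  have "\<alpha> * cnj \<alpha> = 1" using a1 complex_norm_square[of \<alpha>] by simp
  then have "\<alpha> * \<gamma> = \<beta>" by (simp add: \<gamma>_def mult.assoc[symmetric])
  then have "w = \<alpha> *\<^sub>C (f + u)" by (simp add: w_eq u_def scaleC_add_right scaleC_scaleC)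
  then have rw: "rank1 w = rank1 (f + u)" by (simp add: rank1_scaleC a1)
  have uf: "cinner u f = 0" by (simp add: u_def cinner_scaleC_left vf)
  \<comment> \<open>Comparing the norm of \<open>w\<close>, computed once from \<open>f + u\<close>
    and once from \<open>e + z\<close>, shows that \<open>\<gamma>\<close> is unimodular.\<close>
  have ru: "rank1 u = rank1 v"
  proof (cases "v = 0")
    case False
    have pyth: "(norm (a + b))\<^sup>2 = (norm a)\<^sup>2 + (norm b)\<^sup>2" if "cinner b a = 0" for a b :: 'a
    proof -
      have "inner b a = 0" using that by (simp add: inner_eq_Re_cinner)
      then show ?thesis by (simp add: power2_norm_eq_inner inner_simps inner_commute)
    qed
    have "(norm w)\<^sup>2 = 1 + (norm u)\<^sup>2"
      using pyth[OF uf] nf \<open>w = \<alpha> *\<^sub>C (f + u)\<close> a1 by (simp add: norm_scaleC)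
    moreover have "(norm w)\<^sup>2 = 1 + (norm z)\<^sup>2"
      using norm_rank1[OF w] pyth[OF z] e(1) by simp
    ultimately have "(norm u)\<^sup>2 = (norm v)\<^sup>2" by (simp add: nv)
    then have "(cmod \<gamma>)\<^sup>2 = 1" using False by (simp add: u_def norm_scaleC power_mult_distrib)
    then show ?thesis by (simp add: u_def rank1_scaleC)
  qed (simp add: u_def)
  have "2 *\<^sub>R ?S = 2 *\<^sub>R symop u f"
    using S1 unfolding rw rank1_add[of f u] ru symop_commute[of f u] by simp
  then have "?S = symop u f" by simp
  then show ?thesis using uf v ru by auto
qed

lemma representation:
  "\<exists>T. semilinear T \<and> invertible_op T \<and> (\<forall>A\<in>positive_ops. \<psi> A = congr_op T A)"
proof (cases "\<exists>x::'a. x \<noteq> 0")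
  \<comment> \<open>The zero space is treated apart since it contains no unit vector
    \<open>e\<close>.\<close>
  case False
  then have triv: "x = 0" for x :: 'a by blast
  have eq: "A = B" for A B :: "'a \<Rightarrow>\<^sub>L 'a"
  proof (rule blinfun_eqI)
    show "A x = B x" for x using triv[of "A x"] triv[of "B x"] by simp
  qed
  show ?thesis
    by (intro exI[of _ id_blinfun] conjI ballI invertible_opI[where S = id_blinfun])
      (simp_all add: eq[of "\<psi> _"])
next
  case True
  then obtain x0 :: 'a where "x0 \<noteq> 0" by blast
  define e where "e = (1 / norm x0) *\<^sub>R x0"
  have ne: "norm e = 1" using \<open>x0 \<noteq> 0\<close> by (simp add: e_def)
  then have ee: "cinner e e = 1" by (simp add: cinner_self)
  obtain f where f: "\<psi> (rank1 e) = rank1 f" using rank1_image by blast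
  have nf: "norm f = 1" using norm_rank1[OF f] ne by simp
  then have ff: "cinner f f = 1" by (simp add: cinner_self)
  \<comment> \<open>\<open>symop u f\<close> sends \<open>f\<close> to half of \<open>u\<close> when
    \<open>u\<close> is orthogonal to the unit vector \<open>f\<close>. Reading \<open>U z\<close>
    off in this way makes \<open>U\<close> real-linear by construction and leaves no phase to
    choose.\<close>
  define U where "U z = 2 *\<^sub>R ext (symop z e) f" for z
  have U: "\<psi> (rank1 z) = rank1 (U z)" "ext (symop z e) = symop (U z) f" if z: "cinner z e = 0" for z
  proof -
    obtain u where u: "cinner u f = 0" "\<psi> (rank1 z) = rank1 u" "ext (symop z e) = symop u f"
      using rank1_pair[OF ne f z] by blast
    have "cinner f u = 0" using u(1) cinner_commute[of f u] by simp
    then have "U z = u" by (simp add: U_def u(3) symop.rep_eq ff)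
    then show "\<psi> (rank1 z) = rank1 (U z)" "ext (symop z e) = symop (U z) f" using u by simp_all
  qed
  have U_add: "U (x + y) = U x + U y" for x y
    by (simp add: U_def symop_simps ext_add blinfun.add_left scaleR_add_right)
  have U_scale: "U (r *\<^sub>R x) = r *\<^sub>R U x" for r x
    by (simp add: U_def symop_simps ext_scale blinfun.scaleR_left)
  have U_norm: "norm (U z) = norm z" if "cinner z e = 0" for z
    by (rule norm_rank1[OF U(1)[OF that]])
  have perp_ii: "cinner (c *\<^sub>C z) e = 0" if "cinner z e = 0" for z c
    using that by (simp add: cinner_scaleC_left)
  have U_ii: "U (\<i> *\<^sub>C z) = \<i> *\<^sub>C U z \<or> U (\<i> *\<^sub>C z) = - (\<i> *\<^sub>C U z)" if z: "cinner z e = 0" for z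
  proof (cases "z = 0")
    case True then show ?thesis using U_scale[of 0 0] by simp
  next
    case False
    have "rank1 (U z) = rank1 (U (\<i> *\<^sub>C z))"
      using U(1)[OF z] U(1)[OF perp_ii[OF z, of \<i>]] by (simp add: rank1_scaleC)
    then obtain \<gamma> where g: "cmod \<gamma> = 1" "U (\<i> *\<^sub>C z) = \<gamma> *\<^sub>C U z" using rank1_eqD by blast
    \<comment> \<open>Comparing norms at \<open>(1 + \<i>) *\<^sub>C z\<close> gives
      \<open>cmod (1 + \<gamma>) = cmod (1 + \<i>)\<close>; for unimodular \<open>\<gamma>\<close>
      this means that its real part is zero.\<close>
    have "z + \<i> *\<^sub>C z = (1 + \<i>) *\<^sub>C z" by (simp add: scaleC_add_left)
    moreover have "U (z + \<i> *\<^sub>C z) = (1 + \<gamma>) *\<^sub>C U z" by (simp add: U_add g(2) scaleC_add_left)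
    ultimately have "cmod (1 + \<i>) * norm z = cmod (1 + \<gamma>) * norm z"
      using U_norm[OF perp_ii[OF z, of "1 + \<i>"]] U_norm[OF z] by (auto simp: norm_scaleC)
    then have "(cmod (1 + \<gamma>))\<^sup>2 = (cmod (1 + \<i>))\<^sup>2" using False by simp
    moreover have "(Re \<gamma>)\<^sup>2 + (Im \<gamma>)\<^sup>2 = 1" using g(1) by (simp add: cmod_def)
    ultimately have re: "Re \<gamma> = 0"
      unfolding cmod_power2 by (simp add: power2_eq_square algebra_simps)
    then have im: "(Im \<gamma>)\<^sup>2 = 1" using \<open>(Re \<gamma>)\<^sup>2 + (Im \<gamma>)\<^sup>2 = 1\<close> by simp
    from re im have "\<gamma> = \<i> \<or> \<gamma> = - \<i>" by (auto simp: complex_eq_iff power2_eq_1_iff)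
    then show ?thesis using g(2) by (auto simp: scaleC_minus_left)
  qed
  define lin where "lin \<longleftrightarrow> (\<forall>z. cinner z e = 0 \<longrightarrow> U (\<i> *\<^sub>C z) = \<i> *\<^sub>C U z)"
  have anti: "U (\<i> *\<^sub>C z) = - (\<i> *\<^sub>C U z)" if nl: "\<not> lin" and z: "cinner z e = 0" for z
  proof (rule ccontr)
    assume ne2: "U (\<i> *\<^sub>C z) \<noteq> - (\<i> *\<^sub>C U z)"
    then have z2: "U (\<i> *\<^sub>C z) = \<i> *\<^sub>C U z" using U_ii[OF z] by blast
    obtain z' where z': "cinner z' e = 0" "U (\<i> *\<^sub>C z') \<noteq> \<i> *\<^sub>C U z'" using nl by (auto simp: lin_def)
    then have z1: "U (\<i> *\<^sub>C z') = - (\<i> *\<^sub>C U z')" using U_ii by blast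
    \<comment> \<open>The sum of a vector violating the conjugate rule and one violating the linear
      rule would violate both.\<close>
    have "cinner (z + z') e = 0" using z z'(1) by (simp add: cinner_add_left)
    from U_ii[OF this] show False
    proof
      assume "U (\<i> *\<^sub>C (z + z')) = \<i> *\<^sub>C U (z + z')"
      then have "- (\<i> *\<^sub>C U z') = \<i> *\<^sub>C U z'" by (simp add: scaleC_add_right U_add z1 z2)
      then show False using z1 z'(2) by simp
    next
      assume "U (\<i> *\<^sub>C (z + z')) = - (\<i> *\<^sub>C U (z + z'))"
      then have "\<i> *\<^sub>C U z = - (\<i> *\<^sub>C U z)" by (simp add: scaleC_add_right U_add z1 z2)
      then show False using z2 ne2 by simp
    qed
  qed
  define \<tau> where "\<tau> c = (if lin then c else cnj c)" for c
  have tau: "\<tau> (a + b) = \<tau> a + \<tau> b" "\<tau> (of_real r * a) = of_real r * \<tau> a" "cnj (\<tau> a) = \<tau> (cnj a)"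
    "cmod (\<tau> a) = cmod a" "\<tau> (\<tau> a) = a" "\<tau> (a * b) = \<tau> a * \<tau> b" for a b r
    by (simp_all add: \<tau>_def)
  have U_tau: "U (c *\<^sub>C z) = \<tau> c *\<^sub>C U z" if z: "cinner z e = 0" for c z
  proof -
    have "U (\<i> *\<^sub>C z) = \<tau> \<i> *\<^sub>C U z"
      using z anti[OF _ z] by (auto simp: \<tau>_def lin_def scaleC_minus_left)
    then show ?thesis
      unfolding scaleC_eq_Re_Im[of c z] scaleC_eq_Re_Im[of "\<tau> c" "U z"]
      by (simp add: U_add U_scale \<tau>_def scaleC_minus_left)
  qed
  define g where "g x = \<tau> (cinner x e) *\<^sub>C f + U (x - cinner x e *\<^sub>C e)" for x
  have perp: "cinner (x - cinner x e *\<^sub>C e) e = 0" for x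
    by (simp add: cinner_diff_left cinner_scaleC_left ee)
  have sym_tau: "ext (symop (\<alpha> *\<^sub>C e) z) = symop (\<tau> \<alpha> *\<^sub>C f) (U z)" if z: "cinner z e = 0" for \<alpha> z
  proof -
    have "symop (\<alpha> *\<^sub>C e) z = symop (cnj \<alpha> *\<^sub>C z) e"
      by (simp add: symop_scaleC symop_commute[of e])
    then have "ext (symop (\<alpha> *\<^sub>C e) z) = symop (\<tau> (cnj \<alpha>) *\<^sub>C U z) f"
      using U(2)[OF perp_ii[OF z, of "cnj \<alpha>"]] U_tau[OF z] by simp
    also have "\<dots> = symop (\<tau> \<alpha> *\<^sub>C f) (U z)"
      by (simp add: symop_scaleC tau(3) symop_commute[of f])
    finally show ?thesis .
  qed
  have g_rank1: "\<psi> (rank1 x) = rank1 (g x)" for x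
  proof -
    define \<alpha> where "\<alpha> = cinner x e"
    define z where "z = x - \<alpha> *\<^sub>C e"
    have z: "cinner z e = 0" unfolding z_def \<alpha>_def by (rule perp)
    have "rank1 x = rank1 (\<alpha> *\<^sub>C e + z)" by (simp add: z_def)
    also have "\<dots> = ((cmod \<alpha>)\<^sup>2 *\<^sub>R rank1 e + rank1 z) + 2 *\<^sub>R symop (\<alpha> *\<^sub>C e) z"
      by (simp add: rank1_add rank1_scaleC)
    finally have "ext (rank1 x) = ext ((cmod \<alpha>)\<^sup>2 *\<^sub>R rank1 e + rank1 z) + 2 *\<^sub>R ext (symop (\<alpha> *\<^sub>C e) z)"
      by (simp add: ext_add ext_scale positive_selfadj)
    then have "\<psi> (rank1 x) = (cmod \<alpha>)\<^sup>2 *\<^sub>R rank1 f + rank1 (U z) + 2 *\<^sub>R symop (\<tau> \<alpha> *\<^sub>C f) (U z)"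
      by (simp add: ext_positive add scale f U(1)[OF z] sym_tau[OF z])
    also have "\<dots> = rank1 (\<tau> \<alpha> *\<^sub>C f + U z)"
      by (simp add: rank1_add rank1_scaleC tau(4))
    finally show ?thesis by (simp add: g_def \<alpha>_def z_def)
  qed
  have g_norm: "norm (g x) = norm x" for x by (rule norm_rank1[OF g_rank1])
  have g_add: "g (x + y) = g x + g y" for x y
  proof -
    have "x + y - cinner (x + y) e *\<^sub>C e = (x - cinner x e *\<^sub>C e) + (y - cinner y e *\<^sub>C e)"
      by (simp add: cinner_add_left scaleC_add_left)
    then show ?thesis by (simp only: g_def U_add) (simp add: cinner_add_left tau scaleC_add_left)
  qed
  have g_scaleC: "g (c *\<^sub>C x) = \<tau> c *\<^sub>C g x" for c x
  proof -
    have "c *\<^sub>C x - cinner (c *\<^sub>C x) e *\<^sub>C e = c *\<^sub>C (x - cinner x e *\<^sub>C e)"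
      by (simp add: cinner_scaleC_left scaleC_diff_right scaleC_scaleC)
    then show ?thesis
      by (simp only: g_def U_tau[OF perp]) (simp add: cinner_scaleC_left tau scaleC_add_right scaleC_scaleC)
  qed
  have g_scaleR: "g (r *\<^sub>R x) = r *\<^sub>R g x" for r x
    using g_scaleC[of "of_real r" x] by (simp add: scaleC_of_real \<tau>_def split: if_splits)
  have "bounded_linear g"
    by (rule bounded_linear_intro[where K = 1]) (simp_all add: g_add g_scaleR g_norm)
  define T where "T = Blinfun g"
  have T: "blinfun_apply T = g" unfolding T_def by (rule bounded_linear_Blinfun_apply) fact
  have sT: "semilinear T"
    unfolding semilinear_def complex_linear_def conjugate_linear_def T g_scaleC by (simp add: \<tau>_def)
  have surj: "\<exists>x. g x = y" for y
  proof -
    obtain x where "\<psi> (rank1 x) = rank1 y" using rank1_preimage by blast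
    then have "rank1 (g x) = rank1 y" by (simp add: g_rank1)
    then obtain c where "y = c *\<^sub>C g x" using rank1_eqD by blast
    then have "g (\<tau> c *\<^sub>C x) = y" by (simp add: g_scaleC tau)
    then show ?thesis by blast
  qed
  have iT: "invertible_op T"
  proof (rule invertible_opI_bounded_below)
    show "surj (blinfun_apply T)" using surj unfolding T surj_def by metis
    show "norm x \<le> 1 * norm (T x)" for x by (simp add: T g_norm)
  qed
  have "\<psi> A = congr_op T A" if A: "A \<in> positive_ops" for A
  proof -
    \<comment> \<open>\<open>\<psi>\<close> and the congruence preserve and reflect order and agree
      on rank-one operators, so \<open>\<psi> A\<close> and \<open>congr_op T A\<close> dominate the
      same ones.\<close>
    have iff: "rank1 y \<sqsubseteq> \<psi> A \<longleftrightarrow> rank1 y \<sqsubseteq> congr_op T A" for y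
    proof -
      obtain x where x: "g x = y" using surj by blast
      have "rank1 y \<sqsubseteq> \<psi> A \<longleftrightarrow> rank1 x \<sqsubseteq> A"
        using mono_iff[OF positive_rank1 A, of x] by (simp add: g_rank1 x)
      also have "\<dots> \<longleftrightarrow> congr_op T (rank1 x) \<sqsubseteq> congr_op T A" by (rule congr_op_le_iff[OF iT sT, symmetric])
      finally show ?thesis by (simp add: congr_op_rank1[OF sT] T x)
    qed
    have p: "\<psi> A \<in> positive_ops" "congr_op T A \<in> positive_ops"
      using A by (simp_all add: positive_congr_op[OF sT])
    show ?thesis
      by (rule le_op_antisym) (use p iff le_op_rank1_determined positive_selfadj in blast)+
  qed
  then show ?thesis using sT iT by blast
qed

end

text \<open>The exponent 2 is a polynomial on the nonnegative spectrum, so a constant approximating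
  sequence identifies \<open>positive_power R 2\<close> with the composition of \<open>R\<close>
  with itself.\<close>

lemma positive_sqrt:
  assumes D: "D \<in> positive_ops"
  shows "\<exists>R\<in>positive_ops. R o\<^sub>L R = D"
proof -
  define R where "R = positive_power D (1/2)"
  have R: "R \<in> positive_ops" using D by (simp add: R_def)
  have "(\<lambda>n. poly_op [:0, 0, 1:] R) \<longlonglongrightarrow> positive_power R 2"
    unfolding positive_power_def
  proof (rule cfc_tendsto[OF positive_selfadj[OF R]])
    show "uniform_limit (real_spectrum R) (\<lambda>n. poly [:0, 0, 1:]) (\<lambda>t. t powr 2) sequentially"
    proof (rule uniform_limitI)
      fix \<epsilon> :: real assume e: "0 < \<epsilon>"
      have "poly [:0, 0, 1:] t = t powr 2" if "t \<in> real_spectrum R" for t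
        using real_spectrum_positive[OF R] that by (auto simp: powr_numeral power2_eq_square)
      then show "\<forall>\<^sub>F n in sequentially. \<forall>x\<in>real_spectrum R. dist (poly [:0, 0, 1:] x) (x powr 2) < \<epsilon>"
        using e by (intro always_eventually allI ballI) (simp only: dist_self)
    qed
  qed
  moreover have "positive_power R 2 = D"
    unfolding R_def by (rule positive_power_positive_power[OF D]) simp_all
  moreover have "poly_op [:0, 0, 1:] R = R o\<^sub>L R" by (simp add: blinfun_compose.zero_right)
  ultimately have "R o\<^sub>L R = D" by (simp add: LIMSEQ_const_iff)
  then show ?thesis using R by blast
qed

text \<open>The congruence by the inverse of the square root \<open>R\<close> of
  \<open>\<psi> id_blinfun\<close> makes the map unital; \<open>R\<close> is put back in front of
  the resulting operator.\<close>

lemma (in cone_automorphism) representation: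
  "\<exists>T. semilinear T \<and> invertible_op T \<and> (\<forall>A\<in>positive_ops. \<psi> A = congr_op T A)"
proof -
  obtain R where R: "R \<in> positive_ops" "R o\<^sub>L R = \<psi> id_blinfun"
    using positive_sqrt[of "\<psi> id_blinfun"] by auto
  have iR: "invertible_op R"
    using invertible_op_factor[of R R] identity_image_invertible R(2) by simp
  have lR: "semilinear R" by (simp add: selfadj_complex_linear positive_selfadj R(1))
  have iS: "invertible_op (inverse_op R)" by (rule invertible_inverse_op[OF iR])
  have lS: "semilinear (inverse_op R)" by (rule semilinear_inverse[OF iR lR])
  define \<omega> where "\<omega> A = congr_op (inverse_op R) (\<psi> A)" for A
  have bij': "bij_betw (congr_op (inverse_op R)) positive_ops positive_ops"
    by (rule bij_betw_byWitness[where f' = "congr_op R"])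
      (auto simp: congr_op_inverse[OF iR lR] positive_congr_op lR lS)
  have "bij_betw \<omega> positive_ops positive_ops"
    using bij_betw_trans[OF bij bij'] by (simp add: \<omega>_def[abs_def] comp_def)
  moreover have "congr_op R id_blinfun = \<psi> id_blinfun"
    using R by (simp add: congr_op_def adjoint_selfadj[OF positive_selfadj])
  then have "\<omega> id_blinfun = id_blinfun"
    unfolding \<omega>_def using congr_op_inverse(2)[OF iR lR, of id_blinfun] by simp
  ultimately interpret unital_cone_automorphism \<omega>
    by unfold_locales (auto simp: \<omega>_def add congr_op_linear)
  obtain T where T: "semilinear T" "invertible_op T" "\<And>A. A \<in> positive_ops \<Longrightarrow> \<omega> A = congr_op T A"
    using representation by blast
  have "\<psi> A = congr_op (R o\<^sub>L T) A" if "A \<in> positive_ops" for A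
  proof -
    have "congr_op R (congr_op T A) = \<psi> A"
      using T(3)[OF that] congr_op_inverse(1)[OF iR lR] by (metis \<omega>_def)
    then show ?thesis by (simp add: congr_op_compose[OF lR T(1)])
  qed
  then show ?thesis
    using semilinear_compose[OF lR T(1)] invertible_op_compose[OF iR T(2)] by blast
qed

lemma positive_add_eq_0:
  assumes A: "A \<in> positive_ops" and B: "B \<in> positive_ops" and z: "A + B = 0"
  shows "A = 0"
proof (rule selfadj_eqI[OF positive_selfadj[OF A]])
  fix x
  have "qf A x + qf B x = 0" using arg_cong[OF z, of "\<lambda>F. qf F x"] by simp
  then show "qf A x = qf 0 x" using positive_qf[OF A, of x] positive_qf[OF B, of x] by simp
qed simp

theorem arithmetic_mean_preserver:
  fixes \<psi> :: "('a::complex_hilbert \<Rightarrow>\<^sub>L 'a) \<Rightarrow> ('a \<Rightarrow>\<^sub>L 'a)"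
  assumes bij: "bij_betw \<psi> positive_ops positive_ops"
    and mid: "\<And>A B. A \<in> positive_ops \<Longrightarrow> B \<in> positive_ops \<Longrightarrow>
      \<psi> ((1/2) *\<^sub>R (A + B)) = (1/2) *\<^sub>R (\<psi> A + \<psi> B)"
  shows "\<exists>T. semilinear T \<and> invertible_op T \<and> (\<forall>A\<in>positive_ops. \<psi> A = congr_op T A)"
proof -
  have pos: "\<psi> A \<in> positive_ops" if "A \<in> positive_ops" for A
    using bij that by (auto simp: bij_betw_def)
  obtain C where C: "C \<in> positive_ops" "\<psi> C = 0"
    using bij unfolding bij_betw_def by (metis imageE positive_intros(1))
  \<comment> \<open>The preimage \<open>C\<close> of 0 is the midpoint of 0 and its double, so
    \<open>\<psi> 0\<close> is one of two positive summands of 0.\<close>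
  have "(1/2) *\<^sub>R (0 + 2 *\<^sub>R C) = C" by simp
  then have "(1/2) *\<^sub>R (\<psi> 0 + \<psi> (2 *\<^sub>R C)) = 0" using mid[of 0 "2 *\<^sub>R C"] C by simp
  then have "\<psi> 0 + \<psi> (2 *\<^sub>R C) = 0" by simp
  then have zero: "\<psi> 0 = 0" by (rule positive_add_eq_0[rotated 2]) (use C pos in auto)
  have double: "\<psi> (2 *\<^sub>R A) = 2 *\<^sub>R \<psi> A" if "A \<in> positive_ops" for A
    using mid[of "2 *\<^sub>R A" 0] that zero by simp
  have "cone_automorphism \<psi>"
  proof
    fix A B :: "'a \<Rightarrow>\<^sub>L 'a" assume AB: "A \<in> positive_ops" "B \<in> positive_ops"
    have "(1/2) *\<^sub>R (2 *\<^sub>R A + 2 *\<^sub>R B) = A + B" by (simp add: scaleR_add_right)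
    then show "\<psi> (A + B) = \<psi> A + \<psi> B"
      using mid[of "2 *\<^sub>R A" "2 *\<^sub>R B"] AB by (simp add: double scaleR_add_right)
  qed (rule bij)
  then show ?thesis by (rule cone_automorphism.representation)
qed

section \<open>Bijections preserving the harmonic mean\<close>

text \<open>
  The largest \<open>s\<close> with \<open>s *\<^sub>R rank1 x \<sqsubseteq> A\<close> (for \<open>x \<noteq> 0\<close>), the strength of \<open>A\<close> along the ray of \<open>x\<close>
  in the sense of Busch and Gudder.
\<close>

definition strength :: "('a::complex_hilbert \<Rightarrow>\<^sub>L 'a) \<Rightarrow> 'a \<Rightarrow> real"
  where "strength A x = (INF v\<in>{v. cinner v x = 1}. qf A v)"

context
  fixes A :: "'a::complex_hilbert \<Rightarrow>\<^sub>L 'a"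
  assumes A: "A \<in> positive_ops"
begin

lemma bdd_below_strength: "bdd_below (qf A ` {v. cinner v x = 1})"
  using positive_qf[OF A] by (auto intro!: bdd_belowI[of _ 0])

text \<open>In order terms \<open>strength A x *\<^sub>R rank1 x \<sqsubseteq> A\<close>:
  homogeneity of the form reduces any \<open>v\<close> with \<open>cinner v x \<noteq> 0\<close> to
  a normalised one. \<open>strength_lower\<close> adds that no larger factor works.\<close>

lemma strength_le: "strength A x * (cmod (cinner v x))\<^sup>2 \<le> qf A v"
proof (cases "cinner v x = 0")
  case True
  then show ?thesis using positive_qf[OF A] by simp
next
  case False
  define c where "c = inverse (cinner v x)"
  have "cinner (c *\<^sub>C v) x = 1" using False by (simp add: c_def cinner_scaleC_left)
  then have "strength A x \<le> qf A (c *\<^sub>C v)"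
    unfolding strength_def using bdd_below_strength by (intro cINF_lower) auto
  also have "\<dots> = qf A v / (cmod (cinner v x))\<^sup>2"
    using qf_scaleC[OF selfadj_complex_linear[OF positive_selfadj[OF A]]]
    by (simp add: c_def norm_inverse divide_inverse power_inverse mult.commute)
  finally show ?thesis using False by (simp add: field_simps)
qed

lemma normalized_vector: "x \<noteq> 0 \<Longrightarrow> cinner ((1 / (norm x)\<^sup>2) *\<^sub>R x) x = 1"
  by (simp add: cinner_scaleR_left cinner_self)

lemma strength_lower:
  assumes x: "x \<noteq> 0" and c: "\<And>v. c * (cmod (cinner v x))\<^sup>2 \<le> qf A v"
  shows "c \<le> strength A x"
  unfolding strength_def
proof (rule cINF_greatest)
  show "{v. cinner v x = 1} \<noteq> {}" using normalized_vector[OF x] by blast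
  show "c \<le> qf A v" if "v \<in> {v. cinner v x = 1}" for v using c[of v] that by simp
qed

lemma strength_nonneg: "x \<noteq> 0 \<Longrightarrow> 0 \<le> strength A x"
  by (rule strength_lower) (simp_all add: positive_qf[OF A])

lemma strength_approx:
  assumes x: "x \<noteq> 0" and d: "0 < d"
  shows "\<exists>v. cinner v x = 1 \<and> qf A v < strength A x + d"
proof -
  have "qf A ` {v. cinner v x = 1} \<noteq> {}" using normalized_vector[OF x] by blast
  then show ?thesis
    using cInf_lessD[of "qf A ` {v. cinner v x = 1}" "strength A x + d"] d
    by (auto simp: strength_def)
qed

text \<open>The infimum over \<open>v\<close> is one over \<open>b = \<langle>v,x\<rangle>\<close>, and \<open>|a - b|\<^sup>2 + s |b|\<^sup>2\<close> is smallest at \<open>b = a / (1 + s)\<close>.\<close>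

lemma harmonic_mean_rank1:
  assumes x: "x \<noteq> 0"
  shows "harmonic_mean (rank1 x) A = (2 * strength A x / (1 + strength A x)) *\<^sub>R rank1 x"
proof (rule harmonic_mean_eqI[OF positive_rank1 A])
  define s where "s = strength A x"
  have s: "0 \<le> s" unfolding s_def by (rule strength_nonneg[OF x])
  let ?H = "(2 * s / (1 + s)) *\<^sub>R rank1 x"
  have qH: "qf ?H z = 2 * (s / (1 + s) * (cmod (cinner z x))\<^sup>2)" for z by (simp add: qf_rank1)
  show "is_harmonic_mean (rank1 x) A ((2 * strength A x / (1 + strength A x)) *\<^sub>R rank1 x)"
    unfolding s_def[symmetric] is_harmonic_mean_def
  proof (intro conjI allI impI)
    fix z v
    define p q where "p = cmod (cinner (z - v) x)" and "q = cmod (cinner v x)"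
    have "cmod (cinner z x) \<le> p + q"
      unfolding p_def q_def using norm_triangle_ineq[of "cinner (z - v) x" "cinner v x"]
      by (simp add: cinner_diff_left)
    then have "(cmod (cinner z x))\<^sup>2 \<le> (p + q)\<^sup>2" by (intro power_mono) auto
    then have "s / (1 + s) * (cmod (cinner z x))\<^sup>2 \<le> s / (1 + s) * (p + q)\<^sup>2"
      using s by (intro mult_left_mono) auto
    also have "\<dots> \<le> p\<^sup>2 + s * q\<^sup>2"
    proof -
      \<comment> \<open>The gap is the square of \<open>p - s * q\<close>, which vanishes at the
        optimal splitting.\<close>
      have "s * (p + q)\<^sup>2 + (p - s * q)\<^sup>2 = (1 + s) * (p\<^sup>2 + s * q\<^sup>2)"
        by (simp add: power2_eq_square algebra_simps)
      then have "s * (p + q)\<^sup>2 \<le> (1 + s) * (p\<^sup>2 + s * q\<^sup>2)"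
        using zero_le_power2[of "p - s * q"] by linarith
      then show ?thesis using s by (simp add: divide_le_eq mult.commute)
    qed
    also have "\<dots> \<le> p\<^sup>2 + qf A v"
      using strength_le[of x v] by (simp add: q_def s_def)
    finally show "qf ?H z \<le> 2 * (qf (rank1 x) (z - v) + qf A v)"
      unfolding qH by (simp add: qf_rank1 p_def)
  next
    fix z and e :: real assume e: "0 < e"
    define a where "a = cinner z x"
    \<comment> \<open>The excess of \<open>v0\<close> enters the mean with a factor of at most
      \<open>2 * (cmod a)\<^sup>2\<close>, so this \<open>d\<close> keeps it below \<open>e\<close>;
      the summand 1 covers \<open>a = 0\<close>.\<close>
    define d where "d = e / (2 * (cmod a)\<^sup>2 + 1)"
    have nn: "0 < 2 * (cmod a)\<^sup>2 + 1" by (simp add: add_nonneg_pos)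
    have d: "0 < d" using e nn by (simp add: d_def)
    obtain v0 where v0: "cinner v0 x = 1" "qf A v0 < s + d"
      using strength_approx[OF x d] by (auto simp: s_def)
    define v where "v = (a / of_real (1 + s)) *\<^sub>C v0"
    have vx: "cinner v x = a / of_real (1 + s)" by (simp add: v_def cinner_scaleC_left v0)
    have "cinner (z - v) x = a * of_real (s / (1 + s))"
    proof -
      have "complex_of_real (1 + s) \<noteq> 0" using s by (simp only: of_real_eq_0_iff)
      moreover have "cinner (z - v) x = a - a / of_real (1 + s)" by (simp add: cinner_diff_left vx a_def)
      ultimately show ?thesis by (simp add: field_simps)
    qed
    then have q1: "qf (rank1 x) (z - v) = (cmod a)\<^sup>2 * (s / (1 + s))\<^sup>2"
      by (simp only: qf_rank1 norm_mult norm_of_real power_mult_distrib power2_abs)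
    have "qf A v = (cmod a)\<^sup>2 / (1 + s)\<^sup>2 * qf A v0"
      unfolding v_def qf_scaleC[OF selfadj_complex_linear[OF positive_selfadj[OF A]]] norm_divide norm_of_real
      by (simp add: power_divide)
    also have "\<dots> \<le> (cmod a)\<^sup>2 / (1 + s)\<^sup>2 * (s + d)"
      using v0(2) by (intro mult_left_mono) auto
    finally have q2: "qf A v \<le> (cmod a)\<^sup>2 / (1 + s)\<^sup>2 * (s + d)" .
    have "2 * (qf (rank1 x) (z - v) + qf A v) \<le>
        2 * ((cmod a)\<^sup>2 * (s / (1 + s))\<^sup>2 + (cmod a)\<^sup>2 / (1 + s)\<^sup>2 * (s + d))"
      using q1 q2 by simp
    also have "\<dots> = 2 * (s / (1 + s) * (cmod a)\<^sup>2) + 2 * (cmod a)\<^sup>2 * d / (1 + s)\<^sup>2"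
    proof -
      have "(1 + s) \<noteq> 0" using s by simp
      then show ?thesis by (simp add: power_divide divide_simps) (simp add: power2_eq_square algebra_simps)
    qed
    also have "\<dots> \<le> 2 * (s / (1 + s) * (cmod a)\<^sup>2) + e"
    proof -
      have "2 * (cmod a)\<^sup>2 * d \<le> e" using e nn by (simp add: d_def field_simps)
      moreover have "2 * (cmod a)\<^sup>2 * d / (1 + s)\<^sup>2 \<le> 2 * (cmod a)\<^sup>2 * d"
        using divide_left_mono[of 1 "(1 + s)\<^sup>2" "2 * (cmod a)\<^sup>2 * d"] one_le_power[of "1 + s" 2] s d by simp
      ultimately show ?thesis by linarith
    qed
    finally show "\<exists>v. 2 * (qf (rank1 x) (z - v) + qf A v) \<le> qf ?H z + e"
      unfolding qH a_def[symmetric] by blast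
  qed (use s in simp)
qed

end

section \<open>Strength, order and inversion\<close>

lemma strength_mono:
  assumes A: "A \<in> positive_ops" and B: "B \<in> positive_ops" and le: "A \<sqsubseteq> B" and x: "x \<noteq> 0"
  shows "strength A x \<le> strength B x"
  by (rule strength_lower[OF B x]) (use strength_le[OF A] le in \<open>auto simp: le_op_def intro: order_trans\<close>)

text \<open>A rank-one operator \<open>rank1 y\<close> lies below \<open>A\<close> exactly when the
  strength of \<open>A\<close> along \<open>y\<close> is at least 1, and the rank-one operators
  below determine the order.\<close>

lemma le_op_iff_strength:
  assumes A: "A \<in> positive_ops" and B: "B \<in> positive_ops"
  shows "A \<sqsubseteq> B \<longleftrightarrow> (\<forall>x. x \<noteq> 0 \<longrightarrow> strength A x \<le> strength B x)"
proof
  assume le: "\<forall>x. x \<noteq> 0 \<longrightarrow> strength A x \<le> strength B x"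
  show "A \<sqsubseteq> B"
  proof (rule le_op_rank1_determined[OF A B])
    fix y assume y: "rank1 y \<sqsubseteq> A"
    show "rank1 y \<sqsubseteq> B"
    proof (cases "y = 0")
      case True
      then show ?thesis using positive_qf[OF B] by (simp add: le_op_def)
    next
      case False
      have "1 \<le> strength A y"
        by (rule strength_lower[OF A False]) (use y in \<open>simp add: le_op_def qf_rank1\<close>)
      then have "1 \<le> strength B y" using le False order_trans by blast
      then have "1 * (cmod (cinner v y))\<^sup>2 \<le> strength B y * (cmod (cinner v y))\<^sup>2" for v
        by (intro mult_right_mono) auto
      then show ?thesis using strength_le[OF B, of y] by (auto simp: le_op_def qf_rank1 intro: order_trans)
    qed
  qed
qed (use strength_mono[OF A B] in blast)

lemma strength_scale:
  assumes A: "A \<in> positive_ops" and r: "0 < r" and x: "x \<noteq> 0"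
  shows "strength (r *\<^sub>R A) x = r * strength A x"
proof (rule order_antisym)
  have rA: "r *\<^sub>R A \<in> positive_ops" using A r by simp
  have "strength (r *\<^sub>R A) x / r \<le> strength A x"
    using strength_le[OF rA, of x] r by (intro strength_lower[OF A x]) (simp add: field_simps)
  then show "strength (r *\<^sub>R A) x \<le> r * strength A x" using r by (simp add: field_simps)
  show "r * strength A x \<le> strength (r *\<^sub>R A) x"
    using strength_le[OF A, of x] r by (intro strength_lower[OF rA x]) (simp add: mult.assoc)
qed

lemma strength_rank1_self:
  assumes x: "x \<noteq> 0" shows "strength (rank1 x) x = 1"
proof (rule order_antisym)
  show "strength (rank1 x) x \<le> 1"
    using strength_le[OF positive_rank1, of x x "(1 / (norm x)\<^sup>2) *\<^sub>R x"] normalized_vector[OF positive_rank1 x]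
    by (simp only: qf_rank1) simp
  show "1 \<le> strength (rank1 x) x" by (rule strength_lower[OF positive_rank1 x]) (simp add: qf_rank1)
qed

text \<open>The component \<open>v\<close> of \<open>x\<close> orthogonal to \<open>y\<close> is a
  test vector: \<open>rank1 y\<close> vanishes on it, while its inner product with \<open>x\<close>
  is not zero.\<close>

lemma strength_rank1_independent:
  assumes x: "\<And>c. x \<noteq> c *\<^sub>C y"
  shows "strength (rank1 y) x = 0"
proof -
  have x0: "x \<noteq> 0" using x[of 0] by simp
  define a where "a = cinner x y / (norm y)\<^sup>2"
  define v where "v = x - a *\<^sub>C y"
  have v0: "v \<noteq> 0" using x[of a] by (simp add: v_def)
  have vy: "cinner v y = 0"
    by (cases "y = 0") (simp_all add: v_def cinner_diff_left cinner_scaleC_left a_def cinner_self)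
  have xv: "v + a *\<^sub>C y = x" by (simp add: v_def)
  have "cinner v (v + a *\<^sub>C y) = cinner v v" by (simp add: cinner_add_right cinner_scaleC_right vy)
  then have "cinner v x = cinner v v" unfolding xv .
  then have "(cmod (cinner v x))\<^sup>2 > 0" using v0 by (simp add: cinner_self)
  moreover have "strength (rank1 y) x * (cmod (cinner v x))\<^sup>2 \<le> 0"
    using strength_le[OF positive_rank1, of y x v] by (simp add: qf_rank1 vy)
  ultimately have "strength (rank1 y) x \<le> 0" by (simp add: mult_le_0_iff not_less)
  then show ?thesis using strength_nonneg[OF positive_rank1 x0, of y] by simp
qed

text \<open>The bound from above is the test vector \<open>inverse_op A x\<close>; the bound from
  below is Cauchy-Schwarz for the form of \<open>A\<close>.\<close>

lemma strength_invertible: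
  assumes A: "A \<in> positive_ops" "invertible_op A" and x: "x \<noteq> 0"
  shows "strength A x = 1 / qf (inverse_op A) x" "0 < qf (inverse_op A) x"
proof -
  let ?B = "inverse_op A"
  have B: "?B \<in> positive_ops" by (rule positive_inverse[OF A(2,1)])
  have "?B x \<noteq> 0" using x inverse_op_apply(2)[OF A(2), of x] by auto
  then show pos: "0 < qf ?B x"
    using positive_qf[OF B, of x] positive_qf_eq_0[OF B, of x] by (auto simp: order_less_le)
  have qB: "qf A (?B x) = qf ?B x" using A(2) by (simp add: qf_def inner_commute)
  show "strength A x = 1 / qf ?B x"
  proof (rule order_antisym)
    have "qf ?B x \<le> cmod (cinner (?B x) x)"
      unfolding qf_def Re_cinner[symmetric] by (rule complex_Re_le_cmod)
    then have "(qf ?B x)\<^sup>2 \<le> (cmod (cinner (?B x) x))\<^sup>2" using pos by (intro power_mono) auto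
    then have "strength A x * (qf ?B x)\<^sup>2 \<le> strength A x * (cmod (cinner (?B x) x))\<^sup>2"
      using strength_nonneg[OF A(1) x] by (intro mult_left_mono)
    also have "\<dots> \<le> qf ?B x" using strength_le[OF A(1), of x "?B x"] by (simp add: qB)
    finally show "strength A x \<le> 1 / qf ?B x" using pos by (simp add: power2_eq_square field_simps)
    have "(cmod (cinner v x))\<^sup>2 \<le> qf ?B x * qf A v" for v
      using positive_cinner_Cauchy_Schwarz[OF A(1), of "?B x" v] A(2)
      by (simp add: qB cmod_cinner_commute[of v])
    then show "1 / qf ?B x \<le> strength A x"
      using pos by (intro strength_lower[OF A(1) x]) (simp add: field_simps)
  qed
qed

section \<open>Harmonic means and rank one\<close>

lemma harmonic_mean_scaled_rank1:
  assumes x: "x \<noteq> 0" and t: "0 < t" and s: "0 < s"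
  shows "harmonic_mean (t *\<^sub>R rank1 x) (s *\<^sub>R rank1 x) = (2 * t * s / (t + s)) *\<^sub>R rank1 x"
proof -
  define x' where "x' = sqrt t *\<^sub>R x"
  have x': "x' \<noteq> 0" "rank1 x' = t *\<^sub>R rank1 x" using x t by (simp_all add: x'_def rank1_scaleR)
  have eq: "s *\<^sub>R rank1 x = (s / t) *\<^sub>R rank1 x'" using t by (simp add: x'(2))
  have str: "strength (s *\<^sub>R rank1 x) x' = s / t"
    unfolding eq using t s x'(1) by (simp add: strength_scale strength_rank1_self)
  have "harmonic_mean (rank1 x') (s *\<^sub>R rank1 x) = (2 * (s / t) / (1 + s / t)) *\<^sub>R rank1 x'"
    using harmonic_mean_rank1[of "s *\<^sub>R rank1 x" x'] s x'(1) unfolding str by simp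
  also have "\<dots> = (2 * (s / t) / (1 + s / t) * t) *\<^sub>R rank1 x" by (simp add: x'(2))
  also have "2 * (s / t) / (1 + s / t) * t = 2 * t * s / (t + s)"
    using t s by (simp add: field_simps)
  finally show ?thesis by (simp add: x'(2))
qed

lemma harmonic_mean_rank1_independent:
  assumes ind: "\<And>c. x \<noteq> c *\<^sub>C y" and t: "0 < t" and s: "0 < s"
  shows "harmonic_mean (t *\<^sub>R rank1 x) (s *\<^sub>R rank1 y) = 0"
proof -
  have eq: "t *\<^sub>R rank1 x = rank1 (sqrt t *\<^sub>R x)" "s *\<^sub>R rank1 y = rank1 (sqrt s *\<^sub>R y)"
    using t s by (simp_all add: rank1_scaleR)
  have i: "sqrt t *\<^sub>R x \<noteq> c *\<^sub>C sqrt s *\<^sub>R y" for c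
  proof
    assume "sqrt t *\<^sub>R x = c *\<^sub>C sqrt s *\<^sub>R y"
    then have "(1 / sqrt t) *\<^sub>R (sqrt t *\<^sub>R x) = (1 / sqrt t) *\<^sub>R (c *\<^sub>C sqrt s *\<^sub>R y)" by simp
    then have "x = (of_real (1 / sqrt t) * c * of_real (sqrt s)) *\<^sub>C y"
      using t by (simp only: scaleC_of_real[symmetric] scaleC_scaleC mult.assoc)
        (simp add: scaleC_scaleC)
    then show False using ind by blast
  qed
  then have "sqrt t *\<^sub>R x \<noteq> 0" using i[of 0] by simp
  then show ?thesis
    unfolding eq using harmonic_mean_rank1[OF positive_rank1, of "sqrt t *\<^sub>R x"] strength_rank1_independent[OF i]
    by simp
qed

text \<open>By Cauchy-Schwarz, \<open>A\<close> has strength at least \<open>1 / qf A x\<close>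
  along the range vector \<open>A x\<close>.\<close>

lemma harmonic_mean_range_nonzero:
  assumes A: "A \<in> positive_ops" and y: "y = A x" "y \<noteq> 0"
  shows "\<exists>t>0. harmonic_mean A (rank1 y) = t *\<^sub>R rank1 y"
proof -
  have q: "0 < qf A x"
    using y positive_qf[OF A, of x] positive_qf_eq_0[OF A, of x] by (auto simp: order_less_le)
  have "1 / qf A x \<le> strength A y"
    using positive_cinner_Cauchy_Schwarz[OF A, of x] q
    by (intro strength_lower[OF A y(2)]) (simp add: y(1) cmod_cinner_commute[of _ "A x"] field_simps)
  then have "0 < strength A y" using q by (meson divide_pos_pos less_le_trans zero_less_one)
  then show ?thesis
    using harmonic_mean_rank1[OF A y(2)] harmonic_mean_commute[OF A positive_rank1, of y]
    by (intro exI[of _ "2 * strength A y / (1 + strength A y)"]) simp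
qed

lemma rank1_of_range:
  assumes A: "A \<in> positive_ops" and y: "y \<noteq> 0" and range: "\<And>x. \<exists>c. A x = c *\<^sub>C y"
  shows "\<exists>x. A = rank1 x"
proof -
  have sA: "selfadj A" by (rule positive_selfadj[OF A])
  have A0: "A w = 0" if "cinner w y = 0" for w
  proof (rule positive_qf_eq_0[OF A])
    obtain c where "A w = c *\<^sub>C y" using range by blast
    then show "qf A w = 0"
      using that cinner_commute[of y w] by (simp add: qf_def inner_eq_Re_cinner cinner_scaleC_left)
  qed
  define k where "k = qf A y / ((norm y)\<^sup>2)\<^sup>2"
  have k: "0 \<le> k" using positive_qf[OF A] by (simp add: k_def)
  have "A = k *\<^sub>R rank1 y"
  proof (rule selfadj_eqI[OF sA])
    fix z
    define a where "a = cinner z y / (norm y)\<^sup>2"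
    define w where "w = z - a *\<^sub>C y"
    have "cinner w y = 0"
      using y by (simp add: w_def cinner_diff_left cinner_scaleC_left a_def cinner_self)
    then have w: "A w = 0" by (rule A0)
    have "qf A z = qf A (w + a *\<^sub>C y)" by (simp add: w_def)
    also have "\<dots> = qf A (a *\<^sub>C y)" unfolding qf_add[OF sA] by (simp add: w qf_def[of A w])
    also have "\<dots> = (cmod a)\<^sup>2 * qf A y" by (rule qf_scaleC[OF selfadj_complex_linear[OF sA]])
    also have "(cmod a)\<^sup>2 = (cmod (cinner z y))\<^sup>2 / ((norm y)\<^sup>2)\<^sup>2"
      unfolding a_def norm_divide norm_of_real by (simp add: power_divide)
    finally show "qf A z = qf (k *\<^sub>R rank1 y) z" by (simp add: k_def qf_rank1)
  qed (simp add: positive_selfadj)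
  also have "\<dots> = rank1 (sqrt k *\<^sub>R y)" using k by (simp add: rank1_scaleR)
  finally show ?thesis by blast
qed

text \<open>For \<open>A\<close> of rank one all nonzero means with \<open>A\<close> are positive
  multiples of \<open>A\<close>, so their means stay nonzero. Otherwise two independent range
  vectors give means on different rays, and these have mean 0. The criterion mentions only the mean
  and 0, so it is preserved.\<close>

lemma rank1_iff_harmonic_mean:
  assumes A: "A \<in> positive_ops"
  shows "(\<exists>x. A = rank1 x) \<longleftrightarrow>
    \<not> (\<exists>B\<in>positive_ops. \<exists>C\<in>positive_ops. harmonic_mean A B \<noteq> 0 \<and> harmonic_mean A C \<noteq> 0 \<and>
      harmonic_mean (harmonic_mean A B) (harmonic_mean A C) = 0)"
proof
  assume "\<exists>x. A = rank1 x"
  then obtain x where x: "A = rank1 x" by blast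
  have multiple: "\<exists>t>0. harmonic_mean A B = t *\<^sub>R rank1 x \<and> x \<noteq> 0"
    if B: "B \<in> positive_ops" and n: "harmonic_mean A B \<noteq> 0" for B
  proof -
    have x0: "x \<noteq> 0" using n harmonic_mean_zero[OF B] x by auto
    have h: "harmonic_mean A B = (2 * strength B x / (1 + strength B x)) *\<^sub>R rank1 x"
      unfolding x by (rule harmonic_mean_rank1[OF B x0])
    have "strength B x \<noteq> 0" using n h by auto
    then have "0 < strength B x" using strength_nonneg[OF B x0] by simp
    then show ?thesis using h x0 by (intro exI[of _ "2 * strength B x / (1 + strength B x)"]) simp
  qed
  have "harmonic_mean (harmonic_mean A B) (harmonic_mean A C) \<noteq> 0"
    if BC: "B \<in> positive_ops" "C \<in> positive_ops" "harmonic_mean A B \<noteq> 0" "harmonic_mean A C \<noteq> 0" for B C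
  proof -
    obtain t s where ts: "0 < t" "harmonic_mean A B = t *\<^sub>R rank1 x" "0 < s"
        "harmonic_mean A C = s *\<^sub>R rank1 x" "x \<noteq> 0"
      using multiple[OF BC(1,3)] multiple[OF BC(2,4)] by blast
    have "0 < 2 * t * s / (t + s)" using ts by simp
    then show ?thesis unfolding ts(2,4) harmonic_mean_scaled_rank1[OF ts(5,1,3)] using ts(5)
      by (metis rank1_eq_0 scaleR_eq_0_iff less_irrefl)
  qed
  then show "\<not> (\<exists>B\<in>positive_ops. \<exists>C\<in>positive_ops. harmonic_mean A B \<noteq> 0 \<and> harmonic_mean A C \<noteq> 0 \<and>
      harmonic_mean (harmonic_mean A B) (harmonic_mean A C) = 0)" by blast
next
  assume no: "\<not> (\<exists>B\<in>positive_ops. \<exists>C\<in>positive_ops. harmonic_mean A B \<noteq> 0 \<and> harmonic_mean A C \<noteq> 0 \<and>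
      harmonic_mean (harmonic_mean A B) (harmonic_mean A C) = 0)"
  show "\<exists>x. A = rank1 x"
  proof (rule ccontr)
    assume nr: "\<nexists>x. A = rank1 x"
    then have "A \<noteq> 0" by (metis rank1_zero)
    then obtain x1 where x1: "A x1 \<noteq> 0" by (metis blinfun_eqI zero_blinfun.rep_eq)
    define y where "y = A x1"
    have y0: "y \<noteq> 0" using x1 by (simp add: y_def)
    obtain x2 where x2: "\<And>c. A x2 \<noteq> c *\<^sub>C y" using rank1_of_range[OF A y0] nr by blast
    define z where "z = A x2"
    have z0: "z \<noteq> 0" using x2[of 0] by (simp add: z_def)
    obtain t where t: "0 < t" "harmonic_mean A (rank1 y) = t *\<^sub>R rank1 y"
      using harmonic_mean_range_nonzero[OF A y_def y0] by blast
    obtain s where s: "0 < s" "harmonic_mean A (rank1 z) = s *\<^sub>R rank1 z"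
      using harmonic_mean_range_nonzero[OF A z_def z0] by blast
    have "harmonic_mean (s *\<^sub>R rank1 z) (t *\<^sub>R rank1 y) = 0"
      by (rule harmonic_mean_rank1_independent) (use x2 s t in \<open>auto simp: z_def\<close>)
    moreover have "t *\<^sub>R rank1 y \<noteq> 0" "s *\<^sub>R rank1 z \<noteq> 0" using y0 z0 s t by auto
    ultimately show False using no s t positive_rank1 by metis
  qed
qed

text \<open>The sum \<open>g u + g v\<close> depends on \<open>u + v\<close> only.\<close>

lemma midpoint_affine_linear:
  fixes g :: "real \<Rightarrow> real"
  assumes mid: "\<And>a b. 0 < a \<Longrightarrow> 0 < b \<Longrightarrow> g ((a + b) / 2) = (g a + g b) / 2"
    and pos: "\<And>a. 0 < a \<Longrightarrow> 0 < g a"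
    and surj: "\<And>b. 0 < b \<Longrightarrow> \<exists>a>0. g a = b"
    and r: "0 < r"
  shows "g r = r * g 1"
proof -
  have sum: "g a + g b = g c + g d" if "0 < a" "0 < b" "0 < c" "0 < d" "a + b = c + d" for a b c d
    using mid[of a b] mid[of c d] that by simp
  have prog: "g (a + real n * d) = g a + real n * (g (a + d) - g a)" if "0 < a" "0 < d" for a d n
  proof (induction n)
    case (Suc n)
    have "0 < a + real n * d" using that by (simp add: add_pos_nonneg)
    then have "g (a + real (Suc n) * d) + g a = g (a + real n * d) + g (a + d)"
      using that by (intro sum) (auto simp: algebra_simps add_pos_nonneg)
    then show ?case using Suc by (simp add: algebra_simps)
  qed simp
  \<comment> \<open>A decrease over one step would repeat along the arithmetic progression and make
    \<open>g\<close> negative.\<close>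
  have mono: "g a \<le> g b" if ab: "0 < a" "a \<le> b" for a b
  proof (rule ccontr)
    assume n: "\<not> g a \<le> g b"
    then have d: "0 < b - a" using ab by (cases "a = b") auto
    have gd: "0 < g a - g b" using n by simp
    obtain k where "g a < real k * (g a - g b)" using ex_less_of_nat_mult[OF gd] by blast
    moreover have "g (a + real k * (b - a)) = g a - real k * (g a - g b)"
      using prog[OF ab(1) d, of k] by (simp add: algebra_simps)
    moreover have "0 < g (a + real k * (b - a))" using ab d by (intro pos) (simp add: add_pos_nonneg)
    ultimately show False by linarith
  qed
  have add: "g (a + b) = g a + g b" if ab: "0 < a" "0 < b" for a b
  proof -
    have "\<bar>g (a + b) - (g a + g b)\<bar> \<le> \<epsilon>" if e: "0 < \<epsilon>" for \<epsilon>
    proof -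
      \<comment> \<open>Surjectivity provides arguments with small values. The two sum identities
        below leave the defect \<open>g t - 2 * g h\<close>, of modulus at most
        \<open>g t\<close>.\<close>
      obtain t where t: "0 < t" "g t = \<epsilon> / 2" using surj[of "\<epsilon> / 2"] e by auto
      define h where "h = t / 2"
      have h: "0 < h" "2 * h = t" using t by (simp_all add: h_def)
      have "g (a + b) + g h = g (a + h) + g b" using ab h by (intro sum) auto
      moreover have "g (a + h) + g h = g a + g t" using ab h by (intro sum) auto
      moreover have "0 < g h" "g h \<le> g t" using h mono[of h t] pos by auto
      ultimately show ?thesis using t(2) by (simp add: abs_le_iff)
    qed
    then have "\<bar>g (a + b) - (g a + g b)\<bar> \<le> 0" by (rule field_le_epsilon) simp
    then show ?thesis by simp
  qed
  define h where "h a = (if a = 0 then 0 else g a)" for a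
  have "h r = r * h 1"
  proof (rule nonneg_additive_linear)
    show "h (a + b) = h a + h b" if "0 \<le> a" "0 \<le> b" for a b
      using that add[of a b] by (auto simp: h_def add_nonneg_eq_0_iff)
    show "0 \<le> h a" if "0 \<le> a" for a using that pos[of a] by (auto simp: h_def)
  qed (use r in simp)
  then show ?thesis using r by (simp add: h_def)
qed

section \<open>Harmonic automorphisms\<close>

locale harmonic_automorphism = positive_bijection +
  assumes hm: "A \<in> positive_ops \<Longrightarrow> B \<in> positive_ops \<Longrightarrow>
      \<psi> (harmonic_mean A B) = harmonic_mean (\<psi> A) (\<psi> B)"
begin

text \<open>0 is the absorbing element of the harmonic mean.\<close>

lemma zero: "\<psi> 0 = 0"
proof -
  obtain C where C: "C \<in> positive_ops" "\<psi> C = 0" using surjective[of 0] by auto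
  have "\<psi> 0 = harmonic_mean (\<psi> C) (\<psi> 0)"
    using hm[of C 0] C harmonic_mean_zero[of C] harmonic_mean_commute[of C 0] by simp
  then show ?thesis by (simp add: C(2) harmonic_mean_zero)
qed

lemma eq_0_iff: "A \<in> positive_ops \<Longrightarrow> \<psi> A = 0 \<longleftrightarrow> A = 0"
  using injective[of A 0] zero by auto

lemma rank1_iff:
  assumes A: "A \<in> positive_ops"
  shows "(\<exists>y. \<psi> A = rank1 y) \<longleftrightarrow> (\<exists>x. A = rank1 x)"
proof -
  have eq: "harmonic_mean (\<psi> A) (\<psi> B) = 0 \<longleftrightarrow> harmonic_mean A B = 0"
    "harmonic_mean (harmonic_mean (\<psi> A) (\<psi> B)) (harmonic_mean (\<psi> A) (\<psi> C)) = 0 \<longleftrightarrow>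
      harmonic_mean (harmonic_mean A B) (harmonic_mean A C) = 0"
    if "B \<in> positive_ops" "C \<in> positive_ops" for B C
    using that A by (simp_all add: hm[symmetric] eq_0_iff)
  have image: "positive_ops = \<psi> ` positive_ops" using bij by (simp add: bij_betw_def)
  show ?thesis
    unfolding rank1_iff_harmonic_mean[OF A] rank1_iff_harmonic_mean[OF positive[OF A]]
    by (subst (1 2) image) (auto simp: eq)
qed

lemma rank1_image: "\<exists>y. \<psi> (rank1 x) = rank1 y"
  using rank1_iff[of "rank1 x"] by auto

lemma rank1_preimage: "\<exists>x. \<psi> (rank1 x) = rank1 y"
proof -
  obtain A where A: "A \<in> positive_ops" "\<psi> A = rank1 y" using surjective[OF positive_rank1] by blast
  then show ?thesis using rank1_iff[OF A(1)] by auto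
qed

lemma rank1_zero_iff: "\<psi> (rank1 x) = rank1 y \<Longrightarrow> x = 0 \<longleftrightarrow> y = 0"
  by (metis eq_0_iff positive_rank1 rank1_eq_0)

text \<open>Two nonzero vectors span the same ray exactly when the mean of their rank-one operators
  is nonzero.\<close>

lemma rank1_dependent:
  assumes x: "\<psi> (rank1 x) = rank1 y" "x \<noteq> 0" and u: "\<psi> (rank1 u) = rank1 w" "u \<noteq> 0"
  shows "(\<exists>c. u = c *\<^sub>C x) \<longleftrightarrow> (\<exists>c. w = c *\<^sub>C y)"
proof -
  have dep: "(\<exists>c. b = c *\<^sub>C a) \<longleftrightarrow> harmonic_mean (rank1 b) (rank1 a) \<noteq> 0"
    if ab: "a \<noteq> 0" "b \<noteq> 0" for a b :: 'a
  proof
    assume "\<exists>c. b = c *\<^sub>C a"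
    then obtain c where c: "b = c *\<^sub>C a" by blast
    then have c0: "c \<noteq> 0" using ab by auto
    have "harmonic_mean (rank1 b) (rank1 a) = (2 * (cmod c)\<^sup>2 * 1 / ((cmod c)\<^sup>2 + 1)) *\<^sub>R rank1 a"
      using harmonic_mean_scaled_rank1[OF ab(1), of "(cmod c)\<^sup>2" 1] c0 by (simp add: c rank1_scaleC)
    moreover have "2 * (cmod c)\<^sup>2 * 1 / ((cmod c)\<^sup>2 + 1) \<noteq> 0"
      using c0 by (simp add: add_nonneg_eq_0_iff)
    ultimately show "harmonic_mean (rank1 b) (rank1 a) \<noteq> 0" using ab(1) by simp
  next
    assume "harmonic_mean (rank1 b) (rank1 a) \<noteq> 0"
    then show "\<exists>c. b = c *\<^sub>C a" using harmonic_mean_rank1_independent[of b a 1 1] by auto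
  qed
  have "y \<noteq> 0" "w \<noteq> 0" using rank1_zero_iff x u by auto
  then have "(\<exists>c. w = c *\<^sub>C y) \<longleftrightarrow> \<psi> (harmonic_mean (rank1 u) (rank1 x)) \<noteq> 0"
    by (simp add: dep hm x(1) u(1))
  also have "\<dots> \<longleftrightarrow> (\<exists>c. u = c *\<^sub>C x)" using dep[OF x(2) u(2)] by (simp add: eq_0_iff)
  finally show ?thesis by simp
qed

text \<open>By \<open>rank1_dependent\<close> the ray of \<open>x\<close> is mapped onto that of
  \<open>y\<close>, which gives a function \<open>f\<close> of the scale. It is surjective and
  preserves the harmonic mean of positive numbers.\<close>

lemma scale_rank1:
  assumes x: "\<psi> (rank1 x) = rank1 y" "x \<noteq> 0" and t: "0 < t"
  shows "\<psi> (t *\<^sub>R rank1 x) = t *\<^sub>R rank1 y"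
proof -
  have y0: "y \<noteq> 0" using rank1_zero_iff[OF x(1)] x(2) by simp
  have "\<exists>s>0. \<psi> (t *\<^sub>R rank1 x) = s *\<^sub>R rank1 y" if t: "0 < t" for t
  proof -
    define u where "u = sqrt t *\<^sub>R x"
    have ru: "rank1 u = t *\<^sub>R rank1 x" "u \<noteq> 0" using t x(2) by (simp_all add: u_def rank1_scaleR)
    obtain w where w: "\<psi> (rank1 u) = rank1 w" using rank1_image by blast
    have "u = of_real (sqrt t) *\<^sub>C x" by (simp add: u_def scaleC_of_real)
    then obtain c where c: "w = c *\<^sub>C y" using rank1_dependent[OF x w ru(2)] by blast
    have "w \<noteq> 0" using rank1_zero_iff[OF w] ru(2) by simp
    then have "c \<noteq> 0" using c by auto
    then show ?thesis using w c ru(1) by (intro exI[of _ "(cmod c)\<^sup>2"]) (simp add: rank1_scaleC)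
  qed
  then obtain f where f: "\<And>t. 0 < t \<Longrightarrow> 0 < f t" "\<And>t. 0 < t \<Longrightarrow> \<psi> (t *\<^sub>R rank1 x) = f t *\<^sub>R rank1 y"
    by metis
  have cancel: "a = b" if "a *\<^sub>R rank1 y = b *\<^sub>R rank1 y" for a b using that y0 by simp
  have f1: "f 1 = 1" using f(2)[of 1] x(1) cancel[of "f 1" 1] by simp
  have fsurj: "\<exists>t>0. f t = s" if s: "0 < s" for s
  proof -
    define w where "w = sqrt s *\<^sub>R y"
    have rw: "rank1 w = s *\<^sub>R rank1 y" "w \<noteq> 0" using s y0 by (simp_all add: w_def rank1_scaleR)
    obtain u where u: "\<psi> (rank1 u) = rank1 w" using rank1_preimage by blast
    have u0: "u \<noteq> 0" using rank1_zero_iff[OF u] rw(2) by simp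
    have "w = of_real (sqrt s) *\<^sub>C y" by (simp add: w_def scaleC_of_real)
    then obtain c where c: "u = c *\<^sub>C x" using rank1_dependent[OF x u u0] by blast
    have c0: "c \<noteq> 0" using c u0 by auto
    have "f ((cmod c)\<^sup>2) *\<^sub>R rank1 y = s *\<^sub>R rank1 y"
      using f(2)[of "(cmod c)\<^sup>2"] c0 u rw(1) by (simp add: c rank1_scaleC)
    then show ?thesis using cancel c0 by (intro exI[of _ "(cmod c)\<^sup>2"]) auto
  qed
  have fhm: "f (2 * t * s / (t + s)) = 2 * f t * f s / (f t + f s)" if ts: "0 < t" "0 < s" for t s
  proof (rule cancel)
    have "f (2 * t * s / (t + s)) *\<^sub>R rank1 y = \<psi> (harmonic_mean (t *\<^sub>R rank1 x) (s *\<^sub>R rank1 x))"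
      using ts by (simp add: harmonic_mean_scaled_rank1[OF x(2) ts] f(2))
    also have "\<dots> = harmonic_mean (f t *\<^sub>R rank1 y) (f s *\<^sub>R rank1 y)"
      using ts by (simp add: hm f(2))
    also have "\<dots> = (2 * f t * f s / (f t + f s)) *\<^sub>R rank1 y"
      by (rule harmonic_mean_scaled_rank1[OF y0 f(1)[OF ts(1)] f(1)[OF ts(2)]])
    finally show "f (2 * t * s / (t + s)) *\<^sub>R rank1 y = (2 * f t * f s / (f t + f s)) *\<^sub>R rank1 y" .
  qed
  \<comment> \<open>Reciprocals turn harmonic into arithmetic means, so that
    \<open>midpoint_affine_linear\<close> applies.\<close>
  define g where "g a = 1 / f (1 / a)" for a
  have "g r = r * g 1" if r: "0 < r" for r
  proof (rule midpoint_affine_linear[OF _ _ _ r])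
    fix a b :: real assume ab: "0 < a" "0 < b"
    have e: "2 * (1 / a) * (1 / b) / (1 / a + 1 / b) = 1 / ((a + b) / 2)"
      using ab by (simp add: field_simps)
    have fh: "f (1 / ((a + b) / 2)) = 2 * f (1 / a) * f (1 / b) / (f (1 / a) + f (1 / b))"
      using fhm[of "1 / a" "1 / b"] ab unfolding e by simp
    show "g ((a + b) / 2) = (g a + g b) / 2"
      unfolding g_def fh using f(1)[of "1 / a"] f(1)[of "1 / b"] ab by (simp add: field_simps)
  next
    show "0 < g a" if "0 < a" for a using f(1)[of "1 / a"] that by (simp add: g_def)
    show "\<exists>a>0. g a = b" if b: "0 < b" for b
    proof -
      obtain t where "0 < t" "f t = 1 / b" using fsurj[of "1 / b"] b by auto
      then show ?thesis by (intro exI[of _ "1 / t"]) (simp add: g_def)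
    qed
  qed
  from this[of "1 / t"] have "f t = t" using t f(1)[OF t] by (simp add: g_def f1 field_simps)
  then show ?thesis using f(2)[OF t] by simp
qed

text \<open>The scalar \<open>2 * s / (1 + s)\<close> in \<open>harmonic_mean_rank1\<close> is
  carried over by \<open>scale_rank1\<close>, and it determines the nonnegative
  \<open>s\<close>.\<close>

lemma strength_image:
  assumes A: "A \<in> positive_ops" and x: "\<psi> (rank1 x) = rank1 y" "x \<noteq> 0"
  shows "strength (\<psi> A) y = strength A x"
proof -
  have y0: "y \<noteq> 0" using rank1_zero_iff[OF x(1)] x(2) by simp
  define s s' where "s = strength A x" and "s' = strength (\<psi> A) y"
  have s: "0 \<le> s" "0 \<le> s'"
    unfolding s_def s'_def by (simp_all add: strength_nonneg A x(2) y0)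
  have "\<psi> ((2 * s / (1 + s)) *\<^sub>R rank1 x) = (2 * s / (1 + s)) *\<^sub>R rank1 y"
  proof (cases "s = 0")
    case False
    then show ?thesis using s by (intro scale_rank1 x) simp
  qed (simp add: zero)
  moreover have "\<psi> ((2 * s / (1 + s)) *\<^sub>R rank1 x) = (2 * s' / (1 + s')) *\<^sub>R rank1 y"
    unfolding s_def s'_def harmonic_mean_rank1[OF A x(2), symmetric]
      harmonic_mean_rank1[OF positive[OF A] y0, symmetric] by (simp add: hm A x(1))
  ultimately have "2 * s / (1 + s) = 2 * s' / (1 + s')" using y0 by simp
  then have "s = s'" using s by (simp add: field_simps)
  then show ?thesis by (simp add: s_def s'_def)
qed

lemma mono_iff:
  assumes A: "A \<in> positive_ops" and B: "B \<in> positive_ops"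
  shows "\<psi> A \<sqsubseteq> \<psi> B \<longleftrightarrow> A \<sqsubseteq> B"
proof -
  have "(\<forall>y. y \<noteq> 0 \<longrightarrow> strength (\<psi> A) y \<le> strength (\<psi> B) y) \<longleftrightarrow>
      (\<forall>x. x \<noteq> 0 \<longrightarrow> strength A x \<le> strength B x)"
    using strength_image[OF A] strength_image[OF B] rank1_image rank1_preimage rank1_zero_iff by metis
  then show ?thesis using A B by (simp add: le_op_iff_strength)
qed

lemma scale:
  assumes A: "A \<in> positive_ops" and r: "0 < r"
  shows "\<psi> (r *\<^sub>R A) = r *\<^sub>R \<psi> A"
proof -
  have rA: "r *\<^sub>R A \<in> positive_ops" "r *\<^sub>R \<psi> A \<in> positive_ops" using A r by simp_all
  have "strength (\<psi> (r *\<^sub>R A)) y = strength (r *\<^sub>R \<psi> A) y" if y: "y \<noteq> 0" for y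
  proof -
    obtain x where x: "\<psi> (rank1 x) = rank1 y" using rank1_preimage by blast
    then have "x \<noteq> 0" using rank1_zero_iff y by blast
    then show ?thesis
      using strength_image[OF rA(1) x] strength_image[OF A x] y A r by (simp add: strength_scale)
  qed
  then have "\<psi> (r *\<^sub>R A) \<sqsubseteq> r *\<^sub>R \<psi> A" "r *\<^sub>R \<psi> A \<sqsubseteq> \<psi> (r *\<^sub>R A)"
    using rA by (simp_all add: le_op_iff_strength)
  then show ?thesis by (rule le_op_antisym[rotated 2]) (use rA in \<open>simp_all add: positive_selfadj\<close>)
qed

text \<open>Multiples of an invertible positive operator dominate every operator, not just the
  identity. This form survives although \<open>\<psi>\<close> may move the identity, whose preimage
  is \<open>E\<close>.\<close>

lemma invertible_image_iff:
  assumes A: "A \<in> positive_ops"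
  shows "invertible_op (\<psi> A) \<longleftrightarrow> invertible_op A"
proof -
  have chain: "\<exists>m>0. B \<sqsubseteq> m *\<^sub>R C" if "0 < k" "id_blinfun \<sqsubseteq> k *\<^sub>R C" for k and B C :: "'a \<Rightarrow>\<^sub>L 'a"
  proof -
    obtain m where m: "0 < m" "B \<sqsubseteq> m *\<^sub>R id_blinfun" using le_op_scaled_id by blast
    have "m *\<^sub>R id_blinfun \<sqsubseteq> (m * k) *\<^sub>R C"
      using that m(1) by (simp add: le_op_def mult.assoc)
    then show ?thesis using m that(1) by (intro exI[of _ "m * k"]) (auto intro: le_op_trans)
  qed
  obtain E where E: "E \<in> positive_ops" "\<psi> E = id_blinfun" using surjective[of id_blinfun] by auto
  show ?thesis
    unfolding invertible_iff_dominates[OF A] invertible_iff_dominates[OF positive[OF A]]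
  proof
    assume "\<exists>k>0. id_blinfun \<sqsubseteq> k *\<^sub>R A"
    then obtain m where "0 < m" "E \<sqsubseteq> m *\<^sub>R A" using chain by blast
    then show "\<exists>k>0. id_blinfun \<sqsubseteq> k *\<^sub>R \<psi> A" using mono_iff[of E "m *\<^sub>R A"] E A by (auto simp: scale)
  next
    assume "\<exists>k>0. id_blinfun \<sqsubseteq> k *\<^sub>R \<psi> A"
    then obtain m where "0 < m" "\<psi> id_blinfun \<sqsubseteq> m *\<^sub>R \<psi> A" using chain by blast
    then show "\<exists>k>0. id_blinfun \<sqsubseteq> k *\<^sub>R A" using mono_iff[of id_blinfun "m *\<^sub>R A"] A by (auto simp: scale)
  qed
qed

text \<open>Conjugating \<open>\<psi>\<close> by inversion turns the harmonic mean into the arithmetic one.\<close>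

definition \<xi> :: "('a \<Rightarrow>\<^sub>L 'a) \<Rightarrow> ('a \<Rightarrow>\<^sub>L 'a)"
  where "\<xi> X = inverse_op (\<psi> (inverse_op X))"

lemma xi_positive:
  assumes X: "X \<in> positive_ops" "invertible_op X"
  shows "\<xi> X \<in> positive_ops" "invertible_op (\<xi> X)"
  unfolding \<xi>_def using X
  by (simp_all add: positive_inverse invertible_image_iff invertible_inverse_op)

text \<open>Strengths along a ray are reciprocals of forms of inverses, so invariance of strength
  becomes invariance of the form. Forms are additive in the operator, and this is the source of the
  additivity of \<open>\<eta>\<close>.\<close>

lemma qf_xi:
  assumes X: "X \<in> positive_ops" "invertible_op X" and x: "\<psi> (rank1 x) = rank1 y"
  shows "qf (\<xi> X) y = qf X x"
proof (cases "x = 0")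
  case True
  then show ?thesis using rank1_zero_iff[OF x] by simp
next
  case False
  then have y0: "y \<noteq> 0" using rank1_zero_iff[OF x] by simp
  have I: "inverse_op X \<in> positive_ops" "invertible_op (inverse_op X)"
    using X by (simp_all add: positive_inverse invertible_inverse_op)
  then have J: "\<psi> (inverse_op X) \<in> positive_ops" "invertible_op (\<psi> (inverse_op X))"
    by (simp_all add: invertible_image_iff)
  have "1 / qf (\<xi> X) y = 1 / qf X x"
    using strength_image[OF I(1) x False] strength_invertible(1)[OF J y0] strength_invertible(1)[OF I False]
    by (simp add: \<xi>_def inverse_inverse_op X)
  then show ?thesis by simp
qed

lemma xi_surjective:
  assumes Y: "Y \<in> positive_ops" "invertible_op Y"
  shows "\<exists>X\<in>positive_ops. invertible_op X \<and> \<xi> X = Y"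
proof -
  have I: "inverse_op Y \<in> positive_ops" "invertible_op (inverse_op Y)"
    using Y by (simp_all add: positive_inverse invertible_inverse_op)
  obtain A where A: "A \<in> positive_ops" "\<psi> A = inverse_op Y" using surjective I(1) by blast
  have iA: "invertible_op A" using invertible_image_iff[OF A(1)] A(2) I(2) by simp
  show ?thesis
    using A iA Y by (intro bexI[of _ "inverse_op A"] conjI)
      (simp_all add: \<xi>_def inverse_inverse_op invertible_inverse_op positive_inverse)
qed

text \<open>\<open>\<xi>\<close> is meaningful only on invertible operators, while the additive case
  needs the whole cone. The shift by the identity makes every argument invertible, and
  \<open>qf_eta\<close> shows that it cancels.\<close>

definition \<eta> :: "('a \<Rightarrow>\<^sub>L 'a) \<Rightarrow> ('a \<Rightarrow>\<^sub>L 'a)"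
  where "\<eta> A = \<xi> (A + id_blinfun) - \<xi> id_blinfun"

lemma id_invertible: "invertible_op id_blinfun"
  by (rule invertible_opI[where S = id_blinfun]) simp_all

lemma shift_invertible: "A \<in> positive_ops \<Longrightarrow> invertible_op (A + id_blinfun)"
  using invertible_add_positive[OF _ id_invertible, of A] by (simp add: add.commute)

lemma selfadj_eta: "A \<in> positive_ops \<Longrightarrow> selfadj (\<eta> A)"
  unfolding \<eta>_def by (intro selfadj_intros(4) positive_selfadj xi_positive)
    (simp_all add: shift_invertible id_invertible)

lemma qf_eta:
  assumes A: "A \<in> positive_ops" and x: "\<psi> (rank1 x) = rank1 y"
  shows "qf (\<eta> A) y = qf A x"
  using qf_xi[OF _ shift_invertible[OF A] x] qf_xi[OF _ id_invertible x] A by (simp add: \<eta>_def)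

lemma eta_positive:
  assumes A: "A \<in> positive_ops" shows "\<eta> A \<in> positive_ops"
  unfolding positive_iff
proof (intro conjI allI selfadj_eta[OF A])
  fix y
  obtain x where "\<psi> (rank1 x) = rank1 y" using rank1_preimage by blast
  then show "0 \<le> qf (\<eta> A) y" using qf_eta[OF A] positive_qf[OF A] by simp
qed

text \<open>Each vector on either side is matched with one on the other through its rank-one
  operator, so identities and positivity can be checked form by form. Surjectivity of
  \<open>\<eta>\<close> comes down to \<open>X\<close> dominating the identity.\<close>

lemma eta_cone_automorphism: "cone_automorphism \<eta>"
proof
  show "\<eta> (A + B) = \<eta> A + \<eta> B" if "A \<in> positive_ops" "B \<in> positive_ops" for A B
  proof (rule selfadj_eqI)
    fix y
    obtain x where x: "\<psi> (rank1 x) = rank1 y" using rank1_preimage by blast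
    show "qf (\<eta> (A + B)) y = qf (\<eta> A + \<eta> B) y" using that by (simp add: qf_eta[OF _ x])
  qed (use that in \<open>simp_all add: selfadj_eta\<close>)
  show "bij_betw \<eta> positive_ops positive_ops"
    unfolding bij_betw_def
  proof
    show "inj_on \<eta> positive_ops"
    proof (rule inj_onI)
      fix A B :: "'a \<Rightarrow>\<^sub>L 'a"
      assume AB: "A \<in> positive_ops" "B \<in> positive_ops" and eq: "\<eta> A = \<eta> B"
      show "A = B"
      proof (rule selfadj_eqI)
        fix x
        obtain y where y: "\<psi> (rank1 x) = rank1 y" using rank1_image by blast
        show "qf A x = qf B x" using AB eq by (simp add: qf_eta[OF _ y, symmetric])
      qed (use AB positive_selfadj in blast)+
    qed
    show "\<eta> ` positive_ops = positive_ops"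
    proof (intro equalityI subsetI)
      fix B :: "'a \<Rightarrow>\<^sub>L 'a" assume B: "B \<in> positive_ops"
      have xi1: "\<xi> id_blinfun \<in> positive_ops" "invertible_op (\<xi> id_blinfun)"
        by (simp_all add: xi_positive id_invertible)
      have "B + \<xi> id_blinfun \<in> positive_ops" "invertible_op (B + \<xi> id_blinfun)"
        using invertible_add_positive[OF xi1 B] B xi1 by (simp_all add: add.commute)
      then obtain X where X: "X \<in> positive_ops" "invertible_op X" "\<xi> X = B + \<xi> id_blinfun"
        using xi_surjective by blast
      have "0 \<le> qf (X - id_blinfun) x" for x
      proof -
        obtain y where y: "\<psi> (rank1 x) = rank1 y" using rank1_image by blast
        have "qf X x = qf B y + (norm x)\<^sup>2"
          using qf_xi[OF X(1,2) y] qf_xi[OF _ id_invertible y] by (simp add: X(3))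
        then show ?thesis using positive_qf[OF B, of y] by simp
      qed
      then have p: "X - id_blinfun \<in> positive_ops" using X(1) by (simp add: positive_iff)
      have "\<eta> (X - id_blinfun) = B" by (simp add: \<eta>_def X(3))
      then show "B \<in> \<eta> ` positive_ops" using p by blast
    qed (use eta_positive in blast)
  qed
qed

lemma representation:
  "\<exists>T. semilinear T \<and> invertible_op T \<and> (\<forall>A\<in>positive_ops. \<psi> A = congr_op T A)"
proof -
  obtain T where T: "semilinear T" "invertible_op T" "\<And>A. A \<in> positive_ops \<Longrightarrow> \<eta> A = congr_op T A"
    using cone_automorphism.representation[OF eta_cone_automorphism] by blast
  \<comment> \<open>Inversion turns congruence by \<open>T\<close> into congruence by the inverse of
    its adjoint.\<close>
  define S where "S = inverse_op (adjoint_op T)"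
  have iT': "invertible_op (adjoint_op T)" by (rule invertible_adjoint[OF T(2,1)])
  have S: "semilinear S" "invertible_op S"
    unfolding S_def using iT' T(1) by (simp_all add: semilinear_inverse semilinear_adjoint invertible_inverse_op)
  have S': "adjoint_op S = inverse_op T"
  proof (rule adjoint_op_eqI'[OF S(1)])
    fix x y
    have "inner (T (inverse_op T y)) (S x) = inner (inverse_op T y) (adjoint_op T (S x))"
      by (rule semilinear_inner[OF T(1)])
    then show "inner (S x) y = inner x (inverse_op T y)"
      using T(2) iT' by (simp add: S_def inner_commute)
  qed
  have inv_case: "\<psi> A = congr_op S A" if A: "A \<in> positive_ops" "invertible_op A" for A
  proof -
    have I: "inverse_op A \<in> positive_ops" "invertible_op (inverse_op A)"
      using A by (simp_all add: positive_inverse invertible_inverse_op)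
    have "\<xi> (inverse_op A) = congr_op T (inverse_op A)"
    proof (rule selfadj_eqI)
      fix y
      obtain x where x: "\<psi> (rank1 x) = rank1 y" using rank1_preimage by blast
      show "qf (\<xi> (inverse_op A)) y = qf (congr_op T (inverse_op A)) y"
        using qf_xi[OF I x] qf_eta[OF I(1) x] T(3)[OF I(1)] by simp
    qed (simp_all add: positive_selfadj xi_positive I selfadj_congr_op T(1))
    then have "inverse_op (\<psi> A) = congr_op T (inverse_op A)"
      by (simp add: \<xi>_def inverse_inverse_op A)
    moreover have "invertible_op (\<psi> A)" using A by (simp add: invertible_image_iff)
    ultimately have "\<psi> A = inverse_op (congr_op T (inverse_op A))" using inverse_inverse_op by metis
    also have "\<dots> = congr_op S A"
      by (rule inverse_op_eqI) (simp_all add: congr_op_apply S'[unfolded S_def] A iT' T(2) S_def)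
    finally show ?thesis .
  qed
  \<comment> \<open>Continuity of \<open>\<psi>\<close> being unknown, the passage from invertible
    to singular operators is made through the order: this inequality removes the error term.\<close>
  have eps: "A \<sqsubseteq> B" if C: "C \<in> positive_ops" and le: "\<And>\<epsilon>. 0 < \<epsilon> \<Longrightarrow> A \<sqsubseteq> B + \<epsilon> *\<^sub>R C" for A B C :: "'a \<Rightarrow>\<^sub>L 'a"
    unfolding le_op_def
  proof (rule allI, rule field_le_epsilon)
    fix x and e :: real assume e: "0 < e"
    have k: "0 \<le> qf C x" by (rule positive_qf[OF C])
    have "qf A x \<le> qf B x + e / (qf C x + 1) * qf C x"
      using le[of "e / (qf C x + 1)"] e k by (simp add: le_op_def)
    moreover have "e / (qf C x + 1) * qf C x \<le> e" using e k by (simp add: field_simps)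
    ultimately show "qf A x \<le> qf B x + e" by linarith
  qed
  have "\<psi> A = congr_op S A" if A: "A \<in> positive_ops" for A
  proof (rule le_op_antisym)
    have sh: "A + \<epsilon> *\<^sub>R id_blinfun \<in> positive_ops" "A \<sqsubseteq> A + \<epsilon> *\<^sub>R id_blinfun"
      "\<psi> (A + \<epsilon> *\<^sub>R id_blinfun) = congr_op S A + \<epsilon> *\<^sub>R congr_op S id_blinfun" if e: "0 < \<epsilon>" for \<epsilon>
    proof -
      show p: "A + \<epsilon> *\<^sub>R id_blinfun \<in> positive_ops" using A e by simp
      show "A \<sqsubseteq> A + \<epsilon> *\<^sub>R id_blinfun" using e by (simp add: le_op_def)
      have "\<epsilon> *\<^sub>R id_blinfun \<sqsubseteq> A + \<epsilon> *\<^sub>R id_blinfun" using positive_qf[OF A] by (simp add: le_op_def)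
      then have "invertible_op (A + \<epsilon> *\<^sub>R id_blinfun)" by (rule coercive_invertible_qf[OF e])
      then show "\<psi> (A + \<epsilon> *\<^sub>R id_blinfun) = congr_op S A + \<epsilon> *\<^sub>R congr_op S id_blinfun"
        using inv_case[OF p] by (simp add: congr_op_linear)
    qed
    show "\<psi> A \<sqsubseteq> congr_op S A"
    proof (rule eps)
      show "congr_op S id_blinfun \<in> positive_ops" by (simp add: positive_congr_op S)
      show "\<psi> A \<sqsubseteq> congr_op S A + \<epsilon> *\<^sub>R congr_op S id_blinfun" if "0 < \<epsilon>" for \<epsilon>
        using mono_iff[OF A sh(1)[OF that]] sh(2,3)[OF that] by simp
    qed
    \<comment> \<open>For the lower bound the expected value is pulled back to \<open>C\<close>, and
      the error is removed in the domain instead of the range.\<close>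
    obtain C where C: "C \<in> positive_ops" "\<psi> C = congr_op S A"
      using surjective[of "congr_op S A"] A S(1) positive_congr_op by blast
    have "C \<sqsubseteq> A"
    proof (rule eps[of id_blinfun])
      fix \<epsilon> :: real assume e: "0 < \<epsilon>"
      have "\<psi> C \<sqsubseteq> \<psi> (A + \<epsilon> *\<^sub>R id_blinfun)"
        using e positive_qf[OF positive_congr_op[OF S(1)], of id_blinfun]
        by (simp add: sh(3)[OF e] C(2) le_op_def)
      then show "C \<sqsubseteq> A + \<epsilon> *\<^sub>R id_blinfun" using mono_iff[OF C(1) sh(1)[OF e]] by simp
    qed simp
    then show "congr_op S A \<sqsubseteq> \<psi> A" using mono_iff[OF C(1) A] C(2) by simp
  qed (use A S(1) in \<open>simp_all add: positive_selfadj selfadj_congr_op\<close>)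
  then show ?thesis using S by blast
qed

end

section \<open>Power means\<close>

theorem theorem4:
  fixes p :: real
  assumes "p \<in> {-1..1}" and "p \<noteq> 0"
  shows "(\<forall>\<phi> :: ('a::complex_hilbert \<Rightarrow>\<^sub>L 'a) \<Rightarrow> ('a \<Rightarrow>\<^sub>L 'a).
      bij_betw \<phi> positive_ops positive_ops \<and>
      (\<forall>A\<in>positive_ops. \<forall>B\<in>positive_ops.
        \<phi> (power_mean p A B) = power_mean p (\<phi> A) (\<phi> B))
      \<longrightarrow> (\<exists>T :: 'a \<Rightarrow>\<^sub>L 'a. (complex_linear T \<or> conjugate_linear T) \<and> invertible_op T \<and>
        (\<forall>A\<in>positive_ops. \<phi> A =
          positive_power (T o\<^sub>L positive_power A \<bar>p\<bar> o\<^sub>L adjoint_op T) (1 / \<bar>p\<bar>))))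
    \<and>
    (\<forall>(T :: 'a \<Rightarrow>\<^sub>L 'a) (\<phi> :: ('a \<Rightarrow>\<^sub>L 'a) \<Rightarrow> ('a \<Rightarrow>\<^sub>L 'a)).
      (complex_linear T \<or> conjugate_linear T) \<and> invertible_op T \<and>
      (\<forall>A\<in>positive_ops. \<phi> A =
        positive_power (T o\<^sub>L positive_power A \<bar>p\<bar> o\<^sub>L adjoint_op T) (1 / \<bar>p\<bar>))
      \<longrightarrow> (\<forall>A\<in>positive_ops. \<phi> A \<in> positive_ops) \<and>
        (\<forall>A\<in>positive_ops. \<forall>B\<in>positive_ops.
          \<phi> (power_mean p A B) = power_mean p (\<phi> A) (\<phi> B)))"
proof -
  define q where "q = \<bar>p\<bar>"
  have q: "0 < q" using assms(2) by (simp add: q_def)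
  have qr: "0 < 1 / q" "q * (1 / q) = 1" "1 / q * q = 1" using q by simp_all
  \<comment> \<open>Raising to the power \<open>q\<close> carries \<open>power_mean p\<close> to
    \<open>M\<close>, so both signs of \<open>p\<close> share one reduction.\<close>
  define M where "M X Y = (if p > 0 then (1 / 2) *\<^sub>R (X + Y) else harmonic_mean X Y)"
    for X Y :: "'a \<Rightarrow>\<^sub>L 'a"
  have M: "M X Y \<in> positive_ops" if "X \<in> positive_ops" "Y \<in> positive_ops" for X Y
    using that by (simp add: M_def)
  have mean: "power_mean p A B = positive_power (M (positive_power A q) (positive_power B q)) (1 / q)"
    for A B :: "'a \<Rightarrow>\<^sub>L 'a"
    by (simp add: power_mean_def M_def q_def)
  have pos [simp]: "positive_power A q \<in> positive_ops" "positive_power A (1 / q) \<in> positive_ops"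
    if "A \<in> positive_ops" for A :: "'a \<Rightarrow>\<^sub>L 'a"
    using that q qr(1) by simp_all
  have inv [simp]: "positive_power (positive_power A q) (1 / q) = A"
    "positive_power (positive_power A (1 / q)) q = A"
    if "A \<in> positive_ops" for A :: "'a \<Rightarrow>\<^sub>L 'a"
    by (rule positive_power_positive_power[OF that q qr(2)])
      (rule positive_power_positive_power[OF that qr(1,3)])
  have powers_bij: "bij_betw (\<lambda>A :: 'a \<Rightarrow>\<^sub>L 'a. positive_power A q) positive_ops positive_ops"
    "bij_betw (\<lambda>A :: 'a \<Rightarrow>\<^sub>L 'a. positive_power A (1 / q)) positive_ops positive_ops"
    by (rule bij_betw_byWitness[where f' = "\<lambda>A. positive_power A (1 / q)"]; auto)
      (rule bij_betw_byWitness[where f' = "\<lambda>A. positive_power A q"]; auto)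
  have form: "T o\<^sub>L positive_power A q o\<^sub>L adjoint_op T = congr_op T (positive_power A q)"
    for T A :: "'a \<Rightarrow>\<^sub>L 'a"
    by (simp add: congr_op_def)
  show ?thesis
    unfolding form q_def[symmetric] semilinear_def[symmetric]
  proof (intro conjI allI impI)
    fix \<phi> :: "('a \<Rightarrow>\<^sub>L 'a) \<Rightarrow> ('a \<Rightarrow>\<^sub>L 'a)"
    assume "bij_betw \<phi> positive_ops positive_ops \<and>
      (\<forall>A\<in>positive_ops. \<forall>B\<in>positive_ops. \<phi> (power_mean p A B) = power_mean p (\<phi> A) (\<phi> B))"
    then have bij: "bij_betw \<phi> positive_ops positive_ops"
      and hom: "\<And>A B. A \<in> positive_ops \<Longrightarrow> B \<in> positive_ops \<Longrightarrow>
        \<phi> (power_mean p A B) = power_mean p (\<phi> A) (\<phi> B)" by blast+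
    have phi_pos [simp]: "\<phi> A \<in> positive_ops" if "A \<in> positive_ops" for A
      using bij that by (auto simp: bij_betw_def)
    define \<psi> where "\<psi> X = positive_power (\<phi> (positive_power X (1 / q))) q" for X
    have bij': "bij_betw \<psi> positive_ops positive_ops"
      using bij_betw_trans[OF bij_betw_trans[OF powers_bij(2) bij] powers_bij(1)]
      by (simp add: \<psi>_def[abs_def] comp_def)
    have hom': "\<psi> (M X Y) = M (\<psi> X) (\<psi> Y)" if "X \<in> positive_ops" "Y \<in> positive_ops" for X Y
      using hom[of "positive_power X (1 / q)" "positive_power Y (1 / q)"] that
      by (simp add: mean \<psi>_def M)
    have "\<exists>T. semilinear T \<and> invertible_op T \<and> (\<forall>A\<in>positive_ops. \<psi> A = congr_op T A)"
    proof (cases "p > 0")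
      case True
      then show ?thesis using hom' by (intro arithmetic_mean_preserver bij') (simp add: M_def)
    next
      case False
      then have "harmonic_automorphism \<psi>" using hom' bij' by unfold_locales (simp_all add: M_def)
      then show ?thesis by (rule harmonic_automorphism.representation)
    qed
    then obtain T where T: "semilinear T" "invertible_op T"
        "\<And>A. A \<in> positive_ops \<Longrightarrow> \<psi> A = congr_op T A" by blast
    have "\<phi> A = positive_power (congr_op T (positive_power A q)) (1 / q)" if "A \<in> positive_ops" for A
      using that by (simp add: T(3)[symmetric] \<psi>_def)
    then show "\<exists>T. semilinear T \<and> invertible_op T \<and>
        (\<forall>A\<in>positive_ops. \<phi> A = positive_power (congr_op T (positive_power A q)) (1 / q))"
      using T(1,2) by blast
  next
    fix T :: "'a \<Rightarrow>\<^sub>L 'a" and \<phi> :: "('a \<Rightarrow>\<^sub>L 'a) \<Rightarrow> ('a \<Rightarrow>\<^sub>L 'a)"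
    assume "semilinear T \<and> invertible_op T \<and>
      (\<forall>A\<in>positive_ops. \<phi> A = positive_power (congr_op T (positive_power A q)) (1 / q))"
    then have T: "semilinear T" "invertible_op T"
      and phi: "\<And>A. A \<in> positive_ops \<Longrightarrow> \<phi> A = positive_power (congr_op T (positive_power A q)) (1 / q)"
      by blast+
    have c: "congr_op T A \<in> positive_ops" if "A \<in> positive_ops" for A
      using T(1) that by (rule positive_congr_op)
    show "\<forall>A\<in>positive_ops. \<phi> A \<in> positive_ops" by (simp add: phi c)
    \<comment> \<open>The converse rests on this invariance, together with the cancellation of the
      inner exponents \<open>1 / q\<close> and \<open>q\<close>.\<close>
    have congr_M: "congr_op T (M X Y) = M (congr_op T X) (congr_op T Y)"
      if "X \<in> positive_ops" "Y \<in> positive_ops" for X Y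
      using that by (simp add: M_def congr_op_linear harmonic_mean_congr T)
    show "\<forall>A\<in>positive_ops. \<forall>B\<in>positive_ops. \<phi> (power_mean p A B) = power_mean p (\<phi> A) (\<phi> B)"
      by (simp add: mean phi M c congr_M)
  qed
qed

end
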